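(* Let $p$ be a prime. For all $n\geq 1$, each of the cohomology rings $H^\ast(\mathrm{Aut}(F_{p^n});\mathbb{F}_p)$ and $H^\ast(GL_{p^n}(\mathbb{Z});\mathbb{F}_p)$ has the following property. If $p$ is odd, it has a non-nilpotent element of degree $2d$ for every natural number $d$ whose $p$-ary digits sum up to $k(p-1)$ for some $k\geq n$; in particular, it has a non-nilpotent element of degree $2p^n-2$. If $p=2$, the same holds with the degrees divided by $2$: it has a non-nilpotent element of degree $d$ for every natural number $d$ whose binary digits sum up to $k$ for some $k\geq n$; in particular, it has a non-nilpotent element of degree $2^n-1$.
   Context: $F_m$ denotes the free group on $m$ generators and $\mathrm{Aut}(F_m)$ its automorphism group. $H^\ast(G;\mathbb{F}_p)$ denotes group cohomology with trivial coefficients, a ring under the cup product. *)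

theory Defs
  imports
    "HOL-Algebra.Bij"
    "HOL-Algebra.QuotRing"
    "HOL-Number_Theory.Residues"
    "Jordan_Normal_Form.Matrix"
begin

section \<open>Free groups\<close>

text \<open>A letter \<open>(x, True)\<close> stands for the generator \<open>x\<close> and \<open>(x, False)\<close> for its inverse.
  The free group consists of the reduced words, multiplied by concatenation followed by
  free reduction.\<close>

fun cancels :: "'a \<times> bool \<Rightarrow> 'a \<times> bool \<Rightarrow> bool" where
  "cancels (x, b) (y, c) \<longleftrightarrow> x = y \<and> b \<noteq> c"

fun reduced :: "('a \<times> bool) list \<Rightarrow> bool" where
  "reduced (a # b # w) \<longleftrightarrow> \<not> cancels a b \<and> reduced (b # w)"
| "reduced _ \<longleftrightarrow> True"

fun cons_reduce :: "'a \<times> bool \<Rightarrow> ('a \<times> bool) list \<Rightarrow> ('a \<times> bool) list" where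
  "cons_reduce a [] = [a]"
| "cons_reduce a (b # w) = (if cancels a b then w else a # b # w)"

definition free_group :: "'a set \<Rightarrow> ('a \<times> bool) list monoid" where
  "free_group S =
    \<lparr>carrier = {w. reduced w \<and> set w \<subseteq> S \<times> UNIV},
     monoid.mult = (\<lambda>v w. foldr cons_reduce v w),
     one = []\<rparr>"

lemma cancels_iff: "cancels a b \<longleftrightarrow> fst a = fst b \<and> snd a = (\<not> snd b)"
  by (cases a; cases b) auto

lemma reduced_ConsD: "reduced (a # w) \<Longrightarrow> reduced w"
  by (cases w) auto

lemma reduced_cons_reduce: "reduced w \<Longrightarrow> reduced (cons_reduce a w)"
  by (cases w) (auto dest: reduced_ConsD)

lemma reduced_foldr: "reduced w \<Longrightarrow> reduced (foldr cons_reduce v w)"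
  by (induction v) (auto intro: reduced_cons_reduce)

lemma set_cons_reduce: "set (cons_reduce a w) \<subseteq> insert a (set w)"
  by (cases w) auto

lemma set_foldr_cons_reduce: "set (foldr cons_reduce v w) \<subseteq> set v \<union> set w"
  by (induction v) (use set_cons_reduce in fastforce)+

lemma foldr_cons_reduce_Nil: "reduced w \<Longrightarrow> foldr cons_reduce w [] = w"
proof (induction w)
  case (Cons a w)
  then show ?case by (cases w) (auto dest: reduced_ConsD)
qed simp

lemma cons_reduce_cancel:
  assumes "reduced w" "cancels a b"
  shows "cons_reduce a (cons_reduce b w) = w"
proof (cases w)
  case (Cons c u)
  show ?thesis
  proof (cases "cancels b c")
    case True
    then have "a = c" using assms(2) by (auto simp: cancels_iff prod_eq_iff)
    then show ?thesis using True Cons assms by (cases u) auto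
  qed (use Cons assms in auto)
qed (use assms in auto)

lemma foldr_cons_reduce_cons_reduce:
  assumes "reduced v" "reduced w"
  shows "foldr cons_reduce (cons_reduce a v) w = cons_reduce a (foldr cons_reduce v w)"
  using assms by (cases v) (auto simp: cons_reduce_cancel reduced_foldr reduced_ConsD)

lemma foldr_cons_reduce_assoc:
  assumes "reduced v" "reduced w"
  shows "foldr cons_reduce (foldr cons_reduce u v) w = foldr cons_reduce u (foldr cons_reduce v w)"
  using assms by (induction u) (auto simp: foldr_cons_reduce_cons_reduce reduced_foldr)

definition inverse_word :: "('a \<times> bool) list \<Rightarrow> ('a \<times> bool) list" where
  "inverse_word w = rev (map (\<lambda>(x, b). (x, \<not> b)) w)"

lemma foldr_inverse_word:
  assumes "reduced v"
  shows "foldr cons_reduce (inverse_word w) (foldr cons_reduce w v) = v"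
proof (induction w)
  case Nil
  show ?case by (simp add: inverse_word_def)
next
  case (Cons a w)
  have "cancels (case a of (x, b) \<Rightarrow> (x, \<not> b)) a" by (cases a) auto
  then show ?case
    using Cons cons_reduce_cancel[OF reduced_foldr[OF assms, of w], of "case a of (x, b) \<Rightarrow> (x, \<not> b)" a]
    by (simp add: inverse_word_def)
qed

theorem group_free_group: "group (free_group S)"
proof (rule groupI)
  fix w assume w: "w \<in> carrier (free_group S)"
  define v where "v = foldr cons_reduce (inverse_word w) []"
  have "set (inverse_word w) \<subseteq> S \<times> UNIV"
    using w by (auto simp: inverse_word_def free_group_def)
  then have "v \<in> carrier (free_group S)"
    using set_foldr_cons_reduce[of "inverse_word w" "[]"]
    by (auto simp: v_def free_group_def reduced_foldr)
  moreover have "foldr cons_reduce v w = []"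
    using w foldr_inverse_word[of "[]" w] foldr_cons_reduce_assoc[of "[]" w "inverse_word w"]
    by (simp add: v_def free_group_def foldr_cons_reduce_Nil)
  ultimately show "\<exists>v\<in>carrier (free_group S). v \<otimes>\<^bsub>free_group S\<^esub> w = \<one>\<^bsub>free_group S\<^esub>"
    by (auto simp: free_group_def)
next
  fix u v assume "u \<in> carrier (free_group S)" "v \<in> carrier (free_group S)"
  then show "u \<otimes>\<^bsub>free_group S\<^esub> v \<in> carrier (free_group S)"
    using set_foldr_cons_reduce[of u v] by (auto simp: free_group_def reduced_foldr)
qed (auto simp: free_group_def foldr_cons_reduce_assoc)

section \<open>Group cohomology with trivial coefficients\<close>

text \<open>We use the inhomogeneous (bar) cochain complex of a group \<open>G\<close> with coefficients in a ring
  \<open>R\<close> carrying the trivial action. A \<open>d\<close>-cochain is a function on \<open>d\<close>-tuples of elements of \<open>G\<close>;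
  tuples are lists. An element of the direct sum of all the cochain groups is encoded as one
  function on lists of all lengths, the restriction to lists of length \<open>d\<close> being its component of
  degree \<open>d\<close>, which must vanish for all large \<open>d\<close>.\<close>

definition cochains :: "('g, 'm) monoid_scheme \<Rightarrow> ('r, 's) ring_scheme \<Rightarrow> ('g list \<Rightarrow> 'r) set" where
  "cochains G R =
    {f \<in> lists (carrier G) \<rightarrow>\<^sub>E carrier R.
      \<exists>N. \<forall>xs\<in>lists (carrier G). N < length xs \<longrightarrow> f xs = \<zero>\<^bsub>R\<^esub>}"

text \<open>Addition is pointwise and multiplication is the cup product
  \<open>(f \<union> g)(x\<^sub>1, \<dots>, x\<^sub>m\<^sub>+\<^sub>n) = f(x\<^sub>1, \<dots>, x\<^sub>m) g(x\<^sub>m\<^sub>+\<^sub>1, \<dots>, x\<^sub>m\<^sub>+\<^sub>n)\<close> of an \<open>m\<close>-cochain and an \<open>n\<close>-cochain,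
  extended bilinearly.\<close>

definition cochain_ring ::
  "('g, 'm) monoid_scheme \<Rightarrow> ('r, 's) ring_scheme \<Rightarrow> ('g list \<Rightarrow> 'r) ring" where
  "cochain_ring G R =
    \<lparr>carrier = cochains G R,
     monoid.mult = (\<lambda>f g. \<lambda>xs\<in>lists (carrier G).
       \<Oplus>\<^bsub>R\<^esub>i\<in>{0..length xs}. f (take i xs) \<otimes>\<^bsub>R\<^esub> g (drop i xs)),
     one = (\<lambda>xs\<in>lists (carrier G). if xs = [] then \<one>\<^bsub>R\<^esub> else \<zero>\<^bsub>R\<^esub>),
     zero = (\<lambda>xs\<in>lists (carrier G). \<zero>\<^bsub>R\<^esub>),
     add = (\<lambda>f g. \<lambda>xs\<in>lists (carrier G). f xs \<oplus>\<^bsub>R\<^esub> g xs)\<rparr>"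

text \<open>\<open>(x\<^sub>1, \<dots>, x\<^sub>n) \<mapsto> (x\<^sub>1, \<dots>, x\<^sub>i x\<^sub>i\<^sub>+\<^sub>1, \<dots>, x\<^sub>n)\<close> for \<open>1 \<le> i < n\<close>; note that \<open>!\<close> counts from \<open>0\<close>.\<close>

definition merge_at :: "('g, 'm) monoid_scheme \<Rightarrow> nat \<Rightarrow> 'g list \<Rightarrow> 'g list" where
  "merge_at G i xs = take (i - 1) xs @ (xs ! (i - 1) \<otimes>\<^bsub>G\<^esub> xs ! i) # drop (i + 1) xs"

definition coboundary ::
  "('g, 'm) monoid_scheme \<Rightarrow> ('r, 's) ring_scheme \<Rightarrow> ('g list \<Rightarrow> 'r) \<Rightarrow> 'g list \<Rightarrow> 'r" where
  "coboundary G R f = (\<lambda>xs\<in>lists (carrier G).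
    if xs = [] then \<zero>\<^bsub>R\<^esub>
    else f (tl xs)
      \<oplus>\<^bsub>R\<^esub> (\<Oplus>\<^bsub>R\<^esub>i\<in>{1..<length xs}. (\<ominus>\<^bsub>R\<^esub> \<one>\<^bsub>R\<^esub>) [^]\<^bsub>R\<^esub> i \<otimes>\<^bsub>R\<^esub> f (merge_at G i xs))
      \<oplus>\<^bsub>R\<^esub> (\<ominus>\<^bsub>R\<^esub> \<one>\<^bsub>R\<^esub>) [^]\<^bsub>R\<^esub> length xs \<otimes>\<^bsub>R\<^esub> f (butlast xs))"

definition cocycles :: "('g, 'm) monoid_scheme \<Rightarrow> ('r, 's) ring_scheme \<Rightarrow> ('g list \<Rightarrow> 'r) set" where
  "cocycles G R = {f \<in> cochains G R. coboundary G R f = \<zero>\<^bsub>cochain_ring G R\<^esub>}"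

definition coboundaries :: "('g, 'm) monoid_scheme \<Rightarrow> ('r, 's) ring_scheme \<Rightarrow> ('g list \<Rightarrow> 'r) set" where
  "coboundaries G R = coboundary G R ` cochains G R"

definition cocycle_ring ::
  "('g, 'm) monoid_scheme \<Rightarrow> ('r, 's) ring_scheme \<Rightarrow> ('g list \<Rightarrow> 'r) ring" where
  "cocycle_ring G R = (cochain_ring G R)\<lparr>carrier := cocycles G R\<rparr>"

definition cohomology_ring ::
  "('g, 'm) monoid_scheme \<Rightarrow> ('r, 's) ring_scheme \<Rightarrow> ('g list \<Rightarrow> 'r) set ring" where
  "cohomology_ring G R = cocycle_ring G R Quot coboundaries G R"

definition homogeneous_cocycles ::
  "('g, 'm) monoid_scheme \<Rightarrow> ('r, 's) ring_scheme \<Rightarrow> nat \<Rightarrow> ('g list \<Rightarrow> 'r) set" where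
  "homogeneous_cocycles G R d =
    {f \<in> cocycles G R. \<forall>xs\<in>lists (carrier G). length xs \<noteq> d \<longrightarrow> f xs = \<zero>\<^bsub>R\<^esub>}"

text \<open>The degree \<open>d\<close> part of the graded ring \<^const>\<open>cohomology_ring\<close>.\<close>

definition cohomology_group ::
  "('g, 'm) monoid_scheme \<Rightarrow> ('r, 's) ring_scheme \<Rightarrow> nat \<Rightarrow> ('g list \<Rightarrow> 'r) set set" where
  "cohomology_group G R d =
    (\<lambda>f. coboundaries G R +>\<^bsub>cocycle_ring G R\<^esub> f) ` homogeneous_cocycles G R d"

definition nilpotent_element :: "('a, 'm) ring_scheme \<Rightarrow> 'a \<Rightarrow> bool" where
  "nilpotent_element A x \<longleftrightarrow> (\<exists>k::nat. 1 \<le> k \<and> x [^]\<^bsub>A\<^esub> k = \<zero>\<^bsub>A\<^esub>)"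

definition has_non_nilpotent_class ::
  "('g, 'm) monoid_scheme \<Rightarrow> ('r, 's) ring_scheme \<Rightarrow> nat \<Rightarrow> bool" where
  "has_non_nilpotent_class G R d \<longleftrightarrow>
    (\<exists>x\<in>cohomology_group G R d. \<not> nilpotent_element (cohomology_ring G R) x)"

section \<open>The groups and the digit sum\<close>

definition Aut_free_group :: "nat \<Rightarrow> ((nat \<times> bool) list \<Rightarrow> (nat \<times> bool) list) monoid" where
  "Aut_free_group m = AutoGroup (free_group {..<m})"

definition GL_int :: "nat \<Rightarrow> int mat monoid" where
  "GL_int m = units_of (ring_mat TYPE(int) m ())"

text \<open>For \<open>b \<ge> 2\<close> the \<open>i\<close>-th digit of \<open>d\<close> in base \<open>b\<close> is \<open>d div b ^ i mod b\<close>, and it is \<open>0\<close> for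
  \<open>i \<ge> d\<close> because \<open>d < b ^ d\<close>.\<close>

definition digit_sum :: "nat \<Rightarrow> nat \<Rightarrow> nat" where
  "digit_sum b d = (\<Sum>i<d. d div b ^ i mod b)"

end

theory Submission
  imports Defs "HOL-Library.Poly_Mapping" "HOL-Number_Theory.Number_Theory"
    "HOL-Computational_Algebra.Polynomial"
begin

text \<open>Fix a prime \<open>l\<close> with \<open>p\<close> dividing \<open>l - 1\<close>. Both groups act on \<open>GF(l)^m\<close> for \<open>m = p^n\<close> (the automorphism group
  through \<open>Hom(F\<^sub>m, GF(l))\<close>), and the class is the transfer, from the stabiliser of a line, of the
  \<open>d\<close>-th power of the class of degree \<open>2\<close> (of degree \<open>1\<close> if \<open>p = 2\<close>) given by the character of the
  stabiliser on its line. The group \<open>E = (\<int>/p)^n\<close> permutes the coordinates by its regular representation.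
  Its Fourier transform diagonalises \<open>E\<close>, and a line is normalised by its first nonzero Fourier
  coefficient; the number of lines with a given position of this coefficient is congruent to \<open>1\<close>
  modulo \<open>p\<close>, so the transfer restricts to \<open>E\<close> as the sum of the \<open>d\<close>-th powers of the classes of all
  characters of \<open>E\<close>.

  Such a sum is detected by evaluating cocycles on the bar cycle \<open>[t|t\<^sup>p\<^sup>-\<^sup>1|t|t\<^sup>p\<^sup>-\<^sup>1|\<dots>]\<close>, where
  \<open>t = \<Sum>\<^sub>i a\<^sub>i (g\<^sub>i - 1)\<close> has augmentation zero and \<open>t\<^sup>p = 0\<close> in the group algebra of \<open>E\<close> over a domain of
  characteristic \<open>p\<close>. Evaluation is multiplicative for cup products and sends the degree \<open>2\<close> class of
  the character with exponents \<open>b\<close> to \<open>(\<Sum>\<^sub>i a\<^sub>i b\<^sub>i)\<^sup>p\<close>. Hence the class is not nilpotent as soon as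
  \<open>\<Sum>\<^sub>b (\<Sum>\<^sub>i a\<^sub>i b\<^sub>i)\<^sup>d\<close> is nonzero for generic \<open>a\<close>. Expanding by the multinomial theorem, this
  happens if the base \<open>p\<close> digits of \<open>d\<close> can be distributed over \<open>n\<close> nonzero multiples of \<open>p - 1\<close>,
  which is the condition on the digit sum.

  Characteristic \<open>p\<close> is modelled by divisibility by \<open>p\<close> in \<open>int poly\<close>.\<close>


section \<open>Digit sums and binomial coefficients\<close>

text \<open>All digits from position \<open>d\<close> on vanish, so the cutoff is arbitrary; a
  common cutoff lets \<open>d\<close> and \<open>d div b\<close> be compared in
  \<open>digit_sum_rec\<close>.\<close>

lemma digit_sum_eq:
  assumes "b \<ge> 2" "d \<le> N"
  shows "digit_sum b d = (\<Sum>i<N. d div b ^ i mod b)"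
  unfolding digit_sum_def
proof (intro sum.mono_neutral_left ballI)
  fix i assume "i \<in> {..<N} - {..<d}"
  then have "d < b ^ i"
    using assms power_gt_expt[of b i] by simp
  then show "d div b ^ i mod b = 0" by simp
qed (use assms in auto)

lemma digit_sum_rec:
  assumes "b \<ge> 2"
  shows "digit_sum b d = d mod b + digit_sum b (d div b)"
proof -
  have "digit_sum b d = (\<Sum>i<Suc d. d div b ^ i mod b)"
    using assms by (intro digit_sum_eq) auto
  also have "\<dots> = d mod b + (\<Sum>i<d. d div b div b ^ i mod b)"
    by (simp add: sum.lessThan_Suc_shift div_mult2_eq del: sum.lessThan_Suc)
  finally show ?thesis
    using digit_sum_eq[of b "d div b" d] assms by (simp add: div_le_dividend)
qed

lemma digit_sum_0 [simp]: "digit_sum b 0 = 0"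
  by (simp add: digit_sum_def)

lemma digit_sum_mult_add:
  assumes "b \<ge> 2" "r < b"
  shows "digit_sum b (b * q + r) = r + digit_sum b q"
  using assms by (subst digit_sum_rec) auto

lemma digit_sum_small: "b \<ge> 2 \<Longrightarrow> r < b \<Longrightarrow> digit_sum b r = r"
  using digit_sum_mult_add[of b r 0] by simp

lemma digit_sum_eq_0D:
  assumes "b \<ge> 2"
  shows "digit_sum b d = 0 \<Longrightarrow> d = 0"
proof (induction d rule: less_induct)
  case (less d)
  show ?case
  proof (rule ccontr)
    assume "d \<noteq> 0"
    then have "d div b < d" using assms by simp
    then show False
      using less.IH[of "d div b"] less.prems digit_sum_rec[OF assms, of d] \<open>d \<noteq> 0\<close> by auto
  qed
qed

text \<open>Adding one turns a block of trailing digits \<open>p - 1\<close> into zeros and raises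
  the next digit. Each carry costs \<open>p - 1\<close>, and the number of carries is the
  multiplicity of \<open>p\<close> in \<open>Suc d\<close>.\<close>

lemma digit_sum_Suc:
  assumes "prime p"
  shows "digit_sum p (Suc d) + (p - 1) * multiplicity p (Suc d) = Suc (digit_sum p d)"
proof (induction d rule: less_induct)
  case (less d)
  have p: "p \<ge> 2" using assms by (rule prime_ge_2_nat)
  define q r where "q = d div p" and "r = d mod p"
  have d: "d = p * q + r" and r: "r < p" using p by (auto simp: q_def r_def)
  show ?case
  proof (cases "Suc r < p")
    case True
    have "\<not> p dvd Suc d"
      using True by (auto simp: d dvd_eq_mod_eq_0 simp flip: add_Suc_right)
    moreover have "digit_sum p (Suc d) = Suc r + digit_sum p q"
      using digit_sum_mult_add[of p "Suc r" q] p True by (simp add: d)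
    ultimately show ?thesis
      using digit_sum_mult_add[of p r q] p r by (simp add: d not_dvd_imp_multiplicity_0)
  next
    case False
    then have r': "Suc r = p" using r by simp
    then have Sd: "Suc d = p * Suc q" by (simp add: d)
    have "q < d" using d r' p by (cases q) auto
    have "multiplicity p (Suc d) = Suc (multiplicity p (Suc q))"
      unfolding Sd using assms p by (subst multiplicity_times_same) auto
    moreover have "digit_sum p (Suc d) = digit_sum p (Suc q)"
      unfolding Sd using digit_sum_mult_add[of p 0 "Suc q"] p by simp
    moreover have "digit_sum p d = p - 1 + digit_sum p q"
      using digit_sum_mult_add[of p r q] p r r' by (simp add: d)
    ultimately show ?thesis
      using less.IH[OF \<open>q < d\<close>] by (simp add: algebra_simps)
  qed
qed

text \<open>Telescoping of \<open>digit_sum_Suc\<close>, written additively to avoid subtraction in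
  \<open>nat\<close>.\<close>

lemma legendre_formula_digit_sum:
  assumes "prime p"
  shows "digit_sum p n + (p - 1) * multiplicity p (fact n :: nat) = n"
proof (induction n)
  case (Suc n)
  have "multiplicity p (fact (Suc n) :: nat) = multiplicity p (Suc n) + multiplicity p (fact n :: nat)"
    using assms by (simp add: prime_elem_multiplicity_mult_distrib del: mult_Suc)
  then show ?case
    using Suc digit_sum_Suc[OF assms, of n] by (simp add: add_mult_distrib2)
qed simp

text \<open>Kummer's theorem without carries: by Legendre's formula, \<open>p - 1\<close> times the
  multiplicity of \<open>p\<close> in the binomial coefficient is the defect of additivity of the
  digit sum, here zero.\<close>

lemma not_dvd_binomial_if_digit_sum_add:
  assumes "prime p" "j \<le> d" "digit_sum p j + digit_sum p (d - j) = digit_sum p d"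
  shows "\<not> p dvd d choose j"
proof
  assume dvd: "p dvd d choose j"
  have "multiplicity p (fact d :: nat) =
      multiplicity p (fact j * fact (d - j) * (d choose j) :: nat)"
    using binomial_fact_lemma[OF assms(2)] by simp
  also have "\<dots> = multiplicity p (fact j :: nat) + multiplicity p (fact (d - j) :: nat)
      + multiplicity p (d choose j)"
    using assms by (simp add: prime_elem_multiplicity_mult_distrib)
  finally have "(p - 1) * multiplicity p (fact d :: nat) =
      (p - 1) * multiplicity p (fact j :: nat) + (p - 1) * multiplicity p (fact (d - j) :: nat)
      + (p - 1) * multiplicity p (d choose j)"
    by (simp add: add_mult_distrib2)
  then have "(p - 1) * multiplicity p (d choose j) = 0"
    using legendre_formula_digit_sum[OF assms(1), of d]
      legendre_formula_digit_sum[OF assms(1), of j]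
      legendre_formula_digit_sum[OF assms(1), of "d - j"] assms(2,3) by linarith
  then have "multiplicity p (d choose j) = 0"
    using prime_gt_1_nat[OF assms(1)] by simp
  moreover have "multiplicity p (d choose j) > 0"
    using dvd assms prime_gt_1_nat[OF assms(1)]
    by (subst multiplicity_gt_zero_iff) auto
  ultimately show False by simp
qed

text \<open>Taking units from the lowest digits of \<open>d\<close> until \<open>s\<close> of them
  are used gives a \<open>j\<close> lying digitwise below \<open>d\<close>, so \<open>d - j\<close>
  is formed without borrowing.\<close>

lemma digit_sum_split:
  assumes "p \<ge> 2" "s \<le> digit_sum p d"
  shows "\<exists>j\<le>d. digit_sum p j = s \<and> digit_sum p j + digit_sum p (d - j) = digit_sum p d"
  using assms(2)
proof (induction d arbitrary: s rule: less_induct)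
  case (less d)
  define q r where "q = d div p" and "r = d mod p"
  have d: "d = p * q + r" and r: "r < p" using assms(1) by (auto simp: q_def r_def)
  have ds: "digit_sum p d = r + digit_sum p q"
    using digit_sum_mult_add[of p r q] assms(1) r by (simp add: d)
  show ?case
  proof (cases "s \<le> r")
    case True
    have "d - s = p * q + (r - s)" using True by (simp add: d)
    then have "digit_sum p (d - s) = r - s + digit_sum p q"
      using digit_sum_mult_add[of p "r - s" q] assms(1) r by simp
    then show ?thesis
      using True r assms(1) ds by (intro exI[of _ s]) (auto simp: digit_sum_small d)
  next
    case False
    then have "s - r \<le> digit_sum p q" "digit_sum p q \<noteq> 0" using less.prems ds by auto
    then have "0 < q" by (cases q) auto
    then have "q < p * q" using assms(1) by simp
    then have "q < d" unfolding d by linarith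
    then obtain J where J: "J \<le> q" "digit_sum p J = s - r"
      "digit_sum p J + digit_sum p (q - J) = digit_sum p q"
      using less.IH \<open>s - r \<le> digit_sum p q\<close> by blast
    have "d - (p * J + r) = p * (q - J)" by (simp add: d diff_mult_distrib2)
    then have "digit_sum p (d - (p * J + r)) = digit_sum p (q - J)"
      using digit_sum_mult_add[of p 0 "q - J"] assms(1) by simp
    moreover have "digit_sum p (p * J + r) = s"
      using digit_sum_mult_add[of p r J] assms(1) r J False by simp
    ultimately show ?thesis
      using J ds False by (intro exI[of _ "p * J + r"]) (auto simp: d)
  qed
qed

text \<open>All \<open>n\<close> digits equal \<open>p - 1\<close>; this supplies the explicit
  degrees at the end of each case of the theorem.\<close>

lemma digit_sum_power_minus_1:
  assumes "p \<ge> 2"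
  shows "digit_sum p (p ^ n - 1) = n * (p - 1)"
proof (induction n)
  case (Suc n)
  have "p * p ^ n - 1 = p * (p ^ n - 1) + (p - 1)"
  proof -
    have "p \<le> p * p ^ n" using assms by simp
    then show ?thesis using assms by (simp add: diff_mult_distrib2)
  qed
  then show ?case
    using digit_sum_mult_add[of p "p - 1" "p ^ n - 1"] assms Suc by simp
qed simp

section \<open>Power sums of linear forms\<close>

text \<open>By Fermat each of the \<open>p - 1\<close> nonzero residues contributes 1, while
  \<open>j > 0\<close> makes the term at 0 vanish.\<close>

lemma cong_sum_powers_prime:
  assumes "prime p" "j > 0" "(p - 1) dvd j"
  shows "[(\<Sum>b<p. int b ^ j) = -1] (mod int p)"
proof -
  obtain k where j: "j = (p - 1) * k" using assms(3) by auto
  have 1: "[int b ^ j = (if b = 0 then 0 else 1)] (mod int p)" if "b < p" for b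
  proof (cases "b = 0")
    case False
    then have "\<not> p dvd b" using that by (auto dest: dvd_imp_le)
    then have "[b ^ (p - 1) = 1] (mod p)" using assms(1) by (rule fermat_theorem[rotated])
    then have "[(b ^ (p - 1)) ^ k = 1 ^ k] (mod p)" by (rule cong_pow)
    then have "[b ^ j = 1] (mod p)" by (simp add: j power_mult)
    then have "[int (b ^ j) = int 1] (mod int p)" by (simp only: cong_int_iff)
    then show ?thesis using False by simp
  qed (use assms in \<open>simp add: power_0_left\<close>)
  have "[(\<Sum>b<p. int b ^ j) = (\<Sum>b<p. if b = 0 then 0 else 1)] (mod int p)"
    by (intro cong_sum 1) auto
  also have "(\<Sum>b<p. if b = 0 then 0 else 1) = int p - (1::int)"
  proof -
    have "(\<Sum>b<p. if b = 0 then 0 else 1) = (\<Sum>b\<in>{..<p} - {0}. 1 :: int)"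
      by (intro sum.mono_neutral_cong_right) auto
    then show ?thesis using prime_gt_0_nat[OF assms(1)] by (simp add: of_nat_diff)
  qed
  also have "[int p - 1 = -1] (mod int p)"
    by (simp add: cong_iff_dvd_diff)
  finally show ?thesis .
qed

lemma sum_PiE_lessThan_Suc:
  "(\<Sum>b\<in>PiE {..<Suc n} (\<lambda>_. {..<p::nat}). F b) =
    (\<Sum>c<p. \<Sum>b\<in>PiE {..<n} (\<lambda>_. {..<p}). F (b(n := c)))"
proof -
  let ?A = "PiE {..<n} (\<lambda>_. {..<p})"
  have "PiE {..<Suc n} (\<lambda>_. {..<p}) = (\<lambda>(c, b). b(n := c)) ` ({..<p} \<times> ?A)"
    by (simp add: lessThan_Suc PiE_insert_eq)
  moreover have "inj_on (\<lambda>(c, b). b(n := c)) ({..<p} \<times> ?A)"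
    using inj_combinator[of n "{..<n}" "\<lambda>_. {..<p}"] by simp
  ultimately have "(\<Sum>b\<in>PiE {..<Suc n} (\<lambda>_. {..<p}). F b) = (\<Sum>(c, b)\<in>{..<p} \<times> ?A. F (b(n := c)))"
    by (simp add: sum.reindex case_prod_unfold)
  then show ?thesis by (simp add: sum.cartesian_product)
qed

text \<open>The linear forms are evaluated at sparse powers of one indeterminate, so that the
  coefficient of a monomial in the last coordinate is itself a power sum of fewer coordinates.\<close>

lemma power_sum_linear_forms_nonzero:
  assumes "prime p"
  shows "digit_sum p d = k * (p - 1) \<Longrightarrow> n \<le> k \<Longrightarrow> (n = 0 \<Longrightarrow> k = 0) \<Longrightarrow>
    \<exists>a :: nat \<Rightarrow> int poly. \<exists>e. \<not> int p dvd
      coeff (\<Sum>b\<in>PiE {..<n} (\<lambda>_. {..<p}). (\<Sum>i<n. of_nat (b i) * a i) ^ d) e"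
proof (induction n arbitrary: d k)
  case 0
  \<comment> \<open>There is one empty tuple and the empty form is 0, so the sum is
    \<open>0 ^ d\<close>, which is nonzero only because \<open>d = 0\<close>.\<close>
  have "d = 0"
    using digit_sum_eq_0D[OF prime_ge_2_nat[OF assms], of d] 0 by simp
  then have "\<not> int p dvd coeff (\<Sum>b\<in>PiE {..<0::nat} (\<lambda>_. {..<p}). (\<Sum>i<0. of_nat (b i) * (0 :: int poly)) ^ d) 0"
    using prime_gt_1_nat[OF assms] by simp
  then show ?case by (intro exI)
next
  case (Suc n)
  have p: "p \<ge> 2" using assms by (rule prime_ge_2_nat)
  \<comment> \<open>\<open>j0\<close> is the share of the exponent given to the last coordinate. Its
    binomial coefficient is a unit modulo \<open>p\<close>, and so is the sum of the powers
    \<open>c ^ j0\<close>, since \<open>p - 1\<close> divides \<open>j0\<close>.\<close>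
  obtain j0 k0 where j0: "j0 \<le> d" "j0 > 0" "(p - 1) dvd j0" "\<not> p dvd d choose j0"
    and k0: "digit_sum p (d - j0) = k0 * (p - 1)" "n \<le> k0" "n = 0 \<Longrightarrow> k0 = 0"
  proof -
    have "(p - 1) dvd digit_sum p j \<Longrightarrow> (p - 1) dvd j" for j
      using legendre_formula_digit_sum[OF assms, of j]
      by (metis dvd_add dvd_triv_left)
    then have *: "(p - 1) dvd digit_sum p j \<Longrightarrow> digit_sum p j \<noteq> 0 \<Longrightarrow> (p - 1) dvd j \<and> j > 0" for j
      by (cases "j = 0") auto
    \<comment> \<open>The last coordinate takes digit sum \<open>p - 1\<close>; if it is the only
      one it takes everything, so that exponent 0 is left for the base case.\<close>
    define s where "s = (if n = 0 then k else 1) * (p - 1)"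
    have "s \<le> digit_sum p d" "(p - 1) dvd s" "s \<noteq> 0"
      using Suc.prems p by (auto simp: s_def)
    then obtain j where j: "j \<le> d" "digit_sum p j = s"
      "digit_sum p j + digit_sum p (d - j) = digit_sum p d"
      using digit_sum_split[OF p] by blast
    have "digit_sum p (d - j) = (if n = 0 then 0 else k - 1) * (p - 1)"
      using j Suc.prems by (auto simp: s_def diff_mult_distrib)
    moreover have "n \<le> (if n = 0 then 0 else k - 1)" using Suc.prems by auto
    ultimately show ?thesis
      using that[of j "if n = 0 then 0 else k - 1"] j *[of j] \<open>(p - 1) dvd s\<close> \<open>s \<noteq> 0\<close>
        not_dvd_binomial_if_digit_sum_add[OF assms j(1,3)] by auto
  qed
  obtain a :: "nat \<Rightarrow> int poly" and e where
    ae: "\<not> int p dvd coeff (\<Sum>b\<in>PiE {..<n} (\<lambda>_. {..<p}). (\<Sum>i<n. of_nat (b i) * a i) ^ (d - j0)) e"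
    using Suc.IH[OF k0] by blast
  define F where "F m = (\<Sum>b\<in>PiE {..<n} (\<lambda>_. {..<p}). (\<Sum>i<n. of_nat (b i) * a i) ^ m)" for m
  \<comment> \<open>\<open>M\<close> exceeds all degrees of \<open>F (d - j)\<close>, so the
    products with \<open>monom 1 (M * j)\<close> occupy disjoint ranges of degrees and the
    coefficient at \<open>M * j0 + e\<close> sees only \<open>j = j0\<close>.\<close>
  define M where "M = Suc (\<Sum>j\<le>d. degree (F (d - j)))"
  define a' where "a' = a(n := monom 1 M)"
  have M: "degree (F (d - j)) < M" if "j \<le> d" for j
    unfolding M_def less_Suc_eq_le using that by (intro member_le_sum) auto
  have "coeff (F (d - j0)) e \<noteq> 0" using ae by (auto simp: F_def)
  then have "e < M" using M[OF j0(1)] le_degree[of "F (d - j0)" e] by linarith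
  have sum_a': "(\<Sum>i<Suc n. of_nat ((b(n := c)) i) * a' i) =
      of_nat c * monom 1 M + (\<Sum>i<n. of_nat (b i) * a i)" for b c
    by (simp add: a'_def)
  have "(\<Sum>b\<in>PiE {..<Suc n} (\<lambda>_. {..<p}). (\<Sum>i<Suc n. of_nat (b i) * a' i) ^ d)
      = (\<Sum>c<p. \<Sum>b\<in>PiE {..<n} (\<lambda>_. {..<p}).
          (of_nat c * monom 1 M + (\<Sum>i<n. of_nat (b i) * a i)) ^ d)"
    by (simp only: sum_PiE_lessThan_Suc sum_a')
  also have "\<dots> = (\<Sum>c<p. \<Sum>b\<in>PiE {..<n} (\<lambda>_. {..<p}). \<Sum>j\<le>d.
      of_nat (d choose j) * (of_nat c * monom 1 M) ^ j * (\<Sum>i<n. of_nat (b i) * a i) ^ (d - j))"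
    by (simp only: binomial_ring)
  also have "\<dots> = (\<Sum>c<p. \<Sum>j\<le>d. of_nat (d choose j) * (of_nat c * monom 1 M) ^ j * F (d - j))"
    by (simp only: F_def sum_distrib_left sum.swap[of _ "{..d}"])
  also have "\<dots> = (\<Sum>j\<le>d. \<Sum>c<p. of_nat (d choose j) * (of_nat c * monom 1 M) ^ j * F (d - j))"
    by (rule sum.swap)
  also have "\<dots> = (\<Sum>j\<le>d. [:int (d choose j) * (\<Sum>c<p. int c ^ j):] * (monom 1 (M * j) * F (d - j)))"
  proof (intro sum.cong refl)
    fix j
    have "(\<Sum>c<p. of_nat (d choose j) * (of_nat c * monom 1 M) ^ j * F (d - j)) =
       (\<Sum>c<p. of_nat (d choose j) * of_nat (c ^ j)) * (monom 1 (M * j) * F (d - j))"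
      by (simp add: sum_distrib_right sum_distrib_left power_mult_distrib monom_power mult.commute
          mult.left_commute mult.assoc)
    also have "(\<Sum>c<p. of_nat (d choose j) * of_nat (c ^ j)) =
        (of_int (int (d choose j) * (\<Sum>c<p. int c ^ j)) :: int poly)"
      by (simp add: sum_distrib_left)
    also have "\<dots> = [:int (d choose j) * (\<Sum>c<p. int c ^ j):]"
      by (simp only: of_int_poly of_int_eq_id id_apply)
    finally show "(\<Sum>c<p. of_nat (d choose j) * (of_nat c * monom 1 M) ^ j * F (d - j)) =
       [:int (d choose j) * (\<Sum>c<p. int c ^ j):] * (monom 1 (M * j) * F (d - j))" .
  qed
  finally have eq: "(\<Sum>b\<in>PiE {..<Suc n} (\<lambda>_. {..<p}). (\<Sum>i<Suc n. of_nat (b i) * a' i) ^ d) =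
      (\<Sum>j\<le>d. [:int (d choose j) * (\<Sum>c<p. int c ^ j):] * (monom 1 (M * j) * F (d - j)))" .
  have "coeff (\<Sum>b\<in>PiE {..<Suc n} (\<lambda>_. {..<p}). (\<Sum>i<Suc n. of_nat (b i) * a' i) ^ d) (M * j0 + e)
      = (\<Sum>j\<le>d. int (d choose j) * (\<Sum>c<p. int c ^ j) * coeff (monom 1 (M * j) * F (d - j)) (M * j0 + e))"
    by (subst eq) (simp add: coeff_sum)
  also have "\<dots> = (\<Sum>j\<in>{j0}. int (d choose j) * (\<Sum>c<p. int c ^ j) * coeff (monom 1 (M * j) * F (d - j)) (M * j0 + e))"
  proof (intro sum.mono_neutral_right ballI)
    fix j assume j: "j \<in> {..d} - {j0}"
    have "coeff (monom 1 (M * j) * F (d - j)) (M * j0 + e) = 0"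
    proof (cases "j < j0")
      case True
      then obtain t where t: "j0 = Suc (j + t)" using less_imp_Suc_add by blast
      then have "M * j0 + e - M * j = M + (M * t + e)" by (simp add: algebra_simps)
      moreover have "degree (F (d - j)) < M + (M * t + e)" using M[of j] j by auto
      ultimately show ?thesis by (simp add: coeff_monom_mult coeff_eq_0)
    next
      case False
      then have "Suc j0 \<le> j" using j by auto
      then have "M * Suc j0 \<le> M * j" by (rule mult_le_mono2)
      then have "M * j0 + e < M * j" using \<open>e < M\<close> by simp
      then show ?thesis by (simp add: coeff_monom_mult)
    qed
    then show "int (d choose j) * (\<Sum>c<p. int c ^ j) * coeff (monom 1 (M * j) * F (d - j)) (M * j0 + e) = 0"
      by simp
  qed (use j0 in auto)
  also have "\<dots> = int (d choose j0) * (\<Sum>c<p. int c ^ j0) * coeff (F (d - j0)) e"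
    by (simp add: coeff_monom_mult)
  finally have "coeff (\<Sum>b\<in>PiE {..<Suc n} (\<lambda>_. {..<p}). (\<Sum>i<Suc n. of_nat (b i) * a' i) ^ d) (M * j0 + e)
    = int (d choose j0) * (\<Sum>c<p. int c ^ j0) * coeff (F (d - j0)) e" .
  moreover have "\<not> int p dvd int (d choose j0)" using j0 by simp
  moreover have "\<not> int p dvd (\<Sum>c<p. int c ^ j0)"
  proof
    assume *: "int p dvd (\<Sum>c<p. int c ^ j0)"
    have "[(\<Sum>c<p. int c ^ j0) = -1] (mod int p)"
      by (rule cong_sum_powers_prime) (use assms j0 in auto)
    then have "int p dvd -1" using * cong_dvd_iff by blast
    then show False using p by simp
  qed
  moreover have "\<not> int p dvd coeff (F (d - j0)) e" using ae by (simp add: F_def)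
  moreover have "prime (int p)" using assms by simp
  ultimately have "\<not> int p dvd coeff (\<Sum>b\<in>PiE {..<Suc n} (\<lambda>_. {..<p}).
      (\<Sum>i<Suc n. of_nat (b i) * a' i) ^ d) (M * j0 + e)"
    by (simp add: prime_dvd_mult_iff)
  then show ?case by blast
qed


section \<open>Frobenius modulo a prime\<close>

text \<open>Stated in an arbitrary commutative ring because it is applied both to monoid algebras
  and to their coefficients.\<close>

lemma of_nat_prime_dvd_freshmans_dream:
  fixes x y :: "'a :: comm_ring_1"
  assumes "prime p"
  shows "of_nat p dvd (x + y) ^ p - (x ^ p + y ^ p)"
proof -
  have p: "p > 0" using assms by (rule prime_gt_0_nat)
  have "(x + y) ^ p = (\<Sum>k\<le>p. of_nat (p choose k) * x ^ k * y ^ (p - k))"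
    by (rule binomial_ring)
  also have "{..p} = insert 0 (insert p {0<..<p})" using p by auto
  also have "(\<Sum>k\<in>\<dots>. of_nat (p choose k) * x ^ k * y ^ (p - k)) =
      y ^ p + (x ^ p + (\<Sum>k\<in>{0<..<p}. of_nat (p choose k) * x ^ k * y ^ (p - k)))"
    using p by simp
  finally have "(x + y) ^ p - (x ^ p + y ^ p) =
      (\<Sum>k\<in>{0<..<p}. of_nat (p choose k) * x ^ k * y ^ (p - k))"
    by simp
  moreover have "of_nat p dvd (of_nat (p choose k) :: 'a)" if "k \<in> {0<..<p}" for k
  proof -
    have "p dvd p choose k" using that assms by (intro dvd_choose_prime) auto
    then obtain c where "p choose k = p * c" by (rule dvdE)
    then show ?thesis by simp
  qed
  ultimately show ?thesis by (auto intro!: dvd_sum dvd_mult2)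
qed

lemma of_nat_prime_dvd_freshmans_dream_diff:
  fixes x y :: "'a :: comm_ring_1"
  assumes "prime p"
  shows "of_nat p dvd (x - y) ^ p - (x ^ p - y ^ p)"
proof -
  \<comment> \<open>For odd \<open>p\<close> the sum is 0; for \<open>p = 2\<close> it is
    \<open>2 * y ^ 2\<close>, so the sign is harmless modulo \<open>p\<close>.\<close>
  have "of_nat p dvd (- y) ^ p + y ^ p"
  proof (cases "p = 2")
    case True
    then have "(- y) ^ p + y ^ p = of_nat p * y ^ 2" by simp
    then show ?thesis by (metis dvd_triv_left)
  next
    case False
    then have "odd p" using assms prime_odd_nat prime_ge_2_nat by (metis le_neq_implies_less)
    then show ?thesis by simp
  qed
  from dvd_add[OF of_nat_prime_dvd_freshmans_dream[OF assms, of x "- y"] this]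
  show ?thesis by (simp add: algebra_simps)
qed

lemma of_nat_prime_dvd_freshmans_dream_sum:
  fixes f :: "'b \<Rightarrow> 'a :: comm_ring_1"
  assumes "prime p"
  shows "of_nat p dvd (\<Sum>i\<in>A. f i) ^ p - (\<Sum>i\<in>A. f i ^ p)"
proof (induction A rule: infinite_finite_induct)
  case (insert i A)
  then have "of_nat p dvd ((f i + sum f A) ^ p - (f i ^ p + sum f A ^ p))
      + (sum f A ^ p - (\<Sum>i\<in>A. f i ^ p))"
    using of_nat_prime_dvd_freshmans_dream[OF assms] by (intro dvd_add)
  then show ?case using insert by (simp add: algebra_simps)
qed (use prime_gt_0_nat[OF assms] in \<open>auto simp: power_0_left\<close>)

lemma dvd_diff_trans:
  fixes x y z :: "'a :: comm_ring_1"
  assumes "q dvd x - y" "q dvd y - z"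
  shows "q dvd x - z"
  using dvd_add[OF assms] by simp

lemma dvd_diff_sym: "q dvd x - y \<Longrightarrow> q dvd y - x" for x y :: "'a :: comm_ring_1"
  by (metis dvd_minus_iff minus_diff_eq)

lemma dvd_diffD: "q dvd x - y \<Longrightarrow> q dvd y \<Longrightarrow> q dvd x" for x y :: "'a :: comm_ring_1"
  using dvd_add[of q "x - y" y] by simp

lemma dvd_diff_mult:
  fixes x y :: "'a :: comm_ring_1"
  assumes "q dvd x - y" "q dvd x' - y'"
  shows "q dvd x * x' - y * y'"
proof -
  have "q dvd (x - y) * x' + y * (x' - y')" using assms by simp
  then show ?thesis by (simp add: algebra_simps)
qed

lemma dvd_diff_power:
  fixes x y :: "'a :: comm_ring_1"
  assumes "q dvd x - y"
  shows "q dvd x ^ n - y ^ n"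
  by (induction n) (auto intro: dvd_diff_mult[OF assms])

lemma dvd_diff_sum:
  fixes f g :: "'b \<Rightarrow> 'a :: comm_ring_1"
  assumes "\<And>i. i \<in> A \<Longrightarrow> q dvd f i - g i"
  shows "q dvd sum f A - sum g A"
  using assms by (auto simp: sum_subtractf[symmetric] intro!: dvd_sum)

section \<open>Pairing the monoid algebra with functions\<close>

lemma poly_mapping_sum_single:
  "\<alpha> = (\<Sum>e\<in>Poly_Mapping.keys \<alpha>. Poly_Mapping.single e (Poly_Mapping.lookup \<alpha> e))"
  by (intro poly_mapping_eqI) (auto simp: lookup_sum lookup_single when_def in_keys_iff)

lemma poly_mapping_single_induct [case_names single add]:
  fixes P :: "('e \<Rightarrow>\<^sub>0 'k :: comm_monoid_add) \<Rightarrow> bool"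
  assumes "\<And>e c. P (Poly_Mapping.single e c)" "\<And>\<alpha> \<beta>. P \<alpha> \<Longrightarrow> P \<beta> \<Longrightarrow> P (\<alpha> + \<beta>)"
  shows "P \<alpha>"
proof -
  have "P (\<Sum>e\<in>A. Poly_Mapping.single e (Poly_Mapping.lookup \<alpha> e))" for A
  proof (induction A rule: infinite_finite_induct)
    case (insert e A)
    then show ?case using assms by simp
  \<comment> \<open>Empty and infinite index sets give 0, which is a single with coefficient
    0.\<close>
  qed (use assms(1)[of _ 0] in auto)
  then show ?thesis by (metis poly_mapping_sum_single)
qed

text \<open>The linear extension of \<open>F\<close> to the monoid algebra. Functions on the monoid
  thus serve as linear functionals, and relations of the group can be imposed on \<open>F\<close>
  instead of on the algebra.\<close>

definition pairing :: "('e \<Rightarrow>\<^sub>0 'k) \<Rightarrow> ('e \<Rightarrow> 'k) \<Rightarrow> 'k :: comm_ring_1" where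
  "pairing \<alpha> F = (\<Sum>e\<in>Poly_Mapping.keys \<alpha>. Poly_Mapping.lookup \<alpha> e * F e)"

lemma pairing_superset:
  assumes "finite A" "Poly_Mapping.keys \<alpha> \<subseteq> A"
  shows "pairing \<alpha> F = (\<Sum>e\<in>A. Poly_Mapping.lookup \<alpha> e * F e)"
  unfolding pairing_def using assms by (intro sum.mono_neutral_left) (auto simp: in_keys_iff)

lemma pairing_add: "pairing (\<alpha> + \<beta>) F = pairing \<alpha> F + pairing \<beta> F"
proof -
  have "finite (Poly_Mapping.keys \<alpha> \<union> Poly_Mapping.keys \<beta>)" by simp
  moreover have "Poly_Mapping.keys (\<alpha> + \<beta>) \<subseteq> Poly_Mapping.keys \<alpha> \<union> Poly_Mapping.keys \<beta>" by (auto simp: in_keys_iff lookup_add)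
  ultimately show ?thesis
    by (simp add: pairing_superset[of "Poly_Mapping.keys \<alpha> \<union> Poly_Mapping.keys \<beta>"] lookup_add distrib_right sum.distrib)
qed

lemma pairing_single [simp]: "pairing (Poly_Mapping.single e c) F = c * F e"
  by (simp add: pairing_def)

lemma pairing_0 [simp]: "pairing 0 F = 0"
  by (simp add: pairing_def)

lemma pairing_1 [simp]: "pairing 1 F = F 0"
  by (simp add: pairing_def)

lemma pairing_diff: "pairing (\<alpha> - \<beta>) F = pairing \<alpha> F - pairing \<beta> F"
  using pairing_add[of "\<alpha> - \<beta>" \<beta> F] by (simp add: algebra_simps)

lemma pairing_uminus: "pairing (- \<alpha>) F = - pairing \<alpha> F"
  using pairing_diff[of 0 \<alpha> F] by simp

lemma pairing_sum: "pairing (\<Sum>i\<in>A. \<alpha> i) F = (\<Sum>i\<in>A. pairing (\<alpha> i) F)"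
  by (induction A rule: infinite_finite_induct) (auto simp: pairing_add)

lemma pairing_of_nat_mult: "pairing (of_nat m * \<alpha>) F = of_nat m * pairing \<alpha> F"
  by (induction m) (auto simp: pairing_add distrib_right)

lemma pairing_fun_add: "pairing \<alpha> (\<lambda>e. F e + G e) = pairing \<alpha> F + pairing \<alpha> G"
  by (simp add: pairing_def distrib_left sum.distrib)

lemma pairing_fun_diff: "pairing \<alpha> (\<lambda>e. F e - G e) = pairing \<alpha> F - pairing \<alpha> G"
  by (simp add: pairing_def right_diff_distrib sum_subtractf)

lemma pairing_fun_uminus: "pairing \<alpha> (\<lambda>e. - F e) = - pairing \<alpha> F"
  by (simp add: pairing_def sum_negf)

lemma pairing_fun_mult: "pairing \<alpha> (\<lambda>e. c * F e) = c * pairing \<alpha> F"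
  by (simp add: pairing_def sum_distrib_left mult.left_commute)

lemma pairing_fun_mult_right: "pairing \<alpha> (\<lambda>e. F e * c) = pairing \<alpha> F * c"
  by (simp add: pairing_def sum_distrib_right mult.assoc)

text \<open>Convolution is dual to \<open>F (e + e')\<close>; for neighbouring entries of a bar
  chain this produces the inner faces.\<close>

lemma pairing_mult:
  fixes \<alpha> \<beta> :: "'e :: comm_monoid_add \<Rightarrow>\<^sub>0 'k :: comm_ring_1"
  shows "pairing (\<alpha> * \<beta>) F = pairing \<alpha> (\<lambda>e. pairing \<beta> (\<lambda>e'. F (e + e')))"
proof (induction \<alpha> rule: poly_mapping_single_induct)
  case (single e c)
  show ?case
    by (induction \<beta> rule: poly_mapping_single_induct)
      (auto simp: mult_single distrib_left pairing_add mult.assoc)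
qed (auto simp: distrib_right pairing_add)

text \<open>Pairing with the constant 1 is the augmentation, a ring homomorphism.\<close>

lemma pairing_const_1_mult:
  fixes \<alpha> \<beta> :: "'e :: comm_monoid_add \<Rightarrow>\<^sub>0 'k :: comm_ring_1"
  shows "pairing (\<alpha> * \<beta>) (\<lambda>_. 1) = pairing \<alpha> (\<lambda>_. 1) * pairing \<beta> (\<lambda>_. 1)"
  by (simp add: pairing_mult flip: pairing_fun_mult_right)

lemma pairing_const_1_power:
  fixes \<alpha> :: "'e :: comm_monoid_add \<Rightarrow>\<^sub>0 'k :: comm_ring_1"
  shows "pairing (\<alpha> ^ m) (\<lambda>_. 1) = pairing \<alpha> (\<lambda>_. 1) ^ m"
  by (induction m) (auto simp: pairing_const_1_mult)

lemma pairing_const: "pairing \<alpha> (\<lambda>_. c) = c * pairing \<alpha> (\<lambda>_. 1)"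
  using pairing_fun_mult[of \<alpha> c "\<lambda>_. 1"] by simp

lemma dvd_pairing:
  assumes "\<And>e. q dvd F e"
  shows "q dvd pairing \<alpha> F"
  unfolding pairing_def using assms by (intro dvd_sum dvd_mult)

lemma dvd_pairing_diff:
  assumes "\<And>e. q dvd F e - G e"
  shows "q dvd pairing \<alpha> F - pairing \<alpha> G"
  using dvd_pairing[of q "\<lambda>e. F e - G e" \<alpha>] assms by (simp add: pairing_fun_diff)

lemma of_nat_dvd_pairing:
  assumes "of_nat m dvd \<alpha>"
  shows "of_nat m dvd pairing \<alpha> F"
  using assms by (auto elim!: dvdE simp: pairing_of_nat_mult)

section \<open>Functoriality of the monoid algebra\<close>

definition push_forward ::
  "('e \<Rightarrow> 'f) \<Rightarrow> ('e \<Rightarrow>\<^sub>0 'k :: comm_ring_1) \<Rightarrow> ('f :: comm_monoid_add \<Rightarrow>\<^sub>0 'k)" where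
  "push_forward h \<alpha> = (\<Sum>e\<in>Poly_Mapping.keys \<alpha>. Poly_Mapping.single (h e) (Poly_Mapping.lookup \<alpha> e))"

lemma push_forward_single [simp]:
  "push_forward h (Poly_Mapping.single e c) = Poly_Mapping.single (h e) c"
  by (simp add: push_forward_def)

lemma push_forward_add: "push_forward h (\<alpha> + \<beta>) = push_forward h \<alpha> + push_forward h \<beta>"
proof -
  have *: "push_forward h \<gamma> = (\<Sum>e\<in>Poly_Mapping.keys \<alpha> \<union> Poly_Mapping.keys \<beta>. Poly_Mapping.single (h e) (Poly_Mapping.lookup \<gamma> e))"
    if "Poly_Mapping.keys \<gamma> \<subseteq> Poly_Mapping.keys \<alpha> \<union> Poly_Mapping.keys \<beta>" for \<gamma>
    unfolding push_forward_def using that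
    by (intro sum.mono_neutral_left) (auto simp: in_keys_iff)
  have "Poly_Mapping.keys (\<alpha> + \<beta>) \<subseteq> Poly_Mapping.keys \<alpha> \<union> Poly_Mapping.keys \<beta>" by (auto simp: in_keys_iff lookup_add)
  then show ?thesis by (simp add: * lookup_add single_add sum.distrib)
qed

lemma push_forward_0 [simp]: "push_forward h 0 = 0"
  by (simp add: push_forward_def)

lemma push_forward_diff: "push_forward h (\<alpha> - \<beta>) = push_forward h \<alpha> - push_forward h \<beta>"
  using push_forward_add[of h "\<alpha> - \<beta>" \<beta>] by (simp add: algebra_simps)

lemma push_forward_sum: "push_forward h (\<Sum>i\<in>A. \<alpha> i) = (\<Sum>i\<in>A. push_forward h (\<alpha> i))"
  by (induction A rule: infinite_finite_induct) (auto simp: push_forward_add)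

lemma push_forward_mult:
  assumes "\<And>e e'. h (e + e') = h e + h e'"
  shows "push_forward h (\<alpha> * \<beta>) = push_forward h \<alpha> * push_forward h \<beta>"
proof (induction \<alpha> rule: poly_mapping_single_induct)
  case (single e c)
  show ?case
    by (induction \<beta> rule: poly_mapping_single_induct)
      (auto simp: mult_single distrib_left push_forward_add assms)
qed (auto simp: distrib_right push_forward_add)

lemma push_forward_power:
  assumes "\<And>e e'. h (e + e') = h e + h e'" "h 0 = 0"
  shows "push_forward h (\<alpha> ^ m) = push_forward h \<alpha> ^ m"
proof (induction m)
  case 0
  show ?case using push_forward_single[of h 0 1] assms(2) by simp
qed (simp add: push_forward_mult assms)

lemma pairing_push_forward: "pairing (push_forward h \<alpha>) F = pairing \<alpha> (\<lambda>e. F (h e))"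
  by (simp add: push_forward_def pairing_sum) (simp add: pairing_def)

section \<open>Evaluating inhomogeneous cochains on bar chains\<close>

text \<open>The alternating sum of the last faces of a simplex; the first face \<open>f (tl xs)\<close> is left out
  because then the definition is recursive in \<open>f\<close>.\<close>

fun last_faces :: "('g \<Rightarrow> 'g \<Rightarrow> 'g) \<Rightarrow> ('g list \<Rightarrow> int) \<Rightarrow> 'g list \<Rightarrow> int" where
  "last_faces m f [] = 0"
| "last_faces m f [x] = - f []"
| "last_faces m f (x # y # xs) = - f (m x y # xs) - last_faces m (\<lambda>zs. f (x # zs)) (y # xs)"

definition int_coboundary :: "('g \<Rightarrow> 'g \<Rightarrow> 'g) \<Rightarrow> ('g list \<Rightarrow> int) \<Rightarrow> 'g list \<Rightarrow> int" where
  "int_coboundary m f xs = (if xs = [] then 0 else f (tl xs) + last_faces m f xs)"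

text \<open>The value of a cochain on a bar chain, multilinear in the entries of the chain. Cochains
  stay integral, while the coefficients of the chain may come from a larger ring with room for
  generic parameters.\<close>

primrec bar_eval :: "('e \<Rightarrow>\<^sub>0 'k) list \<Rightarrow> ('e list \<Rightarrow> int) \<Rightarrow> 'k :: comm_ring_1" where
  "bar_eval [] f = of_int (f [])"
| "bar_eval (\<alpha> # \<alpha>s) f = pairing \<alpha> (\<lambda>e. bar_eval \<alpha>s (\<lambda>es. f (e # es)))"

lemma bar_eval_add: "bar_eval \<alpha>s (\<lambda>es. f es + g es) = bar_eval \<alpha>s f + bar_eval \<alpha>s g"
  by (induction \<alpha>s arbitrary: f g) (auto simp: pairing_fun_add)

lemma bar_eval_diff: "bar_eval \<alpha>s (\<lambda>es. f es - g es) = bar_eval \<alpha>s f - bar_eval \<alpha>s g"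
  by (induction \<alpha>s arbitrary: f g) (auto simp: pairing_fun_diff)

lemma bar_eval_uminus: "bar_eval \<alpha>s (\<lambda>es. - f es) = - bar_eval \<alpha>s f"
  by (induction \<alpha>s arbitrary: f) (auto simp: pairing_fun_uminus)

lemma bar_eval_mult_left: "bar_eval \<alpha>s (\<lambda>es. c * f es) = of_int c * bar_eval \<alpha>s f"
  by (induction \<alpha>s arbitrary: f) (auto simp: pairing_fun_mult)

lemma bar_eval_sum: "bar_eval \<alpha>s (\<lambda>es. \<Sum>i\<in>A. f i es) = (\<Sum>i\<in>A. bar_eval \<alpha>s (f i))"
proof (induction A rule: infinite_finite_induct)
  case (insert i A)
  then show ?case by (simp add: bar_eval_add)
qed (use bar_eval_mult_left[of \<alpha>s 0 "\<lambda>_. 0"] in auto)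

lemma bar_eval_cong_mod:
  assumes "\<And>es. length es = length \<alpha>s \<Longrightarrow> int m dvd f es - g es"
  shows "of_nat m dvd bar_eval \<alpha>s f - bar_eval \<alpha>s g"
  using assms
proof (induction \<alpha>s arbitrary: f g)
  case Nil
  then obtain k where "f [] - g [] = int m * k" by (auto elim: dvdE)
  then have "of_int (f []) - of_int (g []) = of_nat m * (of_int k :: 'b)"
    by (metis of_int_diff of_int_mult of_int_of_nat_eq)
  then show ?case by simp
next
  case (Cons \<alpha> \<alpha>s)
  then show ?case by (auto intro!: dvd_pairing_diff)
qed

lemma bar_eval_cup:
  "bar_eval (\<alpha>s @ \<beta>s) (\<lambda>es. f (take (length \<alpha>s) es) * g (drop (length \<alpha>s) es)) =
    bar_eval \<alpha>s f * bar_eval \<beta>s g"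
proof (induction \<alpha>s arbitrary: f)
  case (Cons \<alpha> \<alpha>s)
  show ?case using Cons.IH[of "\<lambda>es. f (_ # es)"] by (simp add: pairing_fun_mult_right)
qed (simp add: bar_eval_mult_left)

text \<open>An inner face multiplies two neighbouring entries, whose product is null modulo
  \<open>q\<close> on functions factoring through \<open>\<phi>\<close>. The last face pairs the
  last entry with a constant, which its zero augmentation kills.\<close>

lemma bar_eval_last_faces:
  fixes \<alpha>s :: "('e :: comm_monoid_add \<Rightarrow>\<^sub>0 'k :: comm_ring_1) list"
  assumes "\<And>\<alpha>. \<alpha> \<in> set \<alpha>s \<Longrightarrow> pairing \<alpha> (\<lambda>_. 1) = 0"
    and "successively (\<lambda>\<alpha> \<beta>. \<forall>F. q dvd pairing (\<alpha> * \<beta>) (\<lambda>e. F (\<phi> e))) \<alpha>s"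
    and "\<And>e e'. \<phi> (e + e') = m (\<phi> e) (\<phi> e')"
  shows "q dvd bar_eval \<alpha>s (\<lambda>es. last_faces m f (map \<phi> es))"
  using assms(1,2)
proof (induction \<alpha>s arbitrary: f rule: induct_list012)
  case 1
  then show ?case by simp
next
  case (2 \<alpha>)
  then show ?case using pairing_const[of \<alpha> "- of_int (f [])"] by simp
next
  case (3 \<alpha> \<beta> \<gamma>s)
  have "bar_eval (\<alpha> # \<beta> # \<gamma>s) (\<lambda>es. last_faces m f (map \<phi> es)) =
      - pairing (\<alpha> * \<beta>) (\<lambda>e. bar_eval \<gamma>s (\<lambda>es. f (\<phi> e # map \<phi> es)))
      - pairing \<alpha> (\<lambda>e. bar_eval (\<beta> # \<gamma>s) (\<lambda>es. last_faces m (\<lambda>zs. f (\<phi> e # zs)) (map \<phi> es)))"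
    by (simp add: bar_eval_diff bar_eval_uminus pairing_fun_diff pairing_fun_uminus pairing_mult assms(3))
  moreover have "q dvd pairing (\<alpha> * \<beta>) (\<lambda>e. bar_eval \<gamma>s (\<lambda>es. f (\<phi> e # map \<phi> es)))"
  proof -
    have "\<forall>F. q dvd pairing (\<alpha> * \<beta>) (\<lambda>e. F (\<phi> e))" using 3(4) by simp
    from spec[OF this, of "\<lambda>g. bar_eval \<gamma>s (\<lambda>es. f (g # map \<phi> es))"] show ?thesis .
  qed
  moreover have "q dvd pairing \<alpha> (\<lambda>e. bar_eval (\<beta> # \<gamma>s) (\<lambda>es. last_faces m (\<lambda>zs. f (\<phi> e # zs)) (map \<phi> es)))"
    using 3(3,4) by (intro dvd_pairing 3(2)) auto
  ultimately show ?case by (simp add: dvd_diff)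
qed

text \<open>The chain is a cycle modulo \<open>q\<close>: the remaining first face pairs the first
  entry with a constant.\<close>

lemma bar_eval_coboundary:
  fixes \<alpha>s :: "('e :: comm_monoid_add \<Rightarrow>\<^sub>0 'k :: comm_ring_1) list"
  assumes "\<And>\<alpha>. \<alpha> \<in> set \<alpha>s \<Longrightarrow> pairing \<alpha> (\<lambda>_. 1) = 0"
    and "successively (\<lambda>\<alpha> \<beta>. \<forall>F. q dvd pairing (\<alpha> * \<beta>) (\<lambda>e. F (\<phi> e))) \<alpha>s"
    and "\<And>e e'. \<phi> (e + e') = m (\<phi> e) (\<phi> e')"
  shows "q dvd bar_eval \<alpha>s (\<lambda>es. int_coboundary m f (map \<phi> es))"
proof (cases \<alpha>s)
  case (Cons \<alpha> \<beta>s)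
  have "pairing \<alpha> (\<lambda>_. bar_eval \<beta>s (\<lambda>es. f (map \<phi> es))) = 0"
    using assms(1)[of \<alpha>] Cons by (subst pairing_const) simp
  then have "bar_eval \<alpha>s (\<lambda>es. int_coboundary m f (map \<phi> es)) =
      bar_eval \<alpha>s (\<lambda>es. last_faces m f (map \<phi> es))"
    by (simp add: Cons int_coboundary_def bar_eval_add pairing_fun_add)
  then show ?thesis using bar_eval_last_faces[OF assms] by simp
qed (simp add: int_coboundary_def)

text \<open>Leibniz rule without the first face. The last face of \<open>f\<close> and the first
  face of \<open>g\<close> cancel, which is why a complete coboundary of \<open>g\<close> can appear
  on the right.\<close>

lemma last_faces_cup:
  assumes "length xs \<ge> Suc r"
  shows "last_faces m (\<lambda>xs. f (take r xs) * g (drop r xs)) xs =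
    last_faces m f (take (Suc r) xs) * g (drop (Suc r) xs) +
    (- 1) ^ r * f (take r xs) * int_coboundary m g (drop r xs)"
  using assms
proof (induction r arbitrary: f xs)
  case 0
  have "last_faces m (\<lambda>xs. c * g xs) xs = c * last_faces m g xs" for c :: int and g xs
    by (induction m g xs rule: last_faces.induct) (auto simp: algebra_simps)
  then show ?case using 0 by (cases xs) (auto simp: int_coboundary_def algebra_simps)
next
  case (Suc r)
  then obtain x y ws where xs: "xs = x # y # ws"
    by (metis Suc_le_length_iff)
  show ?case using Suc.IH[of "y # ws" "\<lambda>zs. f (x # zs)"] Suc.prems
    by (simp add: xs algebra_simps)
qed

lemma int_coboundary_cup:
  assumes "length xs \<ge> Suc r"
  shows "int_coboundary m (\<lambda>xs. f (take r xs) * g (drop r xs)) xs =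
    int_coboundary m f (take (Suc r) xs) * g (drop (Suc r) xs) +
    (- 1) ^ r * f (take r xs) * int_coboundary m g (drop r xs)"
  using assms last_faces_cup[OF assms, of m f g]
  by (cases xs) (auto simp: int_coboundary_def algebra_simps)

lemma last_faces_zero [simp]: "last_faces m (\<lambda>_. 0) xs = 0"
  by (induction m "\<lambda>_ :: 'a list. 0 :: int" xs rule: last_faces.induct) auto

lemma last_faces_eq_0:
  assumes "\<And>xs. length xs \<noteq> D \<Longrightarrow> f xs = 0" "length xs \<noteq> Suc D"
  shows "last_faces m f xs = 0"
  using assms
proof (induction m f xs arbitrary: D rule: last_faces.induct)
  case (3 m f x y xs)
  show ?case
  proof (cases D)
    case 0
    then have "f (x # zs) = 0" for zs using 3(2) by simp
    then show ?thesis using 0 3(2) by simp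
  next
    case (Suc D')
    then show ?thesis using 3(1)[of D'] 3(2,3) by simp
  qed
qed auto

lemma int_coboundary_eq_0:
  assumes "\<And>xs. length xs \<noteq> D \<Longrightarrow> f xs = 0" "length xs \<noteq> Suc D"
  shows "int_coboundary m f xs = 0"
  using last_faces_eq_0[of D f xs m] assms by (cases xs) (auto simp: int_coboundary_def)


section \<open>The augmentation element and the carry cocycle\<close>

text \<open>The group algebra of the elementary abelian group is replaced by the algebra of the free
  commutative monoid; the relations \<open>g\<^sub>i ^ p = 1\<close> enter as the periodicity of the functions with which
  elements are paired.\<close>

definition augmentation_element :: "(nat \<Rightarrow> 'k) \<Rightarrow> nat \<Rightarrow> (nat \<Rightarrow>\<^sub>0 nat) \<Rightarrow>\<^sub>0 'k :: comm_ring_1" where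
  "augmentation_element a n =
    (\<Sum>i<n. Poly_Mapping.single (Poly_Mapping.single i 1) (a i) - Poly_Mapping.single 0 (a i))"

lemma pairing_augmentation_element:
  "pairing (augmentation_element a n) F = (\<Sum>i<n. a i * (F (Poly_Mapping.single i 1) - F 0))"
  by (simp add: augmentation_element_def pairing_sum pairing_diff right_diff_distrib)

lemma single_single_power:
  "Poly_Mapping.single (Poly_Mapping.single i (1 :: nat)) (c :: 'k :: comm_ring_1) ^ m =
    Poly_Mapping.single (Poly_Mapping.single i m) (c ^ m)"
  by (induction m) (auto simp: mult_single single_add[symmetric])

lemma single_0_power:
  "Poly_Mapping.single (0 :: 'e :: comm_monoid_add) (c :: 'k :: comm_ring_1) ^ m =
    Poly_Mapping.single 0 (c ^ m)"
  by (induction m) (auto simp: mult_single)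

text \<open>Modulo \<open>p\<close> the power is the sum of the
  \<open>a\<^sub>i ^ p * (g\<^sub>i ^ p - 1)\<close>, and \<open>F\<close> does not distinguish
  \<open>g\<^sub>i ^ p\<close> from 1.\<close>

lemma dvd_pairing_augmentation_element_power:
  assumes "prime p" "\<And>i. i < n \<Longrightarrow> F (Poly_Mapping.single i p) = F 0"
  shows "of_nat p dvd pairing (augmentation_element a n ^ p) F"
proof -
  define x y where "x i = Poly_Mapping.single (Poly_Mapping.single i (1 :: nat)) (a i)"
    and "y i = (Poly_Mapping.single 0 (a i) :: (nat \<Rightarrow>\<^sub>0 nat) \<Rightarrow>\<^sub>0 'a)" for i :: nat
  have "of_nat p dvd augmentation_element a n ^ p - (\<Sum>i<n. (x i - y i) ^ p)"
    unfolding augmentation_element_def x_def y_def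
    by (rule of_nat_prime_dvd_freshmans_dream_sum[OF assms(1)])
  moreover have "of_nat p dvd (\<Sum>i<n. (x i - y i) ^ p) - (\<Sum>i<n. x i ^ p - y i ^ p)"
    by (intro dvd_diff_sum of_nat_prime_dvd_freshmans_dream_diff assms(1))
  ultimately have "of_nat p dvd augmentation_element a n ^ p - (\<Sum>i<n. x i ^ p - y i ^ p)"
    by (rule dvd_diff_trans)
  then have "of_nat p dvd pairing (augmentation_element a n ^ p - (\<Sum>i<n. x i ^ p - y i ^ p)) F"
    by (rule of_nat_dvd_pairing)
  moreover have "pairing (\<Sum>i<n. x i ^ p - y i ^ p) F = 0"
    using assms(2)
    by (simp add: pairing_sum pairing_diff x_def y_def single_single_power single_0_power
        del: One_nat_def)
  ultimately show ?thesis by (simp add: pairing_diff)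
qed

lemma single_1_power:
  "Poly_Mapping.single (1 :: nat) (1 :: 'k :: comm_ring_1) ^ m = Poly_Mapping.single m 1"
  by (induction m) (auto simp: mult_single)

text \<open>On functions of period \<open>p\<close>, multiplication by \<open>Q ^ p\<close> is
  multiplication by the \<open>p\<close>-th power of the augmentation. For a single term the power
  shifts by a multiple of \<open>p\<close>; modulo \<open>p\<close> both sides are additive in
  \<open>Q\<close>.\<close>

lemma pairing_power_mult_cong:
  fixes Q S :: "nat \<Rightarrow>\<^sub>0 'k :: comm_ring_1"
  assumes "prime p" "\<And>j k. F (k + p * j) = F k"
  shows "of_nat p dvd pairing (S * Q ^ p) F - pairing Q (\<lambda>_. 1) ^ p * pairing S F"
proof (induction Q rule: poly_mapping_single_induct)
  case (single e c)
  have "Poly_Mapping.single e c ^ m = Poly_Mapping.single (m * e) (c ^ m)" for m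
    by (induction m) (auto simp: mult_single)
  then show ?case
    using assms(2)[of _ e] by (simp add: pairing_mult pairing_fun_mult)
next
  case (add \<alpha> \<beta>)
  have "of_nat p dvd S * (\<alpha> + \<beta>) ^ p - S * (\<alpha> ^ p + \<beta> ^ p)"
    using of_nat_prime_dvd_freshmans_dream[OF assms(1), of \<alpha> \<beta>] by (intro dvd_diff_mult) auto
  then have 1: "of_nat p dvd pairing (S * (\<alpha> + \<beta>) ^ p) F - pairing (S * (\<alpha> ^ p + \<beta> ^ p)) F"
    using of_nat_dvd_pairing[of p _ F] by (simp flip: pairing_diff)
  have 2: "of_nat p dvd pairing (S * (\<alpha> ^ p + \<beta> ^ p)) F -
      (pairing \<alpha> (\<lambda>_. 1) ^ p + pairing \<beta> (\<lambda>_. 1) ^ p) * pairing S F"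
    using dvd_add[OF add] by (simp add: distrib_left distrib_right pairing_add algebra_simps)
  have 3: "of_nat p dvd (pairing \<alpha> (\<lambda>_. 1) ^ p + pairing \<beta> (\<lambda>_. 1) ^ p) * pairing S F -
      pairing (\<alpha> + \<beta>) (\<lambda>_. 1) ^ p * pairing S F"
    using dvd_diff_sym[OF of_nat_prime_dvd_freshmans_dream[OF assms(1),
          of "pairing \<alpha> (\<lambda>_. 1)" "pairing \<beta> (\<lambda>_. 1)"]]
    by (intro dvd_diff_mult) (auto simp: pairing_add)
  show ?case by (rule dvd_diff_trans[OF dvd_diff_trans[OF 1 2] 3])
qed

text \<open>Write \<open>j mod p\<close> as \<open>j - p * (j div p)\<close>. The function
  \<open>j\<close> is killed because \<open>s - 1\<close> takes differences at least twice, and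
  among the exponents up to \<open>p\<close> only \<open>p\<close> itself has a nonzero
  quotient.\<close>

lemma pairing_binomial_residue:
  fixes s :: "nat \<Rightarrow>\<^sub>0 'k :: comm_ring_1"
  assumes "p \<ge> 2"
  defines "s \<equiv> Poly_Mapping.single 1 1"
  shows "pairing ((s - 1) ^ p) (\<lambda>j. of_nat (j mod p)) = - of_nat p"
proof -
  have p: "p = Suc (p - 1)" using assms by simp
  have "pairing ((s - 1) ^ p) of_nat = pairing ((s - 1) ^ (p - 1)) (\<lambda>_. 1)"
    by (subst p, subst power_Suc) (simp add: pairing_mult pairing_diff s_def pairing_fun_add pairing_const[of _ 0])
  also have "\<dots> = 0"
    using assms(1) by (simp add: pairing_const_1_power pairing_diff s_def power_0_left)
  finally have 1: "pairing ((s - 1) ^ p) of_nat = 0" .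
  have G: "pairing (of_nat c * s ^ k * (- 1) ^ m) G = of_nat c * (- 1) ^ m * G k" for c k m G
    by (cases "even m")
      (auto simp: mult.assoc pairing_of_nat_mult pairing_uminus s_def single_1_power simp del: One_nat_def)
  have "pairing ((s - 1) ^ p) (\<lambda>j. of_nat (j div p)) =
      (\<Sum>k\<le>p. of_nat (p choose k) * (- 1) ^ (p - k) * of_nat (k div p))"
    using binomial_ring[of s "- 1" p] by (simp add: pairing_sum G)
  also have "\<dots> = (\<Sum>k\<in>{p}. of_nat (p choose k) * (- 1) ^ (p - k) * of_nat (k div p))"
    by (intro sum.mono_neutral_right) auto
  also have "\<dots> = 1" using assms by simp
  finally have 2: "pairing ((s - 1) ^ p) (\<lambda>j. of_nat (j div p)) = 1" .
  have "of_nat (j mod p) = of_nat j - of_nat p * (of_nat (j div p) :: 'k)" for j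
    by (metis add_diff_cancel_left' mult_div_mod_eq of_nat_add of_nat_mult)
  then show ?thesis by (simp add: pairing_fun_diff pairing_fun_mult 1 2)
qed

definition linear_form :: "(nat \<Rightarrow> nat) \<Rightarrow> nat \<Rightarrow> (nat \<Rightarrow>\<^sub>0 nat) \<Rightarrow> nat" where
  "linear_form b n e = (\<Sum>i<n. b i * Poly_Mapping.lookup e i)"

lemma linear_form_add: "linear_form b n (e + e') = linear_form b n e + linear_form b n e'"
  by (simp add: linear_form_def lookup_add distrib_left sum.distrib)

lemma linear_form_0 [simp]: "linear_form b n 0 = 0"
  by (simp add: linear_form_def)

lemma linear_form_single: "i < n \<Longrightarrow> linear_form b n (Poly_Mapping.single i c) = b i * c"
  by (simp add: linear_form_def lookup_single when_def if_distrib[of "(*) _"] cong: if_cong)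

text \<open>Along the linear form the augmentation element becomes \<open>(s - 1) * Q\<close>, where
  \<open>Q\<close> collects geometric sums and has augmentation the sum of the
  \<open>b i * a i\<close>. Write \<open>(s - 1) ^ p\<close> as \<open>s ^ p - 1\<close> plus
  \<open>p * S\<close>: the first part kills periodic functions, and the factor \<open>p\<close> of
  the second turns a congruence modulo \<open>p\<close> into one modulo its square.\<close>

lemma pairing_augmentation_element_power_residue:
  fixes a :: "nat \<Rightarrow> 'k :: {idom, ring_char_0}"
  assumes "prime p"
  shows "of_nat p * of_nat p dvd
    pairing (augmentation_element a n ^ p) (\<lambda>e. of_nat (linear_form b n e mod p)) +
    of_nat p * (\<Sum>i<n. of_nat (b i) * a i) ^ p"
proof -
  have p: "p \<ge> 2" using assms by (rule prime_ge_2_nat)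
  define s :: "nat \<Rightarrow>\<^sub>0 'k" where "s = Poly_Mapping.single 1 1"
  define Q where "Q = (\<Sum>i<n. \<Sum>j<b i. Poly_Mapping.single j (a i))"
  define F :: "nat \<Rightarrow> 'k" where "F j = of_nat (j mod p)" for j
  have "push_forward (linear_form b n) (augmentation_element a n) =
      (\<Sum>i<n. Poly_Mapping.single (b i) (a i) - Poly_Mapping.single 0 (a i))"
    by (simp add: augmentation_element_def push_forward_sum push_forward_diff linear_form_single)
  also have "\<dots> = (\<Sum>i<n. \<Sum>j<b i. Poly_Mapping.single (Suc j) (a i) - Poly_Mapping.single j (a i))"
    by (intro sum.cong refl sum_lessThan_telescope[symmetric])
  also have "\<dots> = (s - 1) * Q"
    by (simp add: Q_def s_def sum_distrib_left left_diff_distrib mult_single)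
  finally have push: "push_forward (linear_form b n) (augmentation_element a n) = (s - 1) * Q" .
  have "of_nat p dvd (s - 1) ^ p - (s ^ p - 1 ^ p)"
    by (rule of_nat_prime_dvd_freshmans_dream_diff[OF assms])
  then obtain S where "(s - 1) ^ p - (s ^ p - 1 ^ p) = of_nat p * S" by (rule dvdE)
  then have S: "(s - 1) ^ p = (Poly_Mapping.single p 1 - 1) + of_nat p * S"
    by (simp add: s_def single_1_power algebra_simps del: One_nat_def)
  have eq1: "pairing ((s - 1) ^ p * y) F = of_nat p * pairing (S * y) F" for y
    by (simp add: S distrib_right pairing_add mult.assoc pairing_of_nat_mult pairing_mult[of _ y]
        pairing_diff) (simp add: F_def[abs_def])
  have "of_nat p * pairing S F = - of_nat p"
    using eq1[of 1] pairing_binomial_residue[OF p, where 'k = 'k] by (simp add: s_def F_def[abs_def])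
  \<comment> \<open>The factor \<open>p\<close> cancels in a domain of characteristic zero.\<close>
  then have S1: "pairing S F = - 1"
    using p by (metis mult_cancel_left mult_minus1_right of_nat_eq_0_iff not_numeral_le_zero)
  have "pairing Q (\<lambda>_. 1) = (\<Sum>i<n. of_nat (b i) * a i)"
    by (simp add: Q_def pairing_sum)
  moreover have "of_nat p dvd pairing (S * Q ^ p) F - pairing Q (\<lambda>_. 1) ^ p * pairing S F"
    by (rule pairing_power_mult_cong[OF assms]) (simp add: F_def)
  ultimately have "of_nat p dvd pairing (S * Q ^ p) F + (\<Sum>i<n. of_nat (b i) * a i) ^ p"
    by (simp add: S1)
  then have "of_nat p * of_nat p dvd of_nat p * (pairing (S * Q ^ p) F + (\<Sum>i<n. of_nat (b i) * a i) ^ p)"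
    by (intro mult_dvd_mono) auto
  moreover have "pairing (augmentation_element a n ^ p) (\<lambda>e. of_nat (linear_form b n e mod p)) =
      of_nat p * pairing (S * Q ^ p) F"
    using pairing_push_forward[of "linear_form b n" "augmentation_element a n ^ p" F]
    by (simp add: push_forward_power linear_form_add push power_mult_distrib eq1) (simp add: F_def)
  ultimately show ?thesis by (simp add: distrib_left)
qed

text \<open>On residues below \<open>M\<close>, the cocycle of the extension of Z/M by Z in which Z
  is embedded in Z as the multiples of \<open>M\<close>. Pulled back along a character it gives the
  degree 2 class of that character.\<close>

fun carry :: "nat \<Rightarrow> nat list \<Rightarrow> int" where
  "carry M [x, y] = int ((x + y) div M)"
| "carry M _ = 0"

text \<open>With \<open>r e = linear_form b n e mod p\<close> the carry of \<open>r e + r e'\<close> is \<open>(r e + r e' - r (e + e')) / p\<close>,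
  so \<open>- p\<close> times the value on the chain is the value of \<open>r\<close> on \<open>t ^ p\<close>, which is needed modulo \<open>p\<^sup>2\<close>.\<close>

lemma bar_eval_carry:
  fixes a :: "nat \<Rightarrow> 'k :: {idom, ring_char_0}" and n :: nat
  assumes "prime p"
  defines "t \<equiv> augmentation_element a n"
  shows "of_nat p dvd bar_eval [t, t ^ (p - 1)]
      (\<lambda>es. carry p (map (\<lambda>e. linear_form b n e mod p) es)) - (\<Sum>i<n. of_nat (b i) * a i) ^ p"
proof -
  have p: "p \<ge> 2" using assms by (simp add: prime_ge_2_nat)
  define r where "r e = linear_form b n e mod p" for e
  define X where "X = bar_eval [t, t ^ (p - 1)] (\<lambda>es. carry p (map r es))"
  have carry: "of_nat p * of_nat ((r e + r e') div p) =
      (of_nat (r e) + of_nat (r e')) - (of_nat (r (e + e')) :: 'k)" for e e'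
  proof -
    have "r (e + e') = (r e + r e') mod p"
      by (simp add: r_def linear_form_add mod_add_eq)
    then have "p * ((r e + r e') div p) + r (e + e') = r e + r e'" by simp
    then show ?thesis by (metis add_diff_cancel_right' of_nat_add of_nat_mult)
  qed
  have t0: "pairing t (\<lambda>_. 1) = 0"
    by (simp add: t_def pairing_augmentation_element)
  then have t1: "pairing (t ^ (p - 1)) (\<lambda>_. 1) = 0"
    using p by (simp add: pairing_const_1_power power_0_left)
  have const: "pairing t (\<lambda>_. c) = 0" "pairing (t ^ (p - 1)) (\<lambda>_. c) = 0" for c
    using pairing_const[of t c] pairing_const[of "t ^ (p - 1)" c] t0 t1 by auto
  have "of_nat p * X = pairing t (\<lambda>e. pairing (t ^ (p - 1))
      (\<lambda>e'. of_nat p * of_nat ((r e + r e') div p)))"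
    by (simp add: X_def pairing_fun_mult flip: of_nat_add)
  also have "\<dots> = pairing t (\<lambda>e. pairing (t ^ (p - 1)) (\<lambda>_. of_nat (r e)))
      + pairing t (\<lambda>e. pairing (t ^ (p - 1)) (\<lambda>e'. of_nat (r e')))
      - pairing (t * t ^ (p - 1)) (\<lambda>e. of_nat (r e))"
    by (simp only: carry pairing_fun_add pairing_fun_diff pairing_mult)
  also have "\<dots> = - pairing (t * t ^ (p - 1)) (\<lambda>e. of_nat (r e))"
    by (simp add: const del: One_nat_def)
  also have "t * t ^ (p - 1) = t ^ p" using p by (simp flip: power_Suc)
  finally have X: "of_nat p * X = - pairing (t ^ p) (\<lambda>e. of_nat (r e))" .
  have "of_nat p * of_nat p dvd - (of_nat p * X - of_nat p * (\<Sum>i<n. of_nat (b i) * a i) ^ p)"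
    using pairing_augmentation_element_power_residue[OF assms(1), of a n b]
    by (simp add: X r_def t_def add.commute)
  then have "of_nat p * of_nat p dvd of_nat p * (X - (\<Sum>i<n. of_nat (b i) * a i) ^ p)"
    by (simp only: dvd_minus_iff right_diff_distrib)
  then have "of_nat p dvd X - (\<Sum>i<n. of_nat (b i) * a i) ^ p"
    using p by (subst (asm) dvd_mult_cancel_left) simp
  then show ?thesis by (simp add: X_def r_def)
qed


section \<open>A criterion for non-nilpotence\<close>

text \<open>The appended head makes the condition cyclic: it also covers the join between the end of
  one copy and the start of the next.\<close>

lemma successively_concat_replicate:
  assumes "successively P (xs @ [hd xs])" "xs \<noteq> []"
  shows "successively P (concat (replicate k xs) @ [hd xs])"
proof (induction k)
  case (Suc k)
  have "hd (concat (replicate k xs) @ [hd xs]) = hd xs"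
    using assms(2) by (cases k) auto
  then show ?case using Suc assms by (simp add: successively_append_iff)
qed simp

text \<open>Cochains over the residue ring are represented by total integer functions, so that
  signs, sums and coboundaries are computed in \<open>int\<close> and reduced once.\<close>

definition int_cochain :: "('g, 'm) monoid_scheme \<Rightarrow> nat \<Rightarrow> ('g list \<Rightarrow> int) \<Rightarrow> 'g list \<Rightarrow> int" where
  "int_cochain G p f = (\<lambda>xs\<in>lists (carrier G). f xs mod int p)"

lemma merge_at_1: "merge_at G (Suc 0) (x # y # xs) = (x \<otimes>\<^bsub>G\<^esub> y) # xs"
  by (simp add: merge_at_def)

lemma merge_at_Suc_Suc: "merge_at G (Suc (Suc i)) (x # xs) = x # merge_at G (Suc i) xs"
  by (simp add: merge_at_def)

lemma last_faces_eq_sum: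
  assumes "xs \<noteq> []"
  shows "last_faces (\<otimes>\<^bsub>G\<^esub>) f xs =
    (\<Sum>i\<in>{1..<length xs}. (- 1) ^ i * f (merge_at G i xs)) + (- 1) ^ length xs * f (butlast xs)"
  using assms
proof (induction "(\<otimes>\<^bsub>G\<^esub>)" f xs rule: last_faces.induct)
  case (3 f x y xs)
  have "(\<Sum>i\<in>{1..<length (x # y # xs)}. (- 1) ^ i * f (merge_at G i (x # y # xs))) =
      - f ((x \<otimes>\<^bsub>G\<^esub> y) # xs) + (\<Sum>i\<in>{Suc 1..<Suc (length (y # xs))}. (- 1) ^ i * f (merge_at G i (x # y # xs)))"
    by (subst sum.atLeast_Suc_lessThan) (auto simp: merge_at_1)
  also have "(\<Sum>i\<in>{Suc 1..<Suc (length (y # xs))}. (- 1) ^ i * f (merge_at G i (x # y # xs))) =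
      (\<Sum>i\<in>{1..<length (y # xs)}. - ((- 1) ^ i * f (x # merge_at G i (y # xs))))"
  proof (subst sum.shift_bounds_Suc_ivl, intro sum.cong refl)
    fix i assume "i \<in> {1..<length (y # xs)}"
    then obtain j where "i = Suc j" by (cases i) auto
    then show "(- 1) ^ Suc i * f (merge_at G (Suc i) (x # y # xs)) =
        - ((- 1) ^ i * f (x # merge_at G i (y # xs)))"
      by (simp add: merge_at_Suc_Suc)
  qed
  finally show ?case using 3 by (simp add: sum_negf)
qed auto

section \<open>The cochain complex over the residue ring in terms of integer representatives\<close>

context
  fixes G :: "('g, 'm) monoid_scheme" (structure) and p :: nat and R :: "int ring"
  assumes G: "monoid G" and p: "p > 1"
  defines R: "R \<equiv> residue_ring (int p)"
begin

interpretation G: monoid G by (rule G)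

interpretation residues "int p" R
  using p by unfold_locales (simp_all add: R)

lemma int_cochain_apply: "xs \<in> lists (carrier G) \<Longrightarrow> int_cochain G p f xs = f xs mod int p"
  by (simp add: int_cochain_def)

lemma cochain_ring_mult_int_cochain:
  "int_cochain G p f \<otimes>\<^bsub>cochain_ring G R\<^esub> int_cochain G p g =
    int_cochain G p (\<lambda>xs. \<Sum>i\<in>{0..length xs}. f (take i xs) * g (drop i xs))"
proof (rule ext)
  fix xs
  show "(int_cochain G p f \<otimes>\<^bsub>cochain_ring G R\<^esub> int_cochain G p g) xs =
    int_cochain G p (\<lambda>xs. \<Sum>i\<in>{0..length xs}. f (take i xs) * g (drop i xs)) xs"
  proof (cases "xs \<in> lists (carrier G)")
    case True
    then have "take i xs \<in> lists (carrier G)" "drop i xs \<in> lists (carrier G)" for i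
      using set_take_subset[of i xs] set_drop_subset[of i xs] by auto
    then show ?thesis
      using True by (simp add: cochain_ring_def int_cochain_apply mult_cong sum_cong)
  qed (simp add: cochain_ring_def int_cochain_def)
qed

lemma cochain_ring_one_int_cochain:
  "\<one>\<^bsub>cochain_ring G R\<^esub> = int_cochain G p (\<lambda>xs. if xs = [] then 1 else 0)"
  using p by (auto simp: cochain_ring_def int_cochain_def res_one_eq res_zero_eq fun_eq_iff restrict_def)

lemma cochain_ring_zero_int_cochain: "\<zero>\<^bsub>cochain_ring G R\<^esub> = int_cochain G p (\<lambda>_. 0)"
  by (auto simp: cochain_ring_def int_cochain_def res_zero_eq fun_eq_iff restrict_def)

lemma cochain_ring_zero_add_int_cochain:
  "\<zero>\<^bsub>cochain_ring G R\<^esub> \<oplus>\<^bsub>cochain_ring G R\<^esub> int_cochain G p f = int_cochain G p f"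
  by (auto simp: cochain_ring_def int_cochain_def res_zero_eq res_add_eq fun_eq_iff restrict_def)

lemma int_cochain_eq_self: "f \<in> cochains G R \<Longrightarrow> int_cochain G p f = f"
proof
  fix xs assume "f \<in> cochains G R"
  then have f: "f \<in> lists (carrier G) \<rightarrow>\<^sub>E {0..int p - 1}"
    by (simp add: cochains_def res_carrier_eq)
  show "int_cochain G p f xs = f xs"
  proof (cases "xs \<in> lists (carrier G)")
    case True
    then have "f xs \<in> {0..int p - 1}" using f by (rule PiE_mem[rotated])
    then have "f xs mod int p = f xs" by (intro mod_pos_pos_trivial) auto
    then show ?thesis by (simp only: int_cochain_apply[OF True])
  next
    case False
    then show ?thesis by (simp add: int_cochain_def PiE_arb[OF f False])
  qed
qed

lemma int_cochain_in_cochains: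
  assumes "\<And>xs. length xs \<noteq> D \<Longrightarrow> f xs = 0"
  shows "int_cochain G p f \<in> cochains G R"
proof -
  have "\<forall>xs\<in>lists (carrier G). D < length xs \<longrightarrow> int_cochain G p f xs = \<zero>\<^bsub>R\<^esub>"
    using assms by (auto simp: int_cochain_apply res_zero_eq)
  moreover have "int_cochain G p f \<in> lists (carrier G) \<rightarrow>\<^sub>E carrier R"
    by (auto simp: int_cochain_def)
  ultimately show ?thesis unfolding cochains_def by blast
qed

lemma coboundary_int_cochain:
  "coboundary G R (int_cochain G p f) = int_cochain G p (int_coboundary (\<otimes>\<^bsub>G\<^esub>) f)"
proof
  fix xs
  have sign: "(\<ominus>\<^bsub>R\<^esub> \<one>\<^bsub>R\<^esub>) [^]\<^bsub>R\<^esub> i = (- 1) ^ i mod int p" for i :: nat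
    by (metis res_neg_eq res_one_eq pow_cong)
  show "coboundary G R (int_cochain G p f) xs = int_cochain G p (int_coboundary (\<otimes>\<^bsub>G\<^esub>) f) xs"
  proof (cases "xs \<in> lists (carrier G)")
    case xs: True
    show ?thesis
    proof (cases "xs = []")
      case False
      have tl: "tl xs \<in> lists (carrier G)" "butlast xs \<in> lists (carrier G)"
        using xs by (auto dest: in_set_butlastD list.set_sel(2)[OF False])
      have merge: "merge_at G i xs \<in> lists (carrier G)" if "i \<in> {1..<length xs}" for i
      proof -
        have "xs ! (i - 1) \<in> carrier G" "xs ! i \<in> carrier G"
          using xs that by (auto simp: in_lists_conv_set)
        then show ?thesis
          using xs set_take_subset[of "i - 1" xs] set_drop_subset[of "Suc i" xs]
          by (auto simp: merge_at_def)
      qed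
      have "(\<Oplus>\<^bsub>R\<^esub>i\<in>{1..<length xs}. (\<ominus>\<^bsub>R\<^esub> \<one>\<^bsub>R\<^esub>) [^]\<^bsub>R\<^esub> i \<otimes>\<^bsub>R\<^esub> int_cochain G p f (merge_at G i xs)) =
          (\<Oplus>\<^bsub>R\<^esub>i\<in>{1..<length xs}. ((- 1) ^ i * f (merge_at G i xs)) mod int p)"
        by (intro finsum_cong') (auto simp: sign int_cochain_apply merge mult_cong)
      also have "\<dots> = (\<Sum>i\<in>{1..<length xs}. (- 1) ^ i * f (merge_at G i xs)) mod int p"
        by (rule sum_cong) simp
      finally show ?thesis
        using xs False tl
        by (simp add: coboundary_def int_cochain_apply sign mult_cong add_cong int_coboundary_def
            last_faces_eq_sum add.assoc)
    qed (simp add: coboundary_def int_cochain_def int_coboundary_def res_zero_eq)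
  qed (simp add: coboundary_def int_cochain_def)
qed

lemma zero_in_coboundaries: "\<zero>\<^bsub>cochain_ring G R\<^esub> \<in> coboundaries G R"
proof -
  have "int_coboundary (\<otimes>\<^bsub>G\<^esub>) (\<lambda>_. 0) = (\<lambda>_. 0)"
    by (auto simp: int_coboundary_def)
  then have "coboundary G R (int_cochain G p (\<lambda>_. 0)) = \<zero>\<^bsub>cochain_ring G R\<^esub>"
    by (simp add: coboundary_int_cochain cochain_ring_zero_int_cochain)
  moreover have "int_cochain G p (\<lambda>_. 0) \<in> cochains G R"
    by (rule int_cochain_in_cochains) simp
  ultimately show ?thesis unfolding coboundaries_def by (metis image_eqI)
qed

lemma int_cochain_in_coset:
  "int_cochain G p f \<in> coboundaries G R +>\<^bsub>cocycle_ring G R\<^esub> int_cochain G p f"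
proof -
  have "\<zero>\<^bsub>cochain_ring G R\<^esub> \<oplus>\<^bsub>cocycle_ring G R\<^esub> int_cochain G p f = int_cochain G p f"
    using cochain_ring_zero_add_int_cochain by (simp add: cocycle_ring_def)
  then show ?thesis
    using zero_in_coboundaries by (force simp: a_r_coset_def')
qed

primrec cup_power :: "('g list \<Rightarrow> int) \<Rightarrow> nat \<Rightarrow> 'g list \<Rightarrow> int" where
  "cup_power c 0 = (\<lambda>xs. if xs = [] then 1 else 0)"
| "cup_power c (Suc k) = (\<lambda>xs. \<Sum>i\<in>{0..length xs}. cup_power c k (take i xs) * c (drop i xs))"

text \<open>No ideal property of the coboundaries is needed here: a product of cosets in the quotient
  is a union of cosets of products of representatives.\<close>

lemma cup_power_in_power:
  "int_cochain G p (cup_power c k) \<in>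
    (coboundaries G R +>\<^bsub>cocycle_ring G R\<^esub> int_cochain G p c) [^]\<^bsub>cohomology_ring G R\<^esub> k"
proof (induction k)
  case 0
  show ?case
    using int_cochain_in_coset[of "\<lambda>xs. if xs = [] then 1 else 0"] cochain_ring_one_int_cochain
    by (simp add: cohomology_ring_def FactRing_def nat_pow_def cocycle_ring_def)
next
  case (Suc k)
  let ?I = "coboundaries G R" and ?C = "cocycle_ring G R"
  have "int_cochain G p (cup_power c (Suc k)) =
      int_cochain G p (cup_power c k) \<otimes>\<^bsub>?C\<^esub> int_cochain G p c"
    using cochain_ring_mult_int_cochain[of "cup_power c k" c] by (simp add: cocycle_ring_def)
  then have "int_cochain G p (cup_power c (Suc k)) \<in>
      ?I +>\<^bsub>?C\<^esub> (int_cochain G p (cup_power c k) \<otimes>\<^bsub>?C\<^esub> int_cochain G p c)"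
    by (metis int_cochain_in_coset)
  then show ?case
    using Suc int_cochain_in_coset[of c]
    by (auto simp: cohomology_ring_def FactRing_def nat_pow_def rcoset_mult_def)
qed

text \<open>\<open>c\<close> lives in one degree, so of all splittings in \<open>cup_power\<close>
  only the one at the end of the first \<open>k\<close> copies survives, and there evaluation is
  multiplicative.\<close>

lemma bar_eval_cup_power:
  fixes \<alpha>s :: "('e \<Rightarrow>\<^sub>0 'k :: comm_ring_1) list"
  assumes "\<And>xs. length xs \<noteq> length \<alpha>s \<Longrightarrow> c xs = 0"
  shows "bar_eval (concat (replicate k \<alpha>s)) (\<lambda>es. cup_power c k (map \<phi> es)) =
    bar_eval \<alpha>s (\<lambda>es. c (map \<phi> es)) ^ k"
proof (induction k)
  case (Suc k)
  let ?\<beta>s = "concat (replicate k \<alpha>s)"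
  have *: "concat (replicate (Suc k) \<alpha>s) = ?\<beta>s @ \<alpha>s"
    by (metis append.right_neutral concat.simps concat_append replicate_Suc replicate_append_same)
  \<comment> \<open>Modulus 0 turns the congruence lemma into an equality for functions that agree
    on tuples of the right length.\<close>
  have "of_nat 0 dvd bar_eval (?\<beta>s @ \<alpha>s) (\<lambda>es. cup_power c (Suc k) (map \<phi> es)) -
    bar_eval (?\<beta>s @ \<alpha>s) (\<lambda>es. cup_power c k (map \<phi> (take (length ?\<beta>s) es)) * c (map \<phi> (drop (length ?\<beta>s) es)))"
  proof (rule bar_eval_cong_mod)
    fix es :: "'e list" assume es: "length es = length (?\<beta>s @ \<alpha>s)"
    have "cup_power c (Suc k) (map \<phi> es) = (\<Sum>i\<in>{length ?\<beta>s}. cup_power c k (take i (map \<phi> es)) * c (drop i (map \<phi> es)))"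
      unfolding cup_power.simps using es
      by (intro sum.mono_neutral_right ballI) (auto simp: assms)
    then show "int 0 dvd cup_power c (Suc k) (map \<phi> es) -
        cup_power c k (map \<phi> (take (length ?\<beta>s) es)) * c (map \<phi> (drop (length ?\<beta>s) es))"
      by (simp add: take_map drop_map)
  qed
  then have "bar_eval (?\<beta>s @ \<alpha>s) (\<lambda>es. cup_power c (Suc k) (map \<phi> es)) =
    bar_eval (?\<beta>s @ \<alpha>s) (\<lambda>es. cup_power c k (map \<phi> (take (length ?\<beta>s) es)) * c (map \<phi> (drop (length ?\<beta>s) es)))"
    by (simp only: of_nat_0 dvd_0_left_iff right_minus_eq)
  also have "\<dots> = bar_eval ?\<beta>s (\<lambda>es. cup_power c k (map \<phi> es)) * bar_eval \<alpha>s (\<lambda>es. c (map \<phi> es))"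
    by (rule bar_eval_cup)
  finally show ?case unfolding * Suc by simp
qed simp

text \<open>Copies of the chain concatenate to cycles modulo \<open>p\<close>. If the
  \<open>k\<close>-th cup power were a coboundary, its value on \<open>k\<close> copies would vanish
  modulo \<open>p\<close>; but that value is the \<open>k\<close>-th power of the value of
  \<open>c\<close>, and \<open>p\<close> is a prime element.\<close>

lemma has_non_nilpotent_class_criterion:
  fixes \<alpha>s :: "('e :: comm_monoid_add \<Rightarrow>\<^sub>0 'k :: comm_ring_1) list"
  assumes prime: "prime_elem (of_nat p :: 'k)"
    and \<phi>: "\<And>e. \<phi> e \<in> carrier G" "\<And>e e'. \<phi> (e + e') = \<phi> e \<otimes> \<phi> e'"
    and \<alpha>s: "\<alpha>s \<noteq> []" "\<And>\<alpha>. \<alpha> \<in> set \<alpha>s \<Longrightarrow> pairing \<alpha> (\<lambda>_. 1) = 0"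
    and null: "successively (\<lambda>\<alpha> \<beta>. \<forall>F. of_nat p dvd pairing (\<alpha> * \<beta>) (\<lambda>e. F (\<phi> e))) (\<alpha>s @ [hd \<alpha>s])"
    and c: "\<And>xs. length xs \<noteq> length \<alpha>s \<Longrightarrow> c xs = 0"
      "\<And>xs. xs \<in> lists (carrier G) \<Longrightarrow> int p dvd int_coboundary (\<otimes>\<^bsub>G\<^esub>) c xs"
    and eval: "\<not> of_nat p dvd bar_eval \<alpha>s (\<lambda>es. c (map \<phi> es))"
  shows "has_non_nilpotent_class G R (length \<alpha>s)"
proof -
  let ?x = "coboundaries G R +>\<^bsub>cocycle_ring G R\<^esub> int_cochain G p c"
  let ?N = "\<lambda>\<alpha> \<beta>. \<forall>F. of_nat p dvd pairing (\<alpha> * \<beta>) (\<lambda>e. F (\<phi> e))"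
  have "coboundary G R (int_cochain G p c) = \<zero>\<^bsub>cochain_ring G R\<^esub>"
    unfolding coboundary_int_cochain cochain_ring_zero_int_cochain
    using c(2) by (auto simp: int_cochain_def restrict_def)
  then have "int_cochain G p c \<in> homogeneous_cocycles G R (length \<alpha>s)"
    using int_cochain_in_cochains[of "length \<alpha>s" c] c(1)
    by (auto simp: homogeneous_cocycles_def cocycles_def int_cochain_apply res_zero_eq)
  then have "?x \<in> cohomology_group G R (length \<alpha>s)"
    unfolding cohomology_group_def by (rule imageI)
  moreover have "\<not> nilpotent_element (cohomology_ring G R) ?x"
  proof
    assume "nilpotent_element (cohomology_ring G R) ?x"
    moreover have "\<zero>\<^bsub>cohomology_ring G R\<^esub> = coboundaries G R"
      by (simp add: cohomology_ring_def FactRing_def)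
    ultimately obtain k :: nat where "?x [^]\<^bsub>cohomology_ring G R\<^esub> k = coboundaries G R"
      unfolding nilpotent_element_def by auto
    \<comment> \<open>The zero of the quotient is the set of coboundaries itself, so every
      representative of the power lies in it.\<close>
    then have "int_cochain G p (cup_power c k) \<in> coboundaries G R"
      using cup_power_in_power[of c k] by simp
    then obtain f where f: "int_cochain G p (cup_power c k) = coboundary G R f" "f \<in> cochains G R"
      by (auto simp: coboundaries_def)
    \<comment> \<open>The arbitrary cochain \<open>f\<close> is its own integer
      representative.\<close>
    then have eq: "int_cochain G p (cup_power c k) = int_cochain G p (int_coboundary (\<otimes>\<^bsub>G\<^esub>) f)"
      using coboundary_int_cochain[of f] by (simp add: int_cochain_eq_self)
    have succ: "successively ?N (concat (replicate k \<alpha>s))"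
      using successively_concat_replicate[OF null \<alpha>s(1), of k] by (simp only: successively_append_iff)
    have "of_nat p dvd bar_eval (concat (replicate k \<alpha>s)) (\<lambda>es. cup_power c k (map \<phi> es)) -
        bar_eval (concat (replicate k \<alpha>s)) (\<lambda>es. int_coboundary (\<otimes>\<^bsub>G\<^esub>) f (map \<phi> es))"
    proof (rule bar_eval_cong_mod)
      fix es :: "'e list"
      have "map \<phi> es \<in> lists (carrier G)" using \<phi> by auto
      then have "cup_power c k (map \<phi> es) mod int p = int_coboundary (\<otimes>\<^bsub>G\<^esub>) f (map \<phi> es) mod int p"
        using fun_cong[OF eq, of "map \<phi> es"] by (simp only: int_cochain_apply)
      then show "int p dvd cup_power c k (map \<phi> es) - int_coboundary (\<otimes>\<^bsub>G\<^esub>) f (map \<phi> es)"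
        by (simp add: mod_eq_dvd_iff)
    qed
    moreover have "of_nat p dvd bar_eval (concat (replicate k \<alpha>s))
        (\<lambda>es. int_coboundary (\<otimes>\<^bsub>G\<^esub>) f (map \<phi> es))"
    proof (rule bar_eval_coboundary[where \<phi> = \<phi>])
      fix \<alpha> assume "\<alpha> \<in> set (concat (replicate k \<alpha>s))"
      then show "pairing \<alpha> (\<lambda>_. 1) = 0" using \<alpha>s(2) by auto
    qed (fact succ, fact \<phi>(2))
    ultimately have "of_nat p dvd bar_eval (concat (replicate k \<alpha>s)) (\<lambda>es. cup_power c k (map \<phi> es))"
      by (rule dvd_diffD)
    then have "of_nat p dvd bar_eval \<alpha>s (\<lambda>es. c (map \<phi> es)) ^ k"
      by (simp add: bar_eval_cup_power c(1))
    then have "of_nat p dvd bar_eval \<alpha>s (\<lambda>es. c (map \<phi> es))"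
      by (rule prime_elem_dvd_power[OF prime])
    then show False using eval by contradiction
  qed
  ultimately show ?thesis
    unfolding has_non_nilpotent_class_def by blast
qed

end


section \<open>Cup powers of a homogeneous cocycle\<close>

text \<open>For a cochain concentrated in degree \<open>r\<close> this is the \<open>d\<close>-th
  cup power with the cuts at their only possible places, in contrast to \<open>cup_power\<close>,
  which sums over all cuts.\<close>

primrec iterated_cup :: "('g list \<Rightarrow> int) \<Rightarrow> nat \<Rightarrow> nat \<Rightarrow> 'g list \<Rightarrow> int" where
  "iterated_cup \<kappa> r 0 = (\<lambda>xs. if xs = [] then 1 else 0)"
| "iterated_cup \<kappa> r (Suc d) = (\<lambda>xs. \<kappa> (take r xs) * iterated_cup \<kappa> r d (drop r xs))"

lemma iterated_cup_eq_0:
  assumes "\<And>xs. length xs \<noteq> r \<Longrightarrow> \<kappa> xs = 0" "length xs \<noteq> r * d"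
  shows "iterated_cup \<kappa> r d xs = 0"
  using assms(2)
proof (induction d arbitrary: xs)
  case (Suc d)
  show ?case
  proof (cases "length xs \<ge> r")
    case True
    then have "length (drop r xs) \<noteq> r * d" using Suc.prems by auto
    then show ?thesis using Suc.IH by simp
  next
    case False
    then show ?thesis using assms(1)[of "take r xs"] by simp
  qed
qed simp

lemma iterated_cup_cocycle:
  assumes "\<And>xs. length xs \<noteq> r \<Longrightarrow> \<kappa> xs = 0"
    and "\<And>xs. xs \<in> lists A \<Longrightarrow> q dvd int_coboundary m \<kappa> xs"
    and "xs \<in> lists A"
  shows "q dvd int_coboundary m (iterated_cup \<kappa> r d) xs"
  using assms(3)
proof (induction d arbitrary: xs)
  case 0
  show ?case
  proof (cases "length xs = Suc 0")
    case True
    then obtain x where "xs = [x]" by (auto simp: length_Suc_conv)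
    then show ?thesis by (simp add: int_coboundary_def)
  next
    case False
    then have "int_coboundary m (iterated_cup \<kappa> r 0) xs = 0"
      by (intro int_coboundary_eq_0[of 0]) auto
    then show ?thesis by simp
  qed
next
  case (Suc d)
  show ?case
  proof (cases "length xs = Suc (r * Suc d)")
    case True
    have "take (Suc r) xs \<in> lists A" "drop r xs \<in> lists A"
      using Suc.prems set_take_subset[of "Suc r" xs] set_drop_subset[of r xs] by auto
    moreover have "Suc r \<le> length xs" using True by simp
    ultimately show ?thesis
      using Suc.IH[of "drop r xs"] assms(2)[of "take (Suc r) xs"]
      by (simp add: int_coboundary_cup)
  next
    case False
    have "iterated_cup \<kappa> r (Suc d) ys = 0" if "length ys \<noteq> r * Suc d" for ys
      using assms(1) that by (rule iterated_cup_eq_0)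
    then have "int_coboundary m (iterated_cup \<kappa> r (Suc d)) xs = 0"
      using False by (rule int_coboundary_eq_0)
    then show ?thesis by simp
  qed
qed

lemma bar_eval_iterated_cup:
  "bar_eval (concat (replicate d \<alpha>s)) (\<lambda>es. iterated_cup \<kappa> (length \<alpha>s) d (map \<theta> es)) =
    bar_eval \<alpha>s (\<lambda>es. \<kappa> (map \<theta> es)) ^ d"
proof (induction d)
  case (Suc d)
  then show ?case
    using bar_eval_cup[of \<alpha>s "concat (replicate d \<alpha>s)" "\<lambda>es. \<kappa> (map \<theta> es)"
        "\<lambda>es. iterated_cup \<kappa> (length \<alpha>s) d (map \<theta> es)"]
    by (simp add: take_map drop_map)
qed simp

section \<open>Cocycles of degrees two and one on a cyclic group\<close>

lemma carry_eq_0: "length xs \<noteq> 2 \<Longrightarrow> carry M xs = 0"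
  by (cases "(M, xs)" rule: carry.cases) auto

text \<open>Either order of adding three residues produces carries with total
  \<open>(x + y + z) div M\<close>.\<close>

lemma carry_cocycle: "int_coboundary (\<lambda>x y. (x + y) mod M) (carry M) xs = 0"
proof (cases "length xs = Suc 2")
  case True
  then obtain x y z where xs: "xs = [x, y, z]"
    by (auto simp: length_Suc_conv numeral_2_eq_2)
  have *: "(u + v mod M) div M + v div M = (u + v) div M" for u v
  proof (cases "M = 0")
    case False
    have "(u + v) div M = (u + v mod M + v div M * M) div M"
      by (simp only: add.assoc mod_div_mult_eq)
    also have "\<dots> = v div M + (u + v mod M) div M"
      using False by (rule div_mult_self1)
    finally show ?thesis by simp
  qed simp
  have "(y + z) div M + (x + (y + z) mod M) div M = (x + y) div M + ((x + y) mod M + z) div M"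
    using *[of x "y + z"] *[of z "x + y"] by (simp add: ac_simps)
  then have "int ((y + z) div M) + int ((x + (y + z) mod M) div M) =
      int ((x + y) div M) + int (((x + y) mod M + z) div M)"
    by (metis of_nat_add)
  then show ?thesis by (simp add: xs int_coboundary_def)
next
  case False
  then show ?thesis using carry_eq_0 by (intro int_coboundary_eq_0[of 2]) auto
qed

text \<open>The tautological degree 1 cocycle of Z/M with values modulo \<open>M\<close>; it takes
  the place of \<open>carry\<close> when \<open>p = 2\<close>.\<close>

fun single_entry :: "nat list \<Rightarrow> int" where
  "single_entry [x] = int x"
| "single_entry _ = 0"

lemma single_entry_eq_0: "length xs \<noteq> 1 \<Longrightarrow> single_entry xs = 0"
  by (cases xs rule: single_entry.cases) auto

lemma single_entry_cocycle: "int M dvd int_coboundary (\<lambda>x y. (x + y) mod M) single_entry xs"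
proof (cases "length xs = Suc 1")
  case True
  then obtain x y where xs: "xs = [x, y]"
    by (auto simp: length_Suc_conv)
  have "int_coboundary (\<lambda>x y. (x + y) mod M) single_entry xs = int (x + y) - int (x + y) mod int M"
    by (simp add: xs int_coboundary_def zmod_int)
  then show ?thesis by (simp add: minus_mod_eq_mult_div)
next
  case False
  then have "int_coboundary (\<lambda>x y. (x + y) mod M) single_entry xs = 0"
    using single_entry_eq_0 by (intro int_coboundary_eq_0[of 1]) auto
  then show ?thesis by simp
qed

section \<open>Transfer along a finite right action\<close>

text \<open>A right action \<open>T\<close> on a finite set \<open>P\<close> together with a cocycle \<open>\<theta>\<close> on the action groupoid turns
  a tuple of group elements and a starting point in \<open>P\<close> into a tuple of residues. Pulling a cocycle
  back along this map and summing over \<open>P\<close> is the transfer from the point stabilisers.\<close>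

primrec groupoid_path :: "('x \<Rightarrow> 'g \<Rightarrow> 'x) \<Rightarrow> ('x \<Rightarrow> 'g \<Rightarrow> 'a) \<Rightarrow> 'x \<Rightarrow> 'g list \<Rightarrow> 'a list" where
  "groupoid_path T \<theta> v [] = []"
| "groupoid_path T \<theta> v (g # gs) = \<theta> v g # groupoid_path T \<theta> (T v g) gs"

lemma length_groupoid_path [simp]: "length (groupoid_path T \<theta> v gs) = length gs"
  by (induction gs arbitrary: v) auto

lemma groupoid_path_in_lists:
  assumes "\<And>v g. v \<in> P \<Longrightarrow> g \<in> C \<Longrightarrow> T v g \<in> P" "\<And>v g. v \<in> P \<Longrightarrow> g \<in> C \<Longrightarrow> \<theta> v g \<in> A"
    and "v \<in> P" "gs \<in> lists C"
  shows "groupoid_path T \<theta> v gs \<in> lists A"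
  using assms(3,4) by (induction gs arbitrary: v) (auto simp: assms(1,2))

lemma last_faces_sum:
  "last_faces m (\<lambda>xs. \<Sum>v\<in>P. f v xs) xs = (\<Sum>v\<in>P. last_faces m (f v) xs)"
  by (induction m "\<lambda>xs. \<Sum>v\<in>P. f v xs" xs arbitrary: f rule: last_faces.induct)
    (auto simp: sum_negf sum_subtractf)

lemma last_faces_groupoid_path:
  assumes "\<And>v g h. v \<in> P \<Longrightarrow> g \<in> C \<Longrightarrow> h \<in> C \<Longrightarrow> T v (m g h) = T (T v g) h"
    and "\<And>v g h. v \<in> P \<Longrightarrow> g \<in> C \<Longrightarrow> h \<in> C \<Longrightarrow> \<theta> v (m g h) = m' (\<theta> v g) (\<theta> (T v g) h)"
    and "\<And>v g. v \<in> P \<Longrightarrow> g \<in> C \<Longrightarrow> T v g \<in> P"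
    and "v \<in> P" "xs \<in> lists C"
  shows "last_faces m (\<lambda>xs. Y (groupoid_path T \<theta> v xs)) xs = last_faces m' Y (groupoid_path T \<theta> v xs)"
  using assms(4,5)
proof (induction xs arbitrary: v Y rule: induct_list012)
  case (3 x y xs)
  then have "T v x \<in> P" "y # xs \<in> lists C" by (auto intro: assms(3))
  then show ?case
    using 3(2)[of "T v x" "\<lambda>zs. Y (\<theta> v x # zs)"] 3(3,4) by (simp add: assms(1,2))
qed auto

text \<open>All faces but the first keep the starting point. The first face moves it from
  \<open>v\<close> to \<open>T v g\<close>, and the sum over \<open>P\<close> absorbs this because
  \<open>g\<close> permutes \<open>P\<close>.\<close>

lemma transfer_cocycle:
  assumes T: "\<And>v g h. v \<in> P \<Longrightarrow> g \<in> C \<Longrightarrow> h \<in> C \<Longrightarrow> T v (m g h) = T (T v g) h"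
    and \<theta>: "\<And>v g h. v \<in> P \<Longrightarrow> g \<in> C \<Longrightarrow> h \<in> C \<Longrightarrow> \<theta> v (m g h) = m' (\<theta> v g) (\<theta> (T v g) h)"
    and bij: "\<And>g. g \<in> C \<Longrightarrow> bij_betw (\<lambda>v. T v g) P P"
    and A: "\<And>v g. v \<in> P \<Longrightarrow> g \<in> C \<Longrightarrow> \<theta> v g \<in> A"
    and Y: "\<And>xs. xs \<in> lists A \<Longrightarrow> q dvd int_coboundary m' Y xs"
    and xs: "xs \<in> lists C"
  shows "q dvd int_coboundary m (\<lambda>xs. \<Sum>v\<in>P. Y (groupoid_path T \<theta> v xs)) xs"
proof (cases xs)
  case (Cons g gs)
  then have g: "g \<in> C" using xs by simp
  have P: "\<And>v g. v \<in> P \<Longrightarrow> g \<in> C \<Longrightarrow> T v g \<in> P"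
    using bij by (auto dest: bij_betwE)
  have "(\<Sum>v\<in>P. Y (groupoid_path T \<theta> v gs)) = (\<Sum>v\<in>P. Y (groupoid_path T \<theta> (T v g) gs))"
    by (rule sum.reindex_bij_betw[OF bij[OF g], symmetric])
  moreover have "(\<Sum>v\<in>P. last_faces m (\<lambda>xs. Y (groupoid_path T \<theta> v xs)) xs) =
      (\<Sum>v\<in>P. last_faces m' Y (groupoid_path T \<theta> v xs))"
    by (intro sum.cong refl last_faces_groupoid_path[where P = P and C = C])
      (use T \<theta> P xs in auto)
  ultimately have "int_coboundary m (\<lambda>xs. \<Sum>v\<in>P. Y (groupoid_path T \<theta> v xs)) xs =
      (\<Sum>v\<in>P. int_coboundary m' Y (groupoid_path T \<theta> v xs))"
    by (simp add: int_coboundary_def Cons last_faces_sum sum.distrib)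
  moreover have "groupoid_path T \<theta> v xs \<in> lists A" if "v \<in> P" for v
    using P A that xs by (rule groupoid_path_in_lists)
  ultimately show ?thesis using Y by (auto intro!: dvd_sum)
qed (simp add: int_coboundary_def)

text \<open>Along \<open>\<phi>\<close> points may move, but only within a fibre of
  \<open>\<kappa>\<close>, and the residues depend on the fibre alone. Each fibre therefore
  contributes its cardinality, which is 1 modulo \<open>p\<close>, times one common value.\<close>

lemma sum_groupoid_path_cong:
  fixes Y :: "nat list \<Rightarrow> int"
  assumes "finite P" "finite K" "\<And>v. v \<in> P \<Longrightarrow> \<kappa> v \<in> K"
    and "\<And>v e. v \<in> P \<Longrightarrow> T v (\<phi> e) \<in> P \<and> \<kappa> (T v (\<phi> e)) = \<kappa> v \<and> \<theta> v (\<phi> e) = \<theta>' (\<kappa> v) e"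
    and "\<And>k. k \<in> K \<Longrightarrow> [card {v \<in> P. \<kappa> v = k} = 1] (mod p)"
  shows "int p dvd (\<Sum>v\<in>P. Y (groupoid_path T \<theta> v (map \<phi> es))) - (\<Sum>k\<in>K. Y (map (\<theta>' k) es))"
proof -
  have path: "v \<in> P \<Longrightarrow> groupoid_path T \<theta> v (map \<phi> es) = map (\<theta>' (\<kappa> v)) es" for v
    by (induction es arbitrary: v) (auto simp: assms(4))
  have "(\<Sum>v\<in>P. Y (groupoid_path T \<theta> v (map \<phi> es))) = (\<Sum>v\<in>P. Y (map (\<theta>' (\<kappa> v)) es))"
    by (intro sum.cong refl) (simp add: path)
  also have "\<dots> = (\<Sum>k\<in>K. \<Sum>v\<in>{v \<in> P. \<kappa> v = k}. Y (map (\<theta>' (\<kappa> v)) es))"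
    using assms(1-3) by (intro sum.group[symmetric]) auto
  also have "\<dots> = (\<Sum>k\<in>K. int (card {v \<in> P. \<kappa> v = k}) * Y (map (\<theta>' k) es))"
    by (intro sum.cong refl) simp
  finally have "(\<Sum>v\<in>P. Y (groupoid_path T \<theta> v (map \<phi> es))) - (\<Sum>k\<in>K. Y (map (\<theta>' k) es)) =
      (\<Sum>k\<in>K. (int (card {v \<in> P. \<kappa> v = k}) - 1) * Y (map (\<theta>' k) es))"
    by (simp add: left_diff_distrib sum_subtractf)
  moreover have "int p dvd int (card {v \<in> P. \<kappa> v = k}) - 1" if "k \<in> K" for k
    using assms(5)[OF that] by (metis cong_iff_dvd_diff cong_int_iff of_nat_1)
  ultimately show ?thesis by (auto intro!: dvd_sum)
qed


section \<open>Primes congruent to one and discrete logarithms\<close>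

text \<open>Any prime factor \<open>l\<close> of \<open>1 + p + \<dots> + p ^ (p - 1)\<close> works.
  The order of \<open>p\<close> modulo \<open>l\<close> divides \<open>p\<close>; if it were 1, the
  sum would be congruent to \<open>p\<close>, hence to 1, modulo \<open>l\<close>. So the order is
  \<open>p\<close>, and it divides \<open>l - 1\<close>.\<close>

lemma ex_prime_cong_1:
  fixes p :: nat
  assumes "prime p"
  shows "\<exists>l. prime l \<and> p dvd l - 1"
proof -
  define N where "N = (\<Sum>i<p. p ^ i)"
  have p: "p \<ge> 2" using assms by (rule prime_ge_2_nat)
  have "1 + p = (\<Sum>i\<in>{0, 1}. p ^ i)" by simp
  also have "\<dots> \<le> N" unfolding N_def using p by (intro sum_mono2) auto
  finally have "N \<noteq> 1" using p by simp
  then obtain l where l: "prime l" "l dvd N" using prime_factor_nat by blast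
  have "int p ^ p - 1 = (int p - 1) * int N"
    by (simp add: N_def power_diff_1_eq)
  then have "int l dvd int (p ^ p) - int 1" using l(2) by simp
  then have "[p ^ p = 1] (mod l)" by (metis cong_iff_dvd_diff cong_int_iff)
  then have ord: "ord l p dvd p" by (simp only: ord_divides)
  have "ord l p \<noteq> 1"
  proof
    assume "ord l p = 1"
    then have *: "[p = 1] (mod l)" using ord_divides[of p 1 l] by simp
    then have "[N = (\<Sum>i<p. 1 ^ i)] (mod l)" unfolding N_def by (intro cong_sum cong_pow)
    then have "[N = 1] (mod l)" using * by (auto intro: cong_trans)
    then have "l dvd 1" using l(2) cong_dvd_iff by blast
    then show False using l(1) by simp
  qed
  then have "ord l p = p" using ord assms prime_nat_iff by blast
  moreover have "coprime l p"
    using \<open>[p ^ p = 1] (mod l)\<close> p cong_imp_coprime[OF cong_sym, of "p ^ p" 1 l]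
    by (auto simp: coprime_commute coprime_power_left_iff)
  ultimately have "p dvd l - 1"
    using order_divides_totient[of l p] l(1) by (simp add: totient_prime)
  then show ?thesis using l(1) by blast
qed

text \<open>\<open>lg\<close> is the index with respect to a primitive root, \<open>\<omega>\<close>
  is its power with exponent \<open>(l - 1) div p\<close>, and \<open>\<eta>\<close> is inverse to
  \<open>\<omega>\<close>. The last clause places the logarithms of the powers of
  \<open>\<omega>\<close> in the subgroup of order \<open>p\<close> of Z/(l - 1).\<close>

lemma ex_discrete_log:
  fixes l p :: nat
  assumes "prime l" "p dvd l - 1" "p > 0"
  shows "\<exists>(lg :: int \<Rightarrow> nat) (\<omega> :: int) (\<eta> :: int).
    (\<forall>x\<in>{1..<int l}. lg x < l - 1) \<and>
    (\<forall>x\<in>{1..<int l}. \<forall>y\<in>{1..<int l}. lg (x * y mod int l) = (lg x + lg y) mod (l - 1)) \<and>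
    [\<omega> ^ p = 1] (mod int l) \<and> [\<eta> ^ p = 1] (mod int l) \<and> [\<omega> * \<eta> = 1] (mod int l) \<and>
    (\<forall>j. lg (\<omega> ^ j mod int l) = (l - 1) div p * (j mod p))"
proof -
  have l: "l \<ge> 2" using assms(1) by (rule prime_ge_2_nat)
  obtain \<gamma> where \<gamma>: "residue_primroot l \<gamma>"
    using prime_primitive_root_exists[OF _ assms(1)] l by force
  define f where "f i = \<gamma> ^ i mod l" for i
  have bij: "bij_betw f {..<l - 1} (totatives l)"
    using residue_primroot_is_generator[of l \<gamma>] \<gamma> l assms(1)
    by (simp add: f_def[abs_def] totient_prime)
  have tot: "nat x \<in> totatives l" if "x \<in> {1..<int l}" for x
    using that assms(1) l by (auto simp: totatives_prime)
  define lg where "lg x = inv_into {..<l - 1} f (nat x)" for x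
  have lg: "lg x < l - 1" "f (lg x) = nat x" if "x \<in> {1..<int l}" for x
    using bij_betw_inv_into[OF bij] bij_betw_inv_into_right[OF bij tot[OF that]] tot[OF that]
    by (auto simp: lg_def dest: bij_betwE)
  have lg_unique: "lg (int (f i)) = i mod (l - 1)" for i
  proof -
    have "[\<gamma> ^ (l - 1) = 1] (mod l)"
      using euler_theorem[of \<gamma> l] \<gamma> assms(1)
      by (simp add: residue_primroot_def totient_prime coprime_commute)
    then have "[(\<gamma> ^ (l - 1)) ^ (i div (l - 1)) * \<gamma> ^ (i mod (l - 1)) = 1 ^ (i div (l - 1)) * \<gamma> ^ (i mod (l - 1))] (mod l)"
      by (intro cong_mult cong_pow cong_refl)
    then have "f i = f (i mod (l - 1))"
      by (simp add: f_def cong_def flip: power_mult power_add)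
    moreover have "i mod (l - 1) \<in> {..<l - 1}" using l by simp
    ultimately show ?thesis
      using bij_betw_inv_into_left[OF bij] by (simp add: lg_def)
  qed
  define u where "u = (l - 1) div p"
  have u: "u * p = l - 1" using assms(2) by (simp add: u_def)
  have mult: "lg (x * y mod int l) = (lg x + lg y) mod (l - 1)"
    if "x \<in> {1..<int l}" "y \<in> {1..<int l}" for x y
  proof -
    have "x = int (f (lg x))" "y = int (f (lg y))" using lg that by auto
    then have "x * y mod int l = int (f (lg x) * f (lg y) mod l)"
      by (metis of_nat_mult of_nat_mod)
    also have "f (lg x) * f (lg y) mod l = f (lg x + lg y)"
      by (simp add: f_def mod_mult_eq power_add)
    finally show ?thesis by (simp add: lg_unique)
  qed
  have pow: "lg (int (\<gamma> ^ u) ^ j mod int l) = (l - 1) div p * (j mod p)" for j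
  proof -
    have "int (\<gamma> ^ u) ^ j mod int l = int (f (u * j))"
      by (simp add: f_def power_mult zmod_int)
    then have "lg (int (\<gamma> ^ u) ^ j mod int l) = u * j mod (u * p)"
      by (simp add: lg_unique u)
    then show ?thesis by (simp only: mult_mod_right u_def)
  qed
  have 1: "[int (\<gamma> ^ (l - 1)) = int 1] (mod int l)"
    unfolding cong_int_iff using euler_theorem[of \<gamma> l] \<gamma> assms(1)
    by (simp add: residue_primroot_def totient_prime coprime_commute)
  have "[int (\<gamma> ^ u) ^ p = 1] (mod int l)"
    using 1 by (simp add: u flip: power_mult)
  moreover have "[int (\<gamma> ^ (u * (p - 1))) ^ p = 1] (mod int l)"
  proof -
    have "u * (p - 1) * p = (l - 1) * (p - 1)" using u by simp
    then have "int (\<gamma> ^ (u * (p - 1))) ^ p = int (\<gamma> ^ (l - 1)) ^ (p - 1)"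
      by (metis of_nat_power power_mult)
    then show ?thesis using cong_pow[OF 1, of "p - 1"] by simp
  qed
  moreover have "[int (\<gamma> ^ u) * int (\<gamma> ^ (u * (p - 1))) = 1] (mod int l)"
  proof -
    have "u + u * (p - 1) = l - 1" using assms(3) u by (cases p) auto
    then have "int (\<gamma> ^ u) * int (\<gamma> ^ (u * (p - 1))) = int (\<gamma> ^ (l - 1))"
      by (metis of_nat_mult power_add)
    then show ?thesis using 1 by simp
  qed
  ultimately show ?thesis
    using lg(1) mult pow by blast
qed


section \<open>The action on lines over a prime field\<close>

text \<open>Least residues and extensional functions make equality of vectors over GF(l) plain
  equality of functions.\<close>

definition vecs :: "nat \<Rightarrow> nat \<Rightarrow> (nat \<Rightarrow> int) set" where
  "vecs l m = {..<m} \<rightarrow>\<^sub>E {0..<int l}"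

definition smul :: "nat \<Rightarrow> nat \<Rightarrow> int \<Rightarrow> (nat \<Rightarrow> int) \<Rightarrow> nat \<Rightarrow> int" where
  "smul l m c v = (\<lambda>i\<in>{..<m}. c * v i mod int l)"

lemma vecs_mem: "v \<in> vecs l m \<Longrightarrow> i < m \<Longrightarrow> 0 \<le> v i \<and> v i < int l"
  by (auto simp: vecs_def PiE_iff)

lemma vecs_eqI: "v \<in> vecs l m \<Longrightarrow> w \<in> vecs l m \<Longrightarrow> (\<And>i. i < m \<Longrightarrow> v i = w i) \<Longrightarrow> v = w"
  unfolding vecs_def by (rule PiE_ext) auto

lemma smul_apply: "i < m \<Longrightarrow> smul l m c v i = c * v i mod int l"
  by (simp add: smul_def)

lemma smul_in_vecs: "l > 0 \<Longrightarrow> smul l m c v \<in> vecs l m"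
  by (auto simp: smul_def vecs_def)

lemma smul_smul: "smul l m c (smul l m d v) = smul l m (c * d) v"
  by (auto simp: smul_def mod_mult_right_eq mult.assoc intro!: restrict_ext)

lemma smul_mod: "smul l m (c mod int l) v = smul l m c v"
  by (auto simp: smul_def mod_mult_left_eq intro!: restrict_ext)

lemma smul_1: "v \<in> vecs l m \<Longrightarrow> smul l m 1 v = v"
  by (rule vecs_eqI[of _ l m]) (auto simp: smul_def vecs_def PiE_iff)

text \<open>Lines are represented by the vectors \<open>v\<close> whose transform \<open>hat v\<close> has first nonzero entry \<open>1\<close>.
  In the application the transform diagonalises the elementary abelian subgroup.\<close>

locale line_action = Group.group G for G :: "('g, 'm) monoid_scheme" (structure) +
  fixes l m :: nat and hat :: "(nat \<Rightarrow> int) \<Rightarrow> nat \<Rightarrow> int"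
    and act :: "(nat \<Rightarrow> int) \<Rightarrow> 'g \<Rightarrow> nat \<Rightarrow> int" and lg :: "int \<Rightarrow> nat"
  assumes l: "prime l"
    and hat: "bij_betw hat (vecs l m) (vecs l m)"
    and hat_smul: "v \<in> vecs l m \<Longrightarrow> hat (smul l m c v) = smul l m c (hat v)"
    and act_closed: "v \<in> vecs l m \<Longrightarrow> g \<in> carrier G \<Longrightarrow> act v g \<in> vecs l m"
    and act_mult: "v \<in> vecs l m \<Longrightarrow> g \<in> carrier G \<Longrightarrow> h \<in> carrier G \<Longrightarrow> act v (g \<otimes> h) = act (act v g) h"
    and act_one: "v \<in> vecs l m \<Longrightarrow> act v \<one> = v"
    and act_smul: "v \<in> vecs l m \<Longrightarrow> g \<in> carrier G \<Longrightarrow> act (smul l m c v) g = smul l m c (act v g)"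
    and lg: "x \<in> {1..<int l} \<Longrightarrow> lg x < l - 1"
    and lg_mult: "x \<in> {1..<int l} \<Longrightarrow> y \<in> {1..<int l} \<Longrightarrow> lg (x * y mod int l) = (lg x + lg y) mod (l - 1)"
begin

abbreviation "V \<equiv> vecs l m"
abbreviation "sm \<equiv> smul l m"
abbreviation "U \<equiv> {1..<int l}"

definition nonzero :: "(nat \<Rightarrow> int) \<Rightarrow> bool" where
  "nonzero v \<longleftrightarrow> v \<in> V \<and> (\<exists>k<m. hat v k \<noteq> 0)"

definition pos :: "(nat \<Rightarrow> int) \<Rightarrow> nat" where
  "pos v = (LEAST k. k < m \<and> hat v k \<noteq> 0)"

definition lead :: "(nat \<Rightarrow> int) \<Rightarrow> int" where
  "lead v = hat v (pos v)"

definition lines :: "(nat \<Rightarrow> int) set" where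
  "lines = {v. nonzero v \<and> lead v = 1}"

definition normalize_vec :: "(nat \<Rightarrow> int) \<Rightarrow> nat \<Rightarrow> int" where
  "normalize_vec v = sm (SOME d. d * lead v mod int l = 1) v"

definition line_act :: "(nat \<Rightarrow> int) \<Rightarrow> 'g \<Rightarrow> nat \<Rightarrow> int" where
  "line_act v g = normalize_vec (act v g)"

text \<open>The logarithm of the scalar relating the image of a representative to the representative
  of the image line; on the stabiliser of the line this is its character.\<close>

definition line_log :: "(nat \<Rightarrow> int) \<Rightarrow> 'g \<Rightarrow> nat" where
  "line_log v g = lg (lead (act v g))"

section \<open>Normalised vectors and the induced action on lines\<close>

lemma l_gt_1: "l > 1"
  using l by (rule prime_gt_1_nat)

lemma sm_closed [simp]: "sm c v \<in> V"
  using l_gt_1 by (intro smul_in_vecs) simp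

lemma hat_closed: "v \<in> V \<Longrightarrow> hat v \<in> V"
  using hat by (auto dest: bij_betwE)

lemma mod_in_U:
  assumes "x mod int l \<noteq> 0"
  shows "x mod int l \<in> U"
proof -
  have "0 \<le> x mod int l" "x mod int l < int l" using l_gt_1 by simp_all
  then show ?thesis using assms by simp
qed

lemma U_mult:
  assumes "x \<in> U" "y \<in> U"
  shows "x * y mod int l \<in> U"
proof -
  have "\<not> int l dvd x" "\<not> int l dvd y" using assms by (auto dest: zdvd_imp_le)
  then have "\<not> int l dvd x * y" using l by (simp add: prime_dvd_mult_iff)
  then show ?thesis by (intro mod_in_U) (simp add: dvd_eq_mod_eq_0)
qed

lemma U_inverse:
  assumes "x \<in> U"
  shows "\<exists>d. d * x mod int l = 1"
proof -
  have "\<not> int l dvd x" using assms by (auto dest: zdvd_imp_le)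
  then have "coprime x (int l)" using l prime_imp_coprime coprime_commute by (metis prime_nat_int_transfer)
  then obtain d where "[x * d = 1] (mod int l)" using cong_solve_coprime_int by blast
  then show ?thesis using l_gt_1 by (auto simp: cong_def mult.commute)
qed

lemma nonzero_pos:
  assumes "nonzero v"
  shows "pos v < m" "lead v \<in> U" "k < pos v \<Longrightarrow> hat v k = 0"
proof -
  have "\<exists>k. k < m \<and> hat v k \<noteq> 0" using assms unfolding nonzero_def by blast
  then have *: "pos v < m \<and> hat v (pos v) \<noteq> 0" unfolding pos_def by (rule LeastI_ex)
  then show "pos v < m" by simp
  have "v \<in> V" using assms by (simp add: nonzero_def)
  then have "0 \<le> hat v (pos v) \<and> hat v (pos v) < int l"
    using * by (intro vecs_mem[OF hat_closed]) auto
  then show "lead v \<in> U" using * unfolding lead_def by simp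
  show "hat v k = 0" if "k < pos v"
  proof -
    have "\<not> (k < m \<and> hat v k \<noteq> 0)" using that unfolding pos_def by (rule not_less_Least)
    then show ?thesis using that * by linarith
  qed
qed

lemma pos_eqI:
  assumes "k < m" "hat v k \<noteq> 0" "\<And>i. i < k \<Longrightarrow> hat v i = 0"
  shows "pos v = k"
  unfolding pos_def using assms by (intro Least_equality) (auto simp: not_less[symmetric])

text \<open>The unit factors may vary with the coordinate: constant factors give scalar
  multiplication, characters give the action of the elementary abelian group.\<close>

lemma hat_scaled:
  assumes "nonzero v" "w \<in> V" "\<And>k. k < m \<Longrightarrow> hat w k = c k * hat v k mod int l" "\<And>k. k < m \<Longrightarrow> c k \<in> U"
  shows "nonzero w" "pos w = pos v" "lead w = c (pos v) * lead v mod int l"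
proof -
  have "hat w (pos v) = c (pos v) * lead v mod int l"
    using nonzero_pos[OF assms(1)] assms(3) by (simp add: lead_def)
  moreover have "c (pos v) * lead v mod int l \<in> U"
    using nonzero_pos[OF assms(1)] assms(4) by (intro U_mult) auto
  ultimately have *: "hat w (pos v) \<noteq> 0" "hat w (pos v) = c (pos v) * lead v mod int l" by auto
  show "pos w = pos v"
    using * nonzero_pos[OF assms(1)] assms(3) by (intro pos_eqI) auto
  then show "lead w = c (pos v) * lead v mod int l" using * by (simp add: lead_def)
  show "nonzero w"
    unfolding nonzero_def using *(1) nonzero_pos(1)[OF assms(1)] assms(2) by blast
qed

lemma sm_nonzero:
  assumes "nonzero v" "c \<in> U"
  shows "nonzero (sm c v)" "pos (sm c v) = pos v" "lead (sm c v) = c * lead v mod int l"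
  using hat_scaled[OF assms(1), of "sm c v" "\<lambda>_. c"] assms
  by (auto simp: hat_smul nonzero_def smul_apply)

lemma normalize_vec_unique:
  assumes "w \<in> lines" "c \<in> U"
  shows "normalize_vec (sm c w) = w"
proof -
  have w: "nonzero w" "lead w = 1" "w \<in> V" using assms(1) by (auto simp: lines_def nonzero_def)
  have "lead (sm c w) = c" using sm_nonzero(3)[OF w(1) assms(2)] w(2) assms(2) by simp
  moreover have "(SOME d. d * c mod int l = 1) * c mod int l = 1"
    using someI_ex[OF U_inverse[OF assms(2)]] .
  ultimately have "normalize_vec (sm c w) = sm 1 w"
    unfolding normalize_vec_def by (metis smul_mod smul_smul)
  then show ?thesis using w(3) by (simp add: smul_1)
qed

lemma normalize_vec:
  assumes "nonzero v"
  shows "normalize_vec v \<in> lines" "pos (normalize_vec v) = pos v" "sm (lead v) (normalize_vec v) = v"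
proof -
  define d where "d = (SOME d. d * lead v mod int l = 1)"
  have d: "d * lead v mod int l = 1"
    unfolding d_def by (rule someI_ex[OF U_inverse[OF nonzero_pos(2)[OF assms]]])
  then have "d mod int l \<noteq> 0" by (metis mod_mult_left_eq mult_zero_left mod_0 zero_neq_one)
  then have U: "d mod int l \<in> U" by (rule mod_in_U)
  have n: "normalize_vec v = sm (d mod int l) v" by (simp add: normalize_vec_def d_def smul_mod)
  show "pos (normalize_vec v) = pos v" unfolding n by (rule sm_nonzero(2)[OF assms U])
  show "normalize_vec v \<in> lines"
    unfolding n using sm_nonzero[OF assms U] d by (simp add: lines_def mod_mult_left_eq)
  have "sm (lead v) (normalize_vec v) = sm (d * lead v mod int l) v"
    by (simp add: n smul_smul smul_mod mod_mult_right_eq mult.commute)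
  then show "sm (lead v) (normalize_vec v) = v"
    using assms by (simp add: d smul_1 nonzero_def)
qed

lemma normalize_vec_sm:
  assumes "nonzero v" "c \<in> U"
  shows "normalize_vec (sm c v) = normalize_vec v"
proof -
  have "sm c v = sm c (sm (lead v) (normalize_vec v))" by (simp add: normalize_vec(3)[OF assms(1)])
  also have "\<dots> = sm (c * lead v mod int l) (normalize_vec v)" by (simp add: smul_smul smul_mod)
  finally show ?thesis
    using normalize_vec_unique normalize_vec(1)[OF assms(1)] U_mult assms nonzero_pos(2) by metis
qed

text \<open>The zero vector is recognised by being its own multiple by the scalar 0, a property that
  \<open>act_smul\<close> carries back from \<open>act v g\<close> to \<open>v\<close> along
  \<open>inv g\<close>.\<close>

lemma nonzero_act:
  assumes "nonzero v" "g \<in> carrier G"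
  shows "nonzero (act v g)"
proof (rule ccontr)
  assume *: "\<not> nonzero (act v g)"
  let ?w = "act v g"
  have v: "v \<in> V" and w: "?w \<in> V" using assms act_closed by (auto simp: nonzero_def)
  then have "hat ?w k = 0" if "k < m" for k using * that by (auto simp: nonzero_def)
  then have "hat ?w = sm 0 (hat ?w)"
    by (intro vecs_eqI[of _ l m]) (auto simp: hat_closed w smul_apply)
  then have "hat ?w = hat (sm 0 ?w)" by (simp add: hat_smul w)
  then have "?w = sm 0 ?w" using hat w by (auto simp: bij_betw_def inj_on_def)
  then have "act ?w (inv g) = act (sm 0 ?w) (inv g)" by (rule arg_cong)
  also have "\<dots> = sm 0 (act ?w (inv g))" using w assms(2) by (intro act_smul) auto
  finally have "act ?w (inv g) = sm 0 (act ?w (inv g))" .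
  moreover have "act ?w (inv g) = v"
    using act_mult[OF v assms(2), of "inv g"] assms(2) by (simp add: act_one v)
  ultimately have "v = sm 0 v" by (simp only:)
  then have "hat v = hat (sm 0 v)" by (rule arg_cong)
  then have "hat v = sm 0 (hat v)" by (simp only: hat_smul[OF v])
  then have "hat v k = sm 0 (hat v) k" for k by (rule fun_cong)
  then have "hat v k = 0" if "k < m" for k using that by (metis smul_apply mult_zero_left mod_0)
  then show False using assms(1) by (auto simp: nonzero_def)
qed

lemma lines_nonzero: "v \<in> lines \<Longrightarrow> nonzero v"
  by (simp add: lines_def)

lemma lines_in_V: "v \<in> lines \<Longrightarrow> v \<in> V"
  by (simp add: lines_def nonzero_def)

lemma line_act_closed: "v \<in> lines \<Longrightarrow> g \<in> carrier G \<Longrightarrow> line_act v g \<in> lines"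
  unfolding line_act_def by (intro normalize_vec nonzero_act lines_nonzero)

lemma act_eq_line_act:
  assumes "v \<in> lines" "g \<in> carrier G"
  shows "act v g = sm (lead (act v g)) (line_act v g)"
  unfolding line_act_def using normalize_vec(3)[OF nonzero_act] assms lines_nonzero by simp

lemma act_mult_lines:
  assumes "v \<in> lines" "g \<in> carrier G" "h \<in> carrier G"
  shows "act v (g \<otimes> h) = sm (lead (act v g)) (act (line_act v g) h)"
proof -
  have "act v (g \<otimes> h) = act (act v g) h" using assms by (intro act_mult lines_in_V)
  also have "\<dots> = act (sm (lead (act v g)) (line_act v g)) h"
    using act_eq_line_act[OF assms(1,2)] by simp
  also have "\<dots> = sm (lead (act v g)) (act (line_act v g) h)"
    using assms by (intro act_smul lines_in_V line_act_closed)
  finally show ?thesis .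
qed

lemma line_act_mult:
  assumes "v \<in> lines" "g \<in> carrier G" "h \<in> carrier G"
  shows "line_act v (g \<otimes> h) = line_act (line_act v g) h"
  unfolding line_act_def[of v "g \<otimes> h"] line_act_def[of _ h] act_mult_lines[OF assms]
  using assms by (intro normalize_vec_sm nonzero_act lines_nonzero line_act_closed nonzero_pos)

lemma line_log_mult:
  assumes "v \<in> lines" "g \<in> carrier G" "h \<in> carrier G"
  shows "line_log v (g \<otimes> h) = (line_log v g + line_log (line_act v g) h) mod (l - 1)"
proof -
  have nz: "nonzero (act v g)" "nonzero (act (line_act v g) h)"
    using assms by (simp_all add: nonzero_act lines_nonzero line_act_closed)
  note lead = nonzero_pos(2)[OF nz(1)] nonzero_pos(2)[OF nz(2)]
  have "lead (act v (g \<otimes> h)) = lead (act v g) * lead (act (line_act v g) h) mod int l"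
    unfolding act_mult_lines[OF assms] by (rule sm_nonzero(3)[OF nz(2) lead(1)])
  then show ?thesis
    unfolding line_log_def by (simp only: lg_mult[OF lead])
qed

lemma line_log_less: "v \<in> lines \<Longrightarrow> g \<in> carrier G \<Longrightarrow> line_log v g < l - 1"
  unfolding line_log_def by (intro lg nonzero_pos nonzero_act lines_nonzero)

lemma line_act_one:
  assumes "v \<in> lines"
  shows "line_act v \<one> = v"
proof -
  have "1 \<in> U" using l_gt_1 by simp
  then show ?thesis
    using normalize_vec_unique[OF assms, of 1] assms
    by (simp add: line_act_def act_one lines_in_V smul_1)
qed

lemma bij_betw_line_act:
  assumes "g \<in> carrier G"
  shows "bij_betw (\<lambda>v. line_act v g) lines lines"
proof (rule bij_betw_byWitness[where f' = "\<lambda>v. line_act v (inv g)"])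
  show "\<forall>v\<in>lines. line_act (line_act v g) (inv g) = v" "\<forall>v\<in>lines. line_act (line_act v (inv g)) g = v"
    using assms by (simp_all add: line_act_one flip: line_act_mult)
qed (use assms line_act_closed in auto)

lemma finite_lines: "finite lines"
proof (rule finite_subset)
  show "lines \<subseteq> V" by (auto intro: lines_in_V)
  show "finite V" unfolding vecs_def by (intro finite_PiE) auto
qed

text \<open>The transform vanishes before position \<open>k\<close>, is 1 there and is free
  afterwards, so the number of lines is a power of \<open>l\<close>, and \<open>l\<close> is 1
  modulo \<open>p\<close>.\<close>

lemma card_lines_pos:
  assumes "k < m" "p dvd l - 1"
  shows "[card {v \<in> lines. pos v = k} = 1] (mod p)"
proof -
  define B where "B i = (if i < k then {0} else if i = k then {1} else {0..<int l})" for i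
  have B: "PiE {..<m} B \<subseteq> V"
    unfolding vecs_def B_def using l_gt_1 by (intro PiE_mono) auto
  have "bij_betw hat {v \<in> lines. pos v = k} (PiE {..<m} B)"
  proof (rule bij_betw_subset[OF hat, of _ "PiE {..<m} B", simplified])
    show "{v \<in> lines. pos v = k} \<subseteq> V" by (auto intro: lines_in_V)
    show "hat ` {v \<in> lines. pos v = k} = PiE {..<m} B"
    proof (intro equalityI subsetI)
      fix w assume "w \<in> hat ` {v \<in> lines. pos v = k}"
      then obtain v where v: "w = hat v" "v \<in> lines" "pos v = k" by auto
      have "hat v \<in> V" using v lines_in_V hat_closed by auto
      moreover have "hat v i = 0" if "i < k" for i
        using nonzero_pos(3) v that lines_nonzero by auto
      moreover have "hat v k = 1" using v by (auto simp: lines_def lead_def)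
      ultimately show "w \<in> PiE {..<m} B"
        unfolding v(1) by (auto simp: B_def vecs_def PiE_iff)
    next
      fix w assume w: "w \<in> PiE {..<m} B"
      then have "w \<in> hat ` V" unfolding bij_betw_imp_surj_on[OF hat] using B by blast
      then obtain v where v: "v \<in> V" "w = hat v" by blast
      have B': "hat v i \<in> B i" if "i < m" for i using w v that by (auto simp: PiE_iff)
      have "hat v k = 1" using B'[OF assms(1)] by (simp add: B_def)
      moreover have "hat v i = 0" if "i < k" for i using B'[of i] assms(1) that by (simp add: B_def)
      ultimately have "pos v = k" using assms(1) by (intro pos_eqI) auto
      then have "v \<in> lines" using \<open>hat v k = 1\<close> v(1) assms(1) by (auto simp: lines_def lead_def nonzero_def)
      then show "w \<in> hat ` {v \<in> lines. pos v = k}" using v \<open>pos v = k\<close> by auto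
    qed
  qed
  then have "card {v \<in> lines. pos v = k} = (\<Prod>i<m. card (B i))"
    by (simp add: bij_betw_same_card card_PiE)
  also have "[\<dots> = (\<Prod>i<m. 1)] (mod p)"
  proof (rule cong_prod)
    fix i
    have "[l = 1] (mod p)"
      using assms(2) l_gt_1 by (simp add: cong_altdef_nat)
    then show "[card (B i) = 1] (mod p)" by (simp add: B_def)
  qed
  finally show ?thesis by simp
qed

text \<open>\<open>c\<close> is the transfer of the \<open>d\<close>-th cup power of
  \<open>\<kappa>\<close> along the action on lines. On the image of \<open>\<phi>\<close> the lines
  group by \<open>pos\<close> into one term for each character \<open>\<chi> k\<close>, and the
  chain evaluates that term to \<open>Q k ^ d\<close> modulo \<open>p\<close>.\<close>

lemma has_non_nilpotent_class_transfer:
  fixes \<alpha>s :: "('e :: comm_monoid_add \<Rightarrow>\<^sub>0 'k :: comm_ring_1) list" and p d :: nat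
  assumes p: "p > 1" "p dvd l - 1" "prime_elem (of_nat p :: 'k)" and d: "d > 0"
    and \<phi>: "\<And>e. \<phi> e \<in> carrier G" "\<And>e e'. \<phi> (e + e') = \<phi> e \<otimes> \<phi> e'"
    and \<alpha>s: "\<alpha>s \<noteq> []" "\<And>\<alpha>. \<alpha> \<in> set \<alpha>s \<Longrightarrow> pairing \<alpha> (\<lambda>_. 1) = 0"
    and null: "successively (\<lambda>\<alpha> \<beta>. \<forall>F. of_nat p dvd pairing (\<alpha> * \<beta>) (\<lambda>e. F (\<phi> e))) (\<alpha>s @ [hd \<alpha>s])"
    and \<kappa>: "\<And>xs. length xs \<noteq> length \<alpha>s \<Longrightarrow> \<kappa> xs = 0"
      "\<And>xs. xs \<in> lists {..<l - 1} \<Longrightarrow> int p dvd int_coboundary (\<lambda>x y. (x + y) mod (l - 1)) \<kappa> xs"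
    and \<chi>: "\<And>v k e. v \<in> vecs l m \<Longrightarrow> k < m \<Longrightarrow> hat (act v (\<phi> e)) k = \<chi> k e * hat v k mod int l"
      "\<And>k e. k < m \<Longrightarrow> \<chi> k e \<in> {1..<int l}"
    and Q: "\<And>k. k < m \<Longrightarrow> of_nat p dvd bar_eval \<alpha>s (\<lambda>es. \<kappa> (map (\<lambda>e. lg (\<chi> k e)) es)) - Q k"
      "\<not> of_nat p dvd (\<Sum>k<m. Q k ^ d)"
  shows "has_non_nilpotent_class G (residue_ring (int p)) (length \<alpha>s * d)"
proof -
  define Y where "Y = iterated_cup \<kappa> (length \<alpha>s) d"
  define c where "c xs = (\<Sum>v\<in>lines. Y (groupoid_path line_act line_log v xs))" for xs
  let ?\<beta>s = "concat (replicate d \<alpha>s)"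
  have len: "length ?\<beta>s = length \<alpha>s * d"
    by (simp add: length_concat sum_list_replicate)
  have hd: "hd ?\<beta>s = hd \<alpha>s" using \<alpha>s(1) d by (cases d) auto
  have "has_non_nilpotent_class G (residue_ring (int p)) (length ?\<beta>s)"
  proof (rule has_non_nilpotent_class_criterion[where \<phi> = \<phi> and c = c])
    show "Group.monoid G" by (rule is_monoid)
    show "?\<beta>s \<noteq> []" using \<alpha>s(1) d by auto
    show "pairing \<alpha> (\<lambda>_. 1) = 0" if "\<alpha> \<in> set ?\<beta>s" for \<alpha> using \<alpha>s(2) that by auto
    show "successively (\<lambda>\<alpha> \<beta>. \<forall>F. of_nat p dvd pairing (\<alpha> * \<beta>) (\<lambda>e. F (\<phi> e))) (?\<beta>s @ [hd ?\<beta>s])"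
      unfolding hd by (rule successively_concat_replicate[OF null \<alpha>s(1)])
    show "c xs = 0" if "length xs \<noteq> length ?\<beta>s" for xs
    proof -
      have "Y ys = 0" if "length ys \<noteq> length \<alpha>s * d" for ys
        unfolding Y_def using \<kappa>(1) that by (rule iterated_cup_eq_0)
      then show ?thesis using that len by (simp add: c_def)
    qed
    show "int p dvd int_coboundary (\<otimes>) c xs" if "xs \<in> lists (carrier G)" for xs
      unfolding c_def
    proof (rule transfer_cocycle[where C = "carrier G" and A = "{..<l - 1}" and m' = "\<lambda>x y. (x + y) mod (l - 1)"])
      show "int p dvd int_coboundary (\<lambda>x y. (x + y) mod (l - 1)) Y xs" if "xs \<in> lists {..<l - 1}" for xs
        unfolding Y_def using \<kappa> that by (rule iterated_cup_cocycle)
    qed (use that in \<open>auto simp: line_act_mult line_log_mult bij_betw_line_act line_log_less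
        simp del: One_nat_def\<close>)
    show "\<not> of_nat p dvd bar_eval ?\<beta>s (\<lambda>es. c (map \<phi> es))"
    proof
      assume *: "of_nat p dvd bar_eval ?\<beta>s (\<lambda>es. c (map \<phi> es))"
      have 1: "of_nat p dvd bar_eval ?\<beta>s (\<lambda>es. c (map \<phi> es)) -
          bar_eval ?\<beta>s (\<lambda>es. \<Sum>k<m. Y (map (\<lambda>e. lg (\<chi> k e)) es))"
      proof (rule bar_eval_cong_mod)
        fix es :: "'e list"
        \<comment> \<open>The transform of \<open>v\<close> is only rescaled coordinatewise, so its
          first nonzero coefficient stays in place and changes from 1 to the value of the
          character.\<close>
        have fib: "line_act v (\<phi> e) \<in> lines \<and> pos (line_act v (\<phi> e)) = pos v \<and>
            line_log v (\<phi> e) = lg (\<chi> (pos v) e)" if v: "v \<in> lines" for v e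
        proof -
          note nz = lines_nonzero[OF v]
          note h = hat_scaled[OF nz, of "act v (\<phi> e)" "\<lambda>k. \<chi> k e"]
          have h: "pos (act v (\<phi> e)) = pos v" "lead (act v (\<phi> e)) = \<chi> (pos v) e * lead v mod int l"
            using h \<chi> act_closed \<phi>(1) lines_in_V[OF v] by auto
          have "lead v = 1" using v by (simp add: lines_def)
          moreover have "\<chi> (pos v) e \<in> U" using \<chi>(2) nonzero_pos(1)[OF nz] by simp
          ultimately have "lead (act v (\<phi> e)) = \<chi> (pos v) e" using h(2) by simp
          then show ?thesis
            using h(1) line_act_closed[OF v \<phi>(1)] normalize_vec(2)[OF nonzero_act[OF nz \<phi>(1)]]
            by (simp add: line_act_def line_log_def)
        qed
        show "int p dvd c (map \<phi> es) - (\<Sum>k<m. Y (map (\<lambda>e. lg (\<chi> k e)) es))"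
          unfolding c_def
          by (rule sum_groupoid_path_cong[where \<kappa> = pos])
            (use fib finite_lines card_lines_pos[OF _ p(2)] nonzero_pos(1) lines_nonzero in auto)
      qed
      have 2: "bar_eval ?\<beta>s (\<lambda>es. \<Sum>k<m. Y (map (\<lambda>e. lg (\<chi> k e)) es)) =
          (\<Sum>k<m. bar_eval \<alpha>s (\<lambda>es. \<kappa> (map (\<lambda>e. lg (\<chi> k e)) es)) ^ d)"
        by (simp add: bar_eval_sum Y_def bar_eval_iterated_cup)
      have 3: "of_nat p dvd (\<Sum>k<m. bar_eval \<alpha>s (\<lambda>es. \<kappa> (map (\<lambda>e. lg (\<chi> k e)) es)) ^ d) - (\<Sum>k<m. Q k ^ d)"
        using Q(1) by (intro dvd_diff_sum dvd_diff_power) auto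
      have "of_nat p dvd bar_eval ?\<beta>s (\<lambda>es. c (map \<phi> es)) - (\<Sum>k<m. Q k ^ d)"
        by (rule dvd_diff_trans[OF 1[unfolded 2] 3])
      then have "of_nat p dvd (\<Sum>k<m. Q k ^ d)"
        using * dvd_diff_sym dvd_diffD by blast
      then show False using Q(2) by contradiction
    qed
  qed (use p \<phi> in auto)
  then show ?thesis by (simp add: len)
qed

end


section \<open>Translations and the Fourier transform\<close>

text \<open>\<open>\<beta>\<close> identifies the \<open>p ^ n\<close> coordinates with the elements
  of \<open>(\<int>/p)^n\<close>, so that translations become the regular representation.\<close>

locale digit_translations =
  fixes p n :: nat and \<beta> :: "nat \<Rightarrow> nat \<Rightarrow> nat"
  assumes p: "prime p" and \<beta>: "bij_betw \<beta> {..<p ^ n} ({..<n} \<rightarrow>\<^sub>E {..<p})"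
begin

abbreviation "m \<equiv> p ^ n"

definition shift :: "(nat \<Rightarrow>\<^sub>0 nat) \<Rightarrow> nat \<Rightarrow> nat" where
  "shift e i = (if i < m
    then inv_into {..<m} \<beta> (\<lambda>j\<in>{..<n}. (\<beta> i j + Poly_Mapping.lookup e j) mod p) else i)"

lemma p_gt_0: "p > 0"
  using p by (rule prime_gt_0_nat)

lemma \<beta>_in: "i < m \<Longrightarrow> \<beta> i \<in> {..<n} \<rightarrow>\<^sub>E {..<p}"
  using bij_betwE[OF \<beta>] by blast

lemma \<beta>_less: "i < m \<Longrightarrow> j < n \<Longrightarrow> \<beta> i j < p"
  using \<beta>_in[of i] by (auto simp: PiE_iff)

lemma \<beta>_eqI:
  assumes "i < m" "i' < m" "\<And>j. j < n \<Longrightarrow> \<beta> i j = \<beta> i' j"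
  shows "i = i'"
proof -
  have "\<beta> i = \<beta> i'"
    using \<beta>_in[OF assms(1)] \<beta>_in[OF assms(2)] assms(3) by (intro PiE_ext) auto
  then show ?thesis using \<beta> assms(1,2) by (auto simp: bij_betw_def inj_on_def)
qed

lemma shift_less:
  assumes "i < m"
  shows "shift e i < m" "j < n \<Longrightarrow> \<beta> (shift e i) j = (\<beta> i j + Poly_Mapping.lookup e j) mod p"
proof -
  let ?b = "\<lambda>j\<in>{..<n}. (\<beta> i j + Poly_Mapping.lookup e j) mod p"
  have "?b \<in> {..<n} \<rightarrow>\<^sub>E {..<p}" using p_gt_0 by auto
  then have "?b \<in> \<beta> ` {..<m}" unfolding bij_betw_imp_surj_on[OF \<beta>] .
  then have "inv_into {..<m} \<beta> ?b \<in> {..<m}" "\<beta> (inv_into {..<m} \<beta> ?b) = ?b"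
    by (rule inv_into_into, rule f_inv_into_f)
  then show "shift e i < m" "j < n \<Longrightarrow> \<beta> (shift e i) j = (\<beta> i j + Poly_Mapping.lookup e j) mod p"
    using assms by (simp_all add: shift_def)
qed

lemma shift_outside: "\<not> i < m \<Longrightarrow> shift e i = i"
  by (simp add: shift_def)

lemma shift_add: "shift (e + e') = shift e \<circ> shift e'"
proof
  fix i
  show "shift (e + e') i = (shift e \<circ> shift e') i"
  proof (cases "i < m")
    case True
    show ?thesis
    proof (rule \<beta>_eqI)
      fix j assume j: "j < n"
      show "\<beta> (shift (e + e') i) j = \<beta> ((shift e \<circ> shift e') i) j"
        unfolding o_apply shift_less(2)[OF True j] shift_less(2)[OF shift_less(1)[OF True] j]
          lookup_add mod_add_left_eq by (simp only: ac_simps)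
    qed (simp_all add: shift_less(1) True)
  qed (simp add: shift_outside)
qed

lemma shift_eq_id:
  assumes "\<And>j. j < n \<Longrightarrow> p dvd Poly_Mapping.lookup e j"
  shows "shift e = id"
proof
  fix i
  show "shift e i = id i"
  proof (cases "i < m")
    case True
    have "shift e i = i"
    proof (rule \<beta>_eqI)
      fix j assume j: "j < n"
      obtain c where "Poly_Mapping.lookup e j = p * c" using assms[OF j] by (rule dvdE)
      then show "\<beta> (shift e i) j = \<beta> i j" using shift_less(2)[OF True j] \<beta>_less[OF True j] by simp
    qed (use True shift_less in auto)
    then show ?thesis by simp
  qed (simp add: shift_outside)
qed

lemma shift_permutes: "shift e permutes {..<m}"
proof (rule bij_imp_permutes)
  have "inj_on (shift e) {..<m}"
  proof (rule inj_onI)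
    fix i i' assume i: "i \<in> {..<m}" "i' \<in> {..<m}" "shift e i = shift e i'"
    show "i = i'"
    proof (rule \<beta>_eqI)
      fix j assume j: "j < n"
      have "[\<beta> i j + Poly_Mapping.lookup e j = \<beta> i' j + Poly_Mapping.lookup e j] (mod p)"
        using shift_less(2)[of i j e] shift_less(2)[of i' j e] i j by (simp add: cong_def)
      then have "[\<beta> i j = \<beta> i' j] (mod p)" by (simp only: cong_add_rcancel_nat)
      then show "\<beta> i j = \<beta> i' j" using \<beta>_less i j by (auto simp: cong_def)
    qed (use i in auto)
  qed
  moreover have "shift e ` {..<m} \<subseteq> {..<m}" using shift_less by auto
  ultimately show "bij_betw (shift e) {..<m} {..<m}"
    by (simp add: bij_betw_def endo_inj_surj)
qed (simp add: shift_outside)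

section \<open>The Fourier transform modulo a prime\<close>

definition dot :: "nat \<Rightarrow> nat \<Rightarrow> nat" where
  "dot k i = (\<Sum>j<n. \<beta> k j * \<beta> i j)"

text \<open>With \<open>\<eta>\<close> a primitive \<open>p\<close>-th root of unity modulo
  \<open>l\<close>, the functions \<open>\<eta> ^ dot k i\<close> of \<open>i\<close> are the
  characters of the group of translations.\<close>

definition fourier :: "nat \<Rightarrow> int \<Rightarrow> (nat \<Rightarrow> int) \<Rightarrow> nat \<Rightarrow> int" where
  "fourier l \<eta> v = (\<lambda>k\<in>{..<m}. (\<Sum>i<m. \<eta> ^ dot k i * v i) mod int l)"

lemma fourier_in_vecs: "l > 0 \<Longrightarrow> fourier l \<eta> v \<in> vecs l m"
  by (auto simp: fourier_def vecs_def)

lemma fourier_smul: "fourier l \<eta> (smul l m c v) = smul l m c (fourier l \<eta> v)"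
proof -
  have "(\<Sum>i<m. \<eta> ^ dot k i * smul l m c v i) mod int l = c * ((\<Sum>i<m. \<eta> ^ dot k i * v i) mod int l) mod int l" for k
  proof -
    have "[(\<Sum>i<m. \<eta> ^ dot k i * smul l m c v i) = (\<Sum>i<m. \<eta> ^ dot k i * (c * v i))] (mod int l)"
      by (intro cong_sum cong_mult) (auto simp: smul_apply cong_def)
    also have "(\<Sum>i<m. \<eta> ^ dot k i * (c * v i)) = c * (\<Sum>i<m. \<eta> ^ dot k i * v i)"
      by (simp add: sum_distrib_left ac_simps)
    finally show ?thesis by (simp add: cong_def mod_mult_right_eq)
  qed
  then show ?thesis by (auto simp: fourier_def smul_def intro!: restrict_ext)
qed

context
  fixes l :: nat and \<omega> \<eta> :: int
  assumes l: "prime l" "p dvd l - 1"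
    and \<omega>: "[\<omega> ^ p = 1] (mod int l)" and \<eta>: "[\<eta> ^ p = 1] (mod int l)"
    and \<omega>\<eta>: "[\<omega> * \<eta> = 1] (mod int l)"
    and \<omega>_inj: "\<And>x y. x < p \<Longrightarrow> y < p \<Longrightarrow> [\<omega> ^ x = \<omega> ^ y] (mod int l) \<Longrightarrow> x = y"
begin

lemma \<omega>\<eta>_power: "[\<omega> ^ x * \<eta> ^ x = 1] (mod int l)"
  using cong_pow[OF \<omega>\<eta>, of x] by (simp add: power_mult_distrib)

lemma \<eta>_power_cong:
  assumes "[x = y] (mod p)"
  shows "[\<eta> ^ x = \<eta> ^ y] (mod int l)"
proof -
  have *: "[\<eta> ^ x = \<eta> ^ (x mod p)] (mod int l)" for x
  proof -
    have "[(\<eta> ^ p) ^ (x div p) * \<eta> ^ (x mod p) = 1 ^ (x div p) * \<eta> ^ (x mod p)] (mod int l)"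
      by (intro cong_mult cong_pow \<eta> cong_refl)
    then show ?thesis by (simp flip: power_mult power_add)
  qed
  show ?thesis using *[of x] *[of y] assms by (auto simp: cong_def)
qed

text \<open>Translation adds the linear form to \<open>dot k i\<close> modulo \<open>p\<close>. As
  \<open>\<omega>\<close> and \<open>\<eta>\<close> are inverse, the missing power of
  \<open>\<eta>\<close> is compensated by one of \<open>\<omega>\<close>, and the sum is reindexed
  by the permutation \<open>shift e\<close>.\<close>

lemma fourier_shift:
  assumes "k < m"
  shows "fourier l \<eta> (\<lambda>i\<in>{..<m}. v (shift e i)) k =
    (\<omega> ^ linear_form (\<beta> k) n e mod int l) * fourier l \<eta> v k mod int l"
proof -
  let ?x = "linear_form (\<beta> k) n e"
  have dot: "[dot k (shift e i) = dot k i + ?x] (mod p)" if "i < m" for i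
  proof -
    have "[dot k (shift e i) = (\<Sum>j<n. \<beta> k j * (\<beta> i j + Poly_Mapping.lookup e j))] (mod p)"
      unfolding dot_def using that by (intro cong_sum cong_mult) (auto simp: shift_less cong_def)
    then show ?thesis by (simp add: dot_def linear_form_def distrib_left sum.distrib)
  qed
  have step: "[\<eta> ^ dot k i = \<omega> ^ ?x * \<eta> ^ dot k (shift e i)] (mod int l)" if "i < m" for i
  proof -
    have "[\<omega> ^ ?x * \<eta> ^ dot k (shift e i) = \<omega> ^ ?x * \<eta> ^ (dot k i + ?x)] (mod int l)"
      by (intro cong_mult cong_refl \<eta>_power_cong dot that)
    also have "\<omega> ^ ?x * \<eta> ^ (dot k i + ?x) = \<eta> ^ dot k i * (\<omega> ^ ?x * \<eta> ^ ?x)"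
      by (simp add: power_add ac_simps)
    also have "[\<dots> = \<eta> ^ dot k i * 1] (mod int l)"
      by (intro cong_mult cong_refl \<omega>\<eta>_power)
    finally show ?thesis by (simp add: cong_sym)
  qed
  have "[(\<Sum>i<m. \<eta> ^ dot k i * v (shift e i)) =
      (\<Sum>i<m. (\<omega> ^ ?x * \<eta> ^ dot k (shift e i)) * v (shift e i))] (mod int l)"
    by (intro cong_sum cong_mult cong_refl step) auto
  also have "(\<Sum>i<m. (\<omega> ^ ?x * \<eta> ^ dot k (shift e i)) * v (shift e i)) =
      \<omega> ^ ?x * (\<Sum>i<m. \<eta> ^ dot k (shift e i) * v (shift e i))"
    by (simp add: sum_distrib_left ac_simps)
  also have "(\<Sum>i<m. \<eta> ^ dot k (shift e i) * v (shift e i)) = (\<Sum>i<m. \<eta> ^ dot k i * v i)"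
    by (rule sum.reindex_bij_betw[OF permutes_imp_bij[OF shift_permutes]])
  finally show ?thesis using assms by (simp add: fourier_def cong_def mod_mult_eq)
qed

text \<open>The sum over \<open>k\<close> factors into geometric sums, one for each digit place.
  Where the digits of \<open>i\<close> and \<open>i'\<close> differ, the ratio \<open>z j\<close> is
  a \<open>p\<close>-th root of unity other than 1, so that factor vanishes.\<close>

lemma fourier_orthogonality:
  assumes "i < m" "i' < m"
  shows "[(\<Sum>k<m. \<omega> ^ dot k i' * \<eta> ^ dot k i) = (if i = i' then int m else 0)] (mod int l)"
proof -
  define z where "z j = \<omega> ^ \<beta> i' j * \<eta> ^ \<beta> i j" for j
  have "\<omega> ^ dot k i' * \<eta> ^ dot k i = (\<Prod>j<n. z j ^ \<beta> k j)" for k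
    by (simp add: dot_def z_def power_sum prod.distrib power_mult_distrib mult.commute flip: power_mult)
  then have "(\<Sum>k<m. \<omega> ^ dot k i' * \<eta> ^ dot k i) = (\<Sum>b\<in>{..<n} \<rightarrow>\<^sub>E {..<p}. \<Prod>j<n. z j ^ b j)"
    using sum.reindex_bij_betw[OF \<beta>, of "\<lambda>b. \<Prod>j<n. z j ^ b j"] by simp
  also have "\<dots> = (\<Prod>j<n. \<Sum>c<p. z j ^ c)"
    by (rule prod_sum_PiE[symmetric]) auto
  finally have eq: "(\<Sum>k<m. \<omega> ^ dot k i' * \<eta> ^ dot k i) = (\<Prod>j<n. \<Sum>c<p. z j ^ c)" .
  show ?thesis
  proof (cases "i = i'")
    case True
    have "[(\<Prod>j<n. \<Sum>c<p. z j ^ c) = (\<Prod>j<n. \<Sum>c<p. 1 ^ c)] (mod int l)"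
      unfolding z_def True by (intro cong_prod cong_sum cong_pow \<omega>\<eta>_power)
    then show ?thesis using True eq by simp
  next
    case False
    then obtain j where j: "j < n" "\<beta> i j \<noteq> \<beta> i' j" using \<beta>_eqI assms by blast
    have "[z j ^ p = 1] (mod int l)"
    proof -
      have "[(\<omega> ^ p) ^ \<beta> i' j * (\<eta> ^ p) ^ \<beta> i j = 1 ^ \<beta> i' j * 1 ^ \<beta> i j] (mod int l)"
        by (intro cong_mult cong_pow \<omega> \<eta>)
      then show ?thesis by (simp add: z_def power_mult_distrib mult.commute flip: power_mult)
    qed
    then have "int l dvd (z j - 1) * (\<Sum>c<p. z j ^ c)"
      by (simp add: cong_iff_dvd_diff power_diff_1_eq)
    moreover have "\<not> int l dvd z j - 1"
    proof
      assume "int l dvd z j - 1"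
      then have z: "[z j = 1] (mod int l)" by (simp add: cong_iff_dvd_diff)
      have "[\<omega> ^ \<beta> i' j * (\<omega> ^ \<beta> i j * \<eta> ^ \<beta> i j) = \<omega> ^ \<beta> i' j * 1] (mod int l)"
        by (intro cong_mult cong_refl \<omega>\<eta>_power)
      moreover have "[\<omega> ^ \<beta> i j * z j = \<omega> ^ \<beta> i j * 1] (mod int l)"
        by (intro cong_mult cong_refl z)
      ultimately have "[\<omega> ^ \<beta> i j = \<omega> ^ \<beta> i' j] (mod int l)"
        by (simp add: z_def ac_simps cong_def)
      then show False using \<omega>_inj \<beta>_less assms j by blast
    qed
    ultimately have "int l dvd (\<Sum>c<p. z j ^ c)"
      using l(1) by (simp add: prime_dvd_mult_iff)
    then have "int l dvd (\<Prod>j<n. \<Sum>c<p. z j ^ c)"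
      using j(1) by (meson dvd_trans dvd_prodI finite_lessThan lessThan_iff)
    then show ?thesis using False eq by (simp add: cong_0_iff)
  qed
qed

text \<open>Orthogonality recovers \<open>m\<close> times the vector from its transform, and
  \<open>m\<close> is a unit modulo \<open>l\<close> because \<open>p < l\<close>. Injectivity is
  enough on a finite set.\<close>

lemma bij_betw_fourier: "bij_betw (fourier l \<eta>) (vecs l m) (vecs l m)"
proof -
  have l0: "l > 0" using l(1) by (rule prime_gt_0_nat)
  have "inj_on (fourier l \<eta>) (vecs l m)"
  proof (rule inj_onI)
    fix v w assume v: "v \<in> vecs l m" and w: "w \<in> vecs l m" and eq: "fourier l \<eta> v = fourier l \<eta> w"
    show "v = w"
    proof (rule vecs_eqI[OF v w])
      fix i' assume i': "i' < m"
      have "[(\<Sum>i<m. \<eta> ^ dot k i * v i) = (\<Sum>i<m. \<eta> ^ dot k i * w i)] (mod int l)" if "k < m" for k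
        using fun_cong[OF eq, of k] that by (simp add: fourier_def cong_def)
      then have 0: "[(\<Sum>i<m. \<eta> ^ dot k i * (v i - w i)) = 0] (mod int l)" if "k < m" for k
        using that by (simp add: cong_iff_dvd_diff sum_subtractf right_diff_distrib)
      have 1: "[(\<Sum>k<m. \<omega> ^ dot k i' * (\<Sum>i<m. \<eta> ^ dot k i * (v i - w i))) = (\<Sum>k<m. \<omega> ^ dot k i' * 0)] (mod int l)"
        by (intro cong_sum cong_mult cong_refl 0) auto
      have 2: "(\<Sum>k<m. \<omega> ^ dot k i' * (\<Sum>i<m. \<eta> ^ dot k i * (v i - w i))) =
          (\<Sum>i<m. (\<Sum>k<m. \<omega> ^ dot k i' * \<eta> ^ dot k i) * (v i - w i))"
        by (simp add: sum_distrib_left sum_distrib_right mult.assoc) (rule sum.swap)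
      have 3: "[(\<Sum>i<m. (\<Sum>k<m. \<omega> ^ dot k i' * \<eta> ^ dot k i) * (v i - w i)) =
          (\<Sum>i<m. (if i = i' then int m else 0) * (v i - w i))] (mod int l)"
        by (intro cong_sum cong_mult cong_refl fourier_orthogonality i') auto
      have 4: "(\<Sum>i<m. (if i = i' then int m else 0) * (v i - w i)) = int m * (v i' - w i')"
        using i' by (simp add: if_distrib[of "\<lambda>x. x * _"] cong: if_cong)
      have "[int m * (v i' - w i') = 0] (mod int l)"
        using cong_trans[OF cong_sym[OF 3[unfolded 4]] 1[unfolded 2]] by simp
      then have "int l dvd int m * (v i' - w i')" by (simp only: cong_0_iff)
      moreover have "\<not> int l dvd int m"
      proof
        assume "int l dvd int m"
        then have "l dvd p ^ n" by (simp only: of_nat_dvd_iff)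
        then have "l dvd p" using l(1) prime_dvd_power by blast
        then have "l \<le> p" using p_gt_0 by (intro dvd_imp_le) auto
        moreover have "p \<le> l - 1" using l prime_gt_1_nat[OF l(1)] by (intro dvd_imp_le) auto
        ultimately show False using l0 by linarith
      qed
      ultimately have "int l dvd v i' - w i'" using l(1) by (simp add: prime_dvd_mult_iff)
      then have "v i' mod int l = w i' mod int l" by (simp add: mod_eq_dvd_iff)
      then show "v i' = w i'" using vecs_mem[OF v i'] vecs_mem[OF w i'] by simp
    qed
  qed
  moreover have "fourier l \<eta> ` vecs l m \<subseteq> vecs l m" using fourier_in_vecs[OF l0] by auto
  moreover have "finite (vecs l m)" unfolding vecs_def by (intro finite_PiE) auto
  ultimately show ?thesis by (simp add: bij_betw_def endo_inj_surj)
qed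

end

end

text \<open>Logarithms of \<open>p\<close>-th roots of unity are multiples of
  \<open>u = (l - 1) div p\<close>; on them the carry of Z/(l - 1) is that of Z/p.\<close>

lemma carry_mult: "u > 0 \<Longrightarrow> carry (u * M) (map ((*) u) xs) = carry M xs"
  by (cases "(M, xs)" rule: carry.cases) (auto simp flip: distrib_left)

lemma prime_elem_of_nat_int_poly: "prime p \<Longrightarrow> prime_elem (of_nat p :: int poly)"
  by (simp add: of_nat_poly prime_elem_const_poly_iff)

section \<open>Groups acting on row vectors\<close>

text \<open>Both groups enter through the same data: right actions on vectors modulo primes that
  respect scalars, and a copy of the permutations acting by precomposition.\<close>

lemma has_non_nilpotent_class_of_permutation_action:
  fixes G :: "('g, 'm) monoid_scheme" (structure) and p n d k :: nat
    and act :: "nat \<Rightarrow> (nat \<Rightarrow> int) \<Rightarrow> 'g \<Rightarrow> nat \<Rightarrow> int" and perm :: "(nat \<Rightarrow> nat) \<Rightarrow> 'g"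
  assumes G: "Group.group G" and p: "prime p" and n: "n \<ge> 1"
    and d: "digit_sum p d = k * (p - 1)" "n \<le> k"
    and act_closed: "\<And>l v g. prime l \<Longrightarrow> v \<in> vecs l (p ^ n) \<Longrightarrow> g \<in> carrier G \<Longrightarrow> act l v g \<in> vecs l (p ^ n)"
    and act_mult: "\<And>l v g h. prime l \<Longrightarrow> v \<in> vecs l (p ^ n) \<Longrightarrow> g \<in> carrier G \<Longrightarrow> h \<in> carrier G \<Longrightarrow>
      act l v (g \<otimes> h) = act l (act l v g) h"
    and act_one: "\<And>l v. prime l \<Longrightarrow> v \<in> vecs l (p ^ n) \<Longrightarrow> act l v \<one> = v"
    and act_smul: "\<And>l v g c. prime l \<Longrightarrow> v \<in> vecs l (p ^ n) \<Longrightarrow> g \<in> carrier G \<Longrightarrow>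
      act l (smul l (p ^ n) c v) g = smul l (p ^ n) c (act l v g)"
    and perm_closed: "\<And>\<pi>. \<pi> permutes {..<p ^ n} \<Longrightarrow> perm \<pi> \<in> carrier G"
    and perm_mult: "\<And>\<pi> \<pi>'. \<pi> permutes {..<p ^ n} \<Longrightarrow> \<pi>' permutes {..<p ^ n} \<Longrightarrow>
      perm (\<pi> \<circ> \<pi>') = perm \<pi> \<otimes> perm \<pi>'"
    and act_perm: "\<And>l v \<pi>. prime l \<Longrightarrow> v \<in> vecs l (p ^ n) \<Longrightarrow> \<pi> permutes {..<p ^ n} \<Longrightarrow>
      act l v (perm \<pi>) = (\<lambda>i\<in>{..<p ^ n}. v (\<pi> i))"
  shows "has_non_nilpotent_class G (residue_ring (int p)) ((if p = 2 then 1 else 2) * d)"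
proof -
  have p2: "p \<ge> 2" using p by (rule prime_ge_2_nat)
  have "card {..<p ^ n} = card ({..<n} \<rightarrow>\<^sub>E {..<p})" by (simp add: card_PiE)
  then obtain \<beta> where \<beta>: "bij_betw \<beta> {..<p ^ n} ({..<n} \<rightarrow>\<^sub>E {..<p})"
    using finite_same_card_bij[of "{..<p ^ n}" "{..<n} \<rightarrow>\<^sub>E {..<p}"] by (auto simp: finite_PiE)
  interpret digit_translations p n \<beta> using p \<beta> by unfold_locales
  \<comment> \<open>For \<open>p = 2\<close> the choice \<open>l = 3\<close> makes
    \<open>l - 1 = 2\<close>, so logarithms are already residues modulo 2 and
    \<open>single_entry\<close> is a cocycle.\<close>
  obtain l where lp: "prime l" "p dvd l - 1" "p = 2 \<Longrightarrow> l = 3"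
  proof (cases "p = 2")
    case True
    then show ?thesis using that[of 3] by simp
  next
    case False
    then show ?thesis using that ex_prime_cong_1[OF p] by blast
  qed
  define u where "u = (l - 1) div p"
  have u: "l - 1 = u * p" using lp(2) by (simp add: u_def)
  have "l - 1 > 0" using prime_gt_1_nat[OF lp(1)] by simp
  then have u0: "u > 0" unfolding u by simp
  obtain lg :: "int \<Rightarrow> nat" and \<omega> \<eta> :: int where
    lg: "\<And>x. x \<in> {1..<int l} \<Longrightarrow> lg x < l - 1"
      "\<And>x y. x \<in> {1..<int l} \<Longrightarrow> y \<in> {1..<int l} \<Longrightarrow> lg (x * y mod int l) = (lg x + lg y) mod (l - 1)"
    and \<omega>: "[\<omega> ^ p = 1] (mod int l)" "[\<eta> ^ p = 1] (mod int l)" "[\<omega> * \<eta> = 1] (mod int l)"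
    and lg_\<omega>: "\<And>j. lg (\<omega> ^ j mod int l) = u * (j mod p)"
    using ex_discrete_log[OF lp(1,2) p_gt_0] unfolding u_def by metis
  have \<omega>_inj: "x = y" if "x < p" "y < p" "[\<omega> ^ x = \<omega> ^ y] (mod int l)" for x y
  proof -
    have "u * (x mod p) = u * (y mod p)"
      using that(3) unfolding cong_def lg_\<omega>[symmetric] by (rule arg_cong)
    then show ?thesis using that(1,2) u0 by simp
  qed
  interpret G: Group.group G by (rule G)
  interpret line_action G l "p ^ n" "fourier l \<eta>" "act l" lg
    using lp(1) lg act_closed act_mult act_one act_smul fourier_smul
      bij_betw_fourier[OF lp(1,2) \<omega> \<omega>_inj]
    by unfold_locales auto
  define \<phi> where "\<phi> e = perm (shift e)" for e
  have \<phi>: "\<phi> e \<in> carrier G" "\<phi> (e + e') = \<phi> e \<otimes> \<phi> e'" for e e'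
    by (simp_all add: \<phi>_def shift_add perm_closed perm_mult shift_permutes)
  define \<chi> where "\<chi> k e = \<omega> ^ linear_form (\<beta> k) n e mod int l" for k e
  have \<chi>: "fourier l \<eta> (act l v (\<phi> e)) k = \<chi> k e * fourier l \<eta> v k mod int l"
    if "v \<in> vecs l (p ^ n)" "k < p ^ n" for v k e
    unfolding \<phi>_def \<chi>_def act_perm[OF lp(1) that(1) shift_permutes]
    by (rule fourier_shift[OF lp(1,2) \<omega> \<omega>_inj that(2)])
  have \<chi>_unit: "\<chi> k e \<in> {1..<int l}" for k e
    unfolding \<chi>_def
  proof (rule mod_in_U)
    let ?x = "linear_form (\<beta> k) n e"
    show "\<omega> ^ ?x mod int l \<noteq> 0"
    proof
      assume "\<omega> ^ ?x mod int l = 0"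
      then have "int l dvd \<omega> ^ ?x" by (simp only: dvd_eq_mod_eq_0)
      then have "int l dvd (\<omega> * \<eta>) ^ ?x" by (simp add: power_mult_distrib)
      moreover have "[(\<omega> * \<eta>) ^ ?x = 1 ^ ?x] (mod int l)" by (intro cong_pow \<omega>)
      ultimately have "int l dvd 1 ^ ?x" using cong_dvd_iff by blast
      then have "int l dvd 1" by simp
      then show False using l_gt_1 by simp
    qed
  qed
  \<comment> \<open>The relation \<open>g\<^sub>i ^ p = 1\<close> of the elementary abelian
    group.\<close>
  have \<phi>_period: "\<phi> (Poly_Mapping.single i p) = \<phi> 0" for i
    unfolding \<phi>_def by (subst (1 2) shift_eq_id) (auto simp: lookup_single when_def)
  have d0: "d > 0" using d n p2 by (intro Nat.gr0I) auto
  have sum_\<beta>: "(\<Sum>k<p ^ n. (\<Sum>i<n. of_nat (\<beta> k i) * a i) ^ N) =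
      (\<Sum>b\<in>{..<n} \<rightarrow>\<^sub>E {..<p}. (\<Sum>i<n. of_nat (b i) * a i) ^ N)" for a :: "nat \<Rightarrow> int poly" and N
    by (rule sum.reindex_bij_betw[OF \<beta>])
  \<comment> \<open>The exponent \<open>N\<close> will be \<open>d\<close> for \<open>p = 2\<close>
    and \<open>p * d\<close> for odd \<open>p\<close>.\<close>
  have ex_a: "\<exists>a :: nat \<Rightarrow> int poly. \<not> of_nat p dvd (\<Sum>k<p ^ n. (\<Sum>i<n. of_nat (\<beta> k i) * a i) ^ N)"
    if N: "digit_sum p N = k * (p - 1)" for N
  proof -
    obtain a :: "nat \<Rightarrow> int poly" and e where
      "\<not> int p dvd coeff (\<Sum>b\<in>{..<n} \<rightarrow>\<^sub>E {..<p}. (\<Sum>i<n. of_nat (b i) * a i) ^ N) e"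
      using power_sum_linear_forms_nonzero[OF p N d(2)] n by auto
    then have "\<not> [:int p:] dvd (\<Sum>b\<in>{..<n} \<rightarrow>\<^sub>E {..<p}. (\<Sum>i<n. of_nat (b i) * a i) ^ N)"
      unfolding const_poly_dvd_iff by blast
    moreover have "[:int p:] = of_nat p" by (simp add: of_nat_poly)
    ultimately show ?thesis unfolding sum_\<beta> by auto
  qed
  have prime_elem: "prime_elem (of_nat p :: int poly)" using p by (rule prime_elem_of_nat_int_poly)
  have null: "of_nat p dvd pairing (augmentation_element a n ^ p) (\<lambda>e. F (\<phi> e))"
    for a :: "nat \<Rightarrow> int poly" and F
    by (rule dvd_pairing_augmentation_element_power[OF p]) (simp add: \<phi>_period)
  have aug: "pairing (augmentation_element a n) (\<lambda>_. 1) = 0" for a :: "nat \<Rightarrow> int poly"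
    by (simp add: pairing_augmentation_element)
  show ?thesis
  proof (cases "p = 2")
    case True
    obtain a :: "nat \<Rightarrow> int poly" where
      a: "\<not> of_nat p dvd (\<Sum>k<p ^ n. (\<Sum>i<n. of_nat (\<beta> k i) * a i) ^ d)"
      using ex_a[OF d(1)] by blast
    define t where "t = augmentation_element a n"
    have "u = 1" using u lp(3) True by simp
    have "has_non_nilpotent_class G (residue_ring (int p)) (length [t] * d)"
    proof (rule has_non_nilpotent_class_transfer[where \<phi> = \<phi> and \<chi> = \<chi> and \<kappa> = single_entry
          and Q = "\<lambda>k. \<Sum>i<n. of_nat (\<beta> k i) * a i"])
      show "successively (\<lambda>\<alpha> \<beta>. \<forall>F. of_nat p dvd pairing (\<alpha> * \<beta>) (\<lambda>e. F (\<phi> e))) ([t] @ [hd [t]])"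
        using null[of a] True by (simp add: t_def power2_eq_square)
      show "int p dvd int_coboundary (\<lambda>x y. (x + y) mod (l - 1)) single_entry xs" for xs
        using single_entry_cocycle[of p xs] True lp(3) by simp
      show "of_nat p dvd bar_eval [t] (\<lambda>es. single_entry (map (\<lambda>e. lg (\<chi> k e)) es)) -
          (\<Sum>i<n. of_nat (\<beta> k i) * a i)" if "k < p ^ n" for k
      proof -
        have "bar_eval [t] (\<lambda>es. single_entry (map (\<lambda>e. lg (\<chi> k e)) es)) =
            pairing t (\<lambda>e. of_nat (linear_form (\<beta> k) n e mod p))"
          by (simp add: \<chi>_def lg_\<omega> \<open>u = 1\<close>)
        also have "\<dots> = (\<Sum>i<n. a i * of_nat (\<beta> k i))"
          unfolding t_def pairing_augmentation_element
          using \<beta>_less[OF that] by (intro sum.cong) (auto simp: linear_form_single)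
        finally show ?thesis by (simp add: mult.commute)
      qed
    qed (use p lp d0 \<phi> \<chi> \<chi>_unit single_entry_eq_0 a prime_elem aug prime_gt_1_nat in \<open>auto simp: t_def\<close>)
    then show ?thesis using True by simp
  next
    case False
    \<comment> \<open>The degree 2 class evaluates to a \<open>p\<close>-th power of a linear form,
      so the exponent is \<open>p * d\<close>; appending a digit 0 keeps the digit sum.\<close>
    have "digit_sum p (p * d) = k * (p - 1)"
      using digit_sum_mult_add[OF p2, of 0 d] p2 d(1) by simp
    then obtain a :: "nat \<Rightarrow> int poly" where
      a: "\<not> of_nat p dvd (\<Sum>k<p ^ n. (\<Sum>i<n. of_nat (\<beta> k i) * a i) ^ (p * d))"
      using ex_a by blast
    define t where "t = augmentation_element a n"
    have "has_non_nilpotent_class G (residue_ring (int p)) (length [t, t ^ (p - 1)] * d)"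
    proof (rule has_non_nilpotent_class_transfer[where \<phi> = \<phi> and \<chi> = \<chi> and \<kappa> = "carry (l - 1)"
          and Q = "\<lambda>k. (\<Sum>i<n. of_nat (\<beta> k i) * a i) ^ p"])
      \<comment> \<open>Both products of neighbours in the alternating chain are
        \<open>t ^ p\<close>, also across the join of two copies.\<close>
      have "t * t ^ (p - 1) = t ^ p" "t ^ (p - 1) * t = t ^ p"
        using p2 by (simp_all add: mult.commute flip: power_Suc)
      then show "successively (\<lambda>\<alpha> \<beta>. \<forall>F. of_nat p dvd pairing (\<alpha> * \<beta>) (\<lambda>e. F (\<phi> e)))
          ([t, t ^ (p - 1)] @ [hd [t, t ^ (p - 1)]])"
        using null[of a] by (simp add: t_def)
      show "int p dvd int_coboundary (\<lambda>x y. (x + y) mod (l - 1)) (carry (l - 1)) xs" for xs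
        by (simp only: carry_cocycle dvd_0_right)
      show "of_nat p dvd bar_eval [t, t ^ (p - 1)] (\<lambda>es. carry (l - 1) (map (\<lambda>e. lg (\<chi> k e)) es)) -
          (\<Sum>i<n. of_nat (\<beta> k i) * a i) ^ p" for k
      proof -
        have "carry (l - 1) (map (\<lambda>e. lg (\<chi> k e)) es) =
            carry p (map (\<lambda>e. linear_form (\<beta> k) n e mod p) es)" for es
          using carry_mult[OF u0, of p "map (\<lambda>e. linear_form (\<beta> k) n e mod p) es"]
          by (simp add: \<chi>_def lg_\<omega> u comp_def del: One_nat_def)
        then show ?thesis unfolding t_def using bar_eval_carry[OF p] by simp
      qed
      show "pairing \<alpha> (\<lambda>_. 1) = 0" if "\<alpha> \<in> set [t, t ^ (p - 1)]" for \<alpha>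
        using that p2 aug[of a] by (auto simp: t_def pairing_const_1_power power_0_left)
      show "\<not> of_nat p dvd (\<Sum>k<p ^ n. ((\<Sum>i<n. of_nat (\<beta> k i) * a i) ^ p) ^ d)"
        using a by (simp add: power_mult)
    qed (use p lp d0 \<phi> \<chi> \<chi>_unit carry_eq_0 prime_elem prime_gt_1_nat in auto)
    then show ?thesis using False by (simp add: mult_2)
  qed
qed


section \<open>The general linear group\<close>

definition mat_act :: "nat \<Rightarrow> nat \<Rightarrow> (nat \<Rightarrow> int) \<Rightarrow> int mat \<Rightarrow> nat \<Rightarrow> int" where
  "mat_act m l v A = (\<lambda>j\<in>{..<m}. (\<Sum>i<m. v i * A $$ (i, j)) mod int l)"

text \<open>Column \<open>j\<close> has its 1 in row \<open>\<pi> j\<close>, so that row vectors are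
  precomposed with \<open>\<pi>\<close> and composition becomes the matrix product in the same
  order.\<close>

definition perm_mat :: "nat \<Rightarrow> (nat \<Rightarrow> nat) \<Rightarrow> int mat" where
  "perm_mat m \<pi> = mat m m (\<lambda>(i, j). if i = \<pi> j then 1 else 0)"

lemma group_GL_int: "group (GL_int m)"
proof -
  interpret ring "ring_mat TYPE(int) m ()" by (rule ring_mat)
  show ?thesis unfolding GL_int_def by (rule units_group)
qed

lemma carrier_GL_int:
  "carrier (GL_int m) = {A \<in> carrier_mat m m. \<exists>B\<in>carrier_mat m m. B * A = 1\<^sub>m m \<and> A * B = 1\<^sub>m m}"
  by (simp add: GL_int_def units_of_def Units_def ring_mat_simps)

lemma GL_int_carrier_mat: "A \<in> carrier (GL_int m) \<Longrightarrow> A \<in> carrier_mat m m"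
  by (simp add: carrier_GL_int)

lemma mult_GL_int [simp]: "A \<otimes>\<^bsub>GL_int m\<^esub> B = A * B"
  by (simp add: GL_int_def units_of_def ring_mat_simps)

lemma one_GL_int [simp]: "\<one>\<^bsub>GL_int m\<^esub> = 1\<^sub>m m"
  by (simp add: GL_int_def units_of_def ring_mat_simps)

lemma mat_act_mult:
  assumes "A \<in> carrier_mat m m" "B \<in> carrier_mat m m"
  shows "mat_act m l v (A * B) = mat_act m l (mat_act m l v A) B"
proof -
  have "(\<Sum>i<m. v i * (A * B) $$ (i, j)) mod int l =
      (\<Sum>k<m. mat_act m l v A k * B $$ (k, j)) mod int l" if "j < m" for j
  proof -
    have "(\<Sum>i<m. v i * (A * B) $$ (i, j)) = (\<Sum>i<m. \<Sum>k<m. v i * A $$ (i, k) * B $$ (k, j))"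
      using assms that by (auto simp: scalar_prod_def sum_distrib_left lessThan_atLeast0 mult.assoc
          intro!: sum.cong)
    also have "\<dots> = (\<Sum>k<m. (\<Sum>i<m. v i * A $$ (i, k)) * B $$ (k, j))"
      by (simp add: sum_distrib_right) (rule sum.swap)
    also have "[\<dots> = (\<Sum>k<m. mat_act m l v A k * B $$ (k, j))] (mod int l)"
      by (intro cong_sum cong_mult cong_refl) (auto simp: mat_act_def cong_def)
    finally show ?thesis by (simp add: cong_def)
  qed
  then show ?thesis by (auto simp: mat_act_def[of m l _ "A * B"] mat_act_def[of m l _ B] intro!: restrict_ext)
qed

lemma mat_act_perm:
  assumes "v \<in> vecs l m" "\<pi> permutes {..<m}"
  shows "mat_act m l v (perm_mat m \<pi>) = (\<lambda>i\<in>{..<m}. v (\<pi> i))"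
proof -
  have "(\<Sum>i<m. v i * perm_mat m \<pi> $$ (i, j)) mod int l = v (\<pi> j)" if "j < m" for j
  proof -
    have \<pi>: "\<pi> j < m" using permutes_in_image[OF assms(2), of j] that by simp
    have "(\<Sum>i<m. v i * perm_mat m \<pi> $$ (i, j)) = (\<Sum>i<m. if i = \<pi> j then v i else 0)"
      using that by (intro sum.cong) (auto simp: perm_mat_def)
    then show ?thesis using \<pi> vecs_mem[OF assms(1) \<pi>] by simp
  qed
  then show ?thesis by (auto simp: mat_act_def intro!: restrict_ext)
qed

lemma perm_mat_mult:
  assumes "\<pi>' permutes {..<m}"
  shows "perm_mat m (\<pi> \<circ> \<pi>') = perm_mat m \<pi> * perm_mat m \<pi>'"
proof (rule eq_matI)
  fix i j assume "i < dim_row (perm_mat m \<pi> * perm_mat m \<pi>')" "j < dim_col (perm_mat m \<pi> * perm_mat m \<pi>')"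
  then have ij: "i < m" "j < m" by (auto simp: perm_mat_def)
  have "\<pi>' j < m" using permutes_in_image[OF assms, of j] ij by simp
  have "(perm_mat m \<pi> * perm_mat m \<pi>') $$ (i, j) =
      (\<Sum>k<m. perm_mat m \<pi> $$ (i, k) * perm_mat m \<pi>' $$ (k, j))"
    using ij by (auto simp: perm_mat_def scalar_prod_def lessThan_atLeast0 intro!: sum.cong)
  also have "\<dots> = (\<Sum>k<m. if k = \<pi>' j then perm_mat m \<pi> $$ (i, k) else 0)"
    using ij by (intro sum.cong) (auto simp: perm_mat_def)
  also have "\<dots> = perm_mat m \<pi> $$ (i, \<pi>' j)" using \<open>\<pi>' j < m\<close> by simp
  finally show "perm_mat m (\<pi> \<circ> \<pi>') $$ (i, j) = (perm_mat m \<pi> * perm_mat m \<pi>') $$ (i, j)"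
    using ij \<open>\<pi>' j < m\<close> by (simp add: perm_mat_def)
qed (auto simp: perm_mat_def)

lemma perm_mat_in_GL_int:
  assumes "\<pi> permutes {..<m}"
  shows "perm_mat m \<pi> \<in> carrier (GL_int m)"
proof -
  have carrier: "perm_mat m \<sigma> \<in> carrier_mat m m" for \<sigma> by (simp add: perm_mat_def)
  have "perm_mat m id = 1\<^sub>m m" by (auto simp: perm_mat_def)
  then have "perm_mat m (inv_into UNIV \<pi>) * perm_mat m \<pi> = 1\<^sub>m m" "perm_mat m \<pi> * perm_mat m (inv_into UNIV \<pi>) = 1\<^sub>m m"
    using assms permutes_inv[OF assms] permutes_inv_o[OF assms]
    by (simp_all flip: perm_mat_mult)
  then show ?thesis unfolding carrier_GL_int using carrier by blast
qed

lemma has_non_nilpotent_class_GL_int: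
  assumes "prime p" "n \<ge> 1" "digit_sum p d = k * (p - 1)" "n \<le> k"
  shows "has_non_nilpotent_class (GL_int (p ^ n)) (residue_ring (int p)) ((if p = 2 then 1 else 2) * d)"
proof (rule has_non_nilpotent_class_of_permutation_action[where act = "mat_act (p ^ n)" and perm = "perm_mat (p ^ n)"])
  fix l v assume l: "prime l" and v: "v \<in> vecs l (p ^ n)"
  show "mat_act (p ^ n) l v g \<in> vecs l (p ^ n)" for g
    using prime_gt_0_nat[OF l] by (auto simp: mat_act_def vecs_def)
  show "mat_act (p ^ n) l v \<one>\<^bsub>GL_int (p ^ n)\<^esub> = v"
  proof (rule vecs_eqI[OF _ v])
    show "mat_act (p ^ n) l v \<one>\<^bsub>GL_int (p ^ n)\<^esub> \<in> vecs l (p ^ n)"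
      using prime_gt_0_nat[OF l] by (auto simp: mat_act_def vecs_def)
    fix j assume j: "j < p ^ n"
    have "(\<Sum>i<p ^ n. v i * 1\<^sub>m (p ^ n) $$ (i, j)) = (\<Sum>i<p ^ n. if i = j then v i else 0)"
      using j by (intro sum.cong) auto
    then show "mat_act (p ^ n) l v \<one>\<^bsub>GL_int (p ^ n)\<^esub> j = v j"
      using j vecs_mem[OF v j] by (simp add: mat_act_def)
  qed
  show "mat_act (p ^ n) l v (perm_mat (p ^ n) \<pi>) = (\<lambda>i\<in>{..<p ^ n}. v (\<pi> i))"
    if "\<pi> permutes {..<p ^ n}" for \<pi>
    using mat_act_perm[OF v that] .
  show "mat_act (p ^ n) l (smul l (p ^ n) c v) g = smul l (p ^ n) c (mat_act (p ^ n) l v g)" for c g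
  proof -
    have "(\<Sum>i<p ^ n. smul l (p ^ n) c v i * g $$ (i, j)) mod int l =
        c * ((\<Sum>i<p ^ n. v i * g $$ (i, j)) mod int l) mod int l" for j
    proof -
      have "[(\<Sum>i<p ^ n. smul l (p ^ n) c v i * g $$ (i, j)) = (\<Sum>i<p ^ n. c * v i * g $$ (i, j))] (mod int l)"
        by (intro cong_sum cong_mult cong_refl) (auto simp: smul_apply cong_def)
      then show ?thesis by (simp add: cong_def mod_mult_right_eq sum_distrib_left mult.assoc)
    qed
    then show ?thesis by (auto simp: mat_act_def smul_def[of l _ c "restrict _ _"] intro!: restrict_ext)
  qed
qed (use assms in \<open>auto simp: group_GL_int mat_act_mult perm_mat_mult perm_mat_in_GL_int
    dest!: GL_int_carrier_mat\<close>)

section \<open>The automorphism group of the free group\<close>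

text \<open>The homomorphism from the free group to the integers with values \<open>v\<close> on the
  generators, defined on all words so that invariance under reduction can be checked letter by
  letter.\<close>

definition word_sum :: "(nat \<Rightarrow> int) \<Rightarrow> (nat \<times> bool) list \<Rightarrow> int" where
  "word_sum v w = (\<Sum>(x, b)\<leftarrow>w. if b then v x else - v x)"

lemma word_sum_Nil [simp]: "word_sum v [] = 0"
  by (simp add: word_sum_def)

lemma word_sum_Cons: "word_sum v (a # w) = word_sum v [a] + word_sum v w"
  by (simp add: word_sum_def)

lemma word_sum_True [simp]: "word_sum v [(x, True)] = v x"
  by (simp add: word_sum_def)

lemma word_sum_False [simp]: "word_sum v [(x, False)] = - v x"
  by (simp add: word_sum_def)

lemma word_sum_cancels: "cancels a b \<Longrightarrow> word_sum v [a] = - word_sum v [b]"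
  by (cases a; cases b; auto simp: word_sum_def)

lemma word_sum_cons_reduce: "word_sum v (cons_reduce a w) = word_sum v [a] + word_sum v w"
proof (cases w)
  case (Cons b u)
  then show ?thesis
    using word_sum_cancels[of a b v] word_sum_Cons[of v a "b # u"] word_sum_Cons[of v b u] by auto
qed simp

lemma word_sum_mult: "word_sum v (foldr cons_reduce u w) = word_sum v u + word_sum v w"
proof (induction u)
  case (Cons a u)
  then show ?case using word_sum_Cons[of v a u] by (simp add: word_sum_cons_reduce)
qed simp

lemma word_sum_free_group_mult:
  "word_sum v (u \<otimes>\<^bsub>free_group S\<^esub> w) = word_sum v u + word_sum v w"
  by (simp add: free_group_def word_sum_mult)

lemma carrier_free_group: "w \<in> carrier (free_group S) \<longleftrightarrow> reduced w \<and> set w \<subseteq> S \<times> UNIV"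
  by (simp add: free_group_def)

text \<open>A vector stands for the homomorphism to GF(l) with these values on the generators, and
  \<open>f\<close> acts by precomposition.\<close>

definition hom_act :: "nat \<Rightarrow> nat \<Rightarrow> (nat \<Rightarrow> int) \<Rightarrow> ((nat \<times> bool) list \<Rightarrow> (nat \<times> bool) list) \<Rightarrow> nat \<Rightarrow> int" where
  "hom_act m l v f = (\<lambda>j\<in>{..<m}. word_sum v (f [(j, True)]) mod int l)"

lemma generator_in_free_group: "j \<in> S \<Longrightarrow> [(j, b)] \<in> carrier (free_group S)"
  by (simp add: carrier_free_group)

lemma word_sum_cong:
  assumes "set w \<subseteq> {..<m} \<times> UNIV" "\<And>i. i < m \<Longrightarrow> [v i = v' i] (mod int l)"
  shows "[word_sum v w = word_sum v' w] (mod int l)"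
  using assms(1)
proof (induction w)
  case (Cons a w)
  then have "[word_sum v [a] = word_sum v' [a]] (mod int l)"
    using assms(2)[of "fst a"] by (cases a; cases "snd a") (auto simp: cong_minus_minus_iff)
  then have "[word_sum v [a] + word_sum v w = word_sum v' [a] + word_sum v' w] (mod int l)"
    using Cons by (intro cong_add) auto
  then show ?case using word_sum_Cons[of _ a w] by metis
qed simp

text \<open>Two homomorphisms to GF(l) that agree on the generators agree everywhere; the induction
  splits off one letter at a time.\<close>

lemma word_sum_hom_act:
  assumes f: "f \<in> hom (free_group {..<m}) (free_group {..<m})" and w: "w \<in> carrier (free_group {..<m})"
  shows "[word_sum (hom_act m l v f) w = word_sum v (f w)] (mod int l)"
  using w
proof (induction w)
  let ?F = "free_group {..<m}"
  interpret F: Group.group ?F by (rule group_free_group)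
  have one: "f [] = []"
    using hom_one[OF f F.is_group F.is_group] by (simp add: free_group_def)
  case Nil
  show ?case by (simp add: one)
next
  let ?F = "free_group {..<m}"
  interpret F: Group.group ?F by (rule group_free_group)
  have one: "f [] = []"
    using hom_one[OF f F.is_group F.is_group] by (simp add: free_group_def)
  case (Cons a w)
  obtain j b where a: "a = (j, b)" by fastforce
  have j: "j < m" using Cons.prems by (simp add: carrier_free_group a)
  have gen: "[(j, c)] \<in> carrier ?F" for c using j by (intro generator_in_free_group) simp
  have w: "w \<in> carrier ?F" using Cons.prems by (auto simp: carrier_free_group dest: reduced_ConsD)
  \<comment> \<open>\<open>hom_act\<close> looks only at positive letters; the value at an inverse
    letter follows from the image of this relation.\<close>
  have "[(j, True)] \<otimes>\<^bsub>?F\<^esub> [(j, False)] = []" by (simp add: free_group_def)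
  then have "f [(j, True)] \<otimes>\<^bsub>?F\<^esub> f [(j, False)] = []"
    using hom_mult[OF f gen gen] one by metis
  then have neg: "word_sum v (f [(j, False)]) = - word_sum v (f [(j, True)])"
    using word_sum_free_group_mult[where v = v and u = "f [(j, True)]" and w = "f [(j, False)]" and S = "{..<m}"]
    by (simp add: add_eq_0_iff)
  \<comment> \<open>The word is reduced, so nothing cancels when its first letter is split
    off.\<close>
  have "[(j, b)] \<otimes>\<^bsub>?F\<^esub> w = (j, b) # w"
    using Cons.prems by (cases w) (auto simp: free_group_def a)
  then have "f (a # w) = f [(j, b)] \<otimes>\<^bsub>?F\<^esub> f w"
    using hom_mult[OF f gen w] by (metis a)
  then have fw: "word_sum v (f (a # w)) = word_sum v (f [(j, b)]) + word_sum v (f w)"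
    by (simp add: word_sum_free_group_mult)
  have "[word_sum (hom_act m l v f) [(j, b)] = word_sum v (f [(j, b)])] (mod int l)"
    using j by (cases b) (auto simp: hom_act_def neg cong_def mod_minus_eq)
  then have "[word_sum (hom_act m l v f) [(j, b)] + word_sum (hom_act m l v f) w =
      word_sum v (f [(j, b)]) + word_sum v (f w)] (mod int l)"
    using Cons.IH[OF w] by (rule cong_add)
  then show ?case
    using word_sum_Cons[of "hom_act m l v f" "(j, b)" w] fw by (simp add: a)
qed

section \<open>The group structure and the permutation automorphisms\<close>

lemma group_Aut_free_group: "group (Aut_free_group m)"
proof -
  interpret F: Group.group "free_group {..<m}" by (rule group_free_group)
  show ?thesis unfolding Aut_free_group_def by (rule F.AutoGroup)
qed

lemma carrier_Aut_free_group: "carrier (Aut_free_group m) = auto (free_group {..<m})"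
  by (simp add: Aut_free_group_def AutoGroup_def)

lemma mult_Aut_free_group:
  assumes "f \<in> carrier (Aut_free_group m)" "g \<in> carrier (Aut_free_group m)"
  shows "f \<otimes>\<^bsub>Aut_free_group m\<^esub> g = compose (carrier (free_group {..<m})) f g"
  using assms by (simp add: Aut_free_group_def AutoGroup_def BijGroup_def auto_def)

lemma one_Aut_free_group: "\<one>\<^bsub>Aut_free_group m\<^esub> = (\<lambda>w\<in>carrier (free_group {..<m}). w)"
  by (simp add: Aut_free_group_def AutoGroup_def BijGroup_def)

text \<open>An injective renaming of letters keeps reduced words reduced, so no reduction has to
  follow the \<open>map\<close>.\<close>

definition perm_aut :: "nat \<Rightarrow> (nat \<Rightarrow> nat) \<Rightarrow> (nat \<times> bool) list \<Rightarrow> (nat \<times> bool) list" where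
  "perm_aut m \<pi> = (\<lambda>w\<in>carrier (free_group {..<m}). map (map_prod \<pi> id) w)"

lemma cancels_map_prod: "inj \<pi> \<Longrightarrow> cancels (map_prod \<pi> id a) (map_prod \<pi> id b) \<longleftrightarrow> cancels a b"
  by (cases a; cases b) (auto simp: inj_eq)

lemma reduced_map: "inj \<pi> \<Longrightarrow> reduced (map (map_prod \<pi> id) w) \<longleftrightarrow> reduced w"
  by (induction w rule: reduced.induct) (auto simp: cancels_map_prod)

lemma cons_reduce_map:
  "inj \<pi> \<Longrightarrow> map (map_prod \<pi> id) (cons_reduce a w) = cons_reduce (map_prod \<pi> id a) (map (map_prod \<pi> id) w)"
  by (cases w) (auto simp: cancels_map_prod)

lemma foldr_cons_reduce_map:
  "inj \<pi> \<Longrightarrow> map (map_prod \<pi> id) (foldr cons_reduce u w) =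
    foldr cons_reduce (map (map_prod \<pi> id) u) (map (map_prod \<pi> id) w)"
  by (induction u) (auto simp: cons_reduce_map)

lemma map_perm_in_free_group:
  assumes "\<pi> permutes S" "w \<in> carrier (free_group S)"
  shows "map (map_prod \<pi> id) w \<in> carrier (free_group S)"
  using assms permutes_in_image[OF assms(1)] reduced_map[OF permutes_inj[OF assms(1)]]
  by (auto simp: carrier_free_group)

lemma perm_aut_comp:
  assumes "\<pi>' permutes {..<m}"
  shows "perm_aut m (\<pi> \<circ> \<pi>') = compose (carrier (free_group {..<m})) (perm_aut m \<pi>) (perm_aut m \<pi>')"
  using map_perm_in_free_group[OF assms]
  by (auto simp: perm_aut_def compose_def map_prod.comp intro!: restrict_ext)

lemma perm_aut_in_Aut:
  assumes \<pi>: "\<pi> permutes {..<m}"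
  shows "perm_aut m \<pi> \<in> carrier (Aut_free_group m)"
proof -
  let ?C = "carrier (free_group {..<m})"
  have "bij_betw (perm_aut m \<pi>) ?C ?C"
  proof (rule bij_betw_byWitness[where f' = "perm_aut m (inv_into UNIV \<pi>)"])
    show "\<forall>w\<in>?C. perm_aut m (inv_into UNIV \<pi>) (perm_aut m \<pi> w) = w"
      using map_perm_in_free_group[OF \<pi>] permutes_inverses[OF \<pi>]
      by (auto simp: perm_aut_def map_prod.comp comp_def intro!: map_idI)
    show "\<forall>w\<in>?C. perm_aut m \<pi> (perm_aut m (inv_into UNIV \<pi>) w) = w"
      using map_perm_in_free_group[OF permutes_inv[OF \<pi>]] permutes_inverses[OF \<pi>]
      by (auto simp: perm_aut_def map_prod.comp comp_def intro!: map_idI)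
  qed (use map_perm_in_free_group[OF \<pi>] map_perm_in_free_group[OF permutes_inv[OF \<pi>]]
      in \<open>auto simp: perm_aut_def\<close>)
  moreover have "perm_aut m \<pi> \<in> hom (free_group {..<m}) (free_group {..<m})"
  proof (rule homI)
    interpret F: Group.group "free_group {..<m}" by (rule group_free_group)
    show "perm_aut m \<pi> w \<in> ?C" if "w \<in> ?C" for w
      using map_perm_in_free_group[OF \<pi> that] that by (simp add: perm_aut_def)
    show "perm_aut m \<pi> (u \<otimes>\<^bsub>free_group {..<m}\<^esub> w) =
        perm_aut m \<pi> u \<otimes>\<^bsub>free_group {..<m}\<^esub> perm_aut m \<pi> w" if "u \<in> ?C" "w \<in> ?C" for u w
      using F.m_closed[OF that] that foldr_cons_reduce_map[OF permutes_inj[OF \<pi>], of u w]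
      by (simp add: perm_aut_def) (simp add: free_group_def)
  qed
  ultimately show ?thesis
    unfolding carrier_Aut_free_group auto_def Bij_def by (simp add: perm_aut_def)
qed

lemma perm_aut_mult:
  assumes "\<pi> permutes {..<m}" "\<pi>' permutes {..<m}"
  shows "perm_aut m (\<pi> \<circ> \<pi>') = perm_aut m \<pi> \<otimes>\<^bsub>Aut_free_group m\<^esub> perm_aut m \<pi>'"
  using perm_aut_comp[OF assms(2)] mult_Aut_free_group[OF perm_aut_in_Aut perm_aut_in_Aut] assms
  by simp

text \<open>The product is composition with \<open>g\<close> applied first, so precomposition is a
  right action.\<close>

lemma hom_act_mult:
  assumes "f \<in> carrier (Aut_free_group m)" "g \<in> carrier (Aut_free_group m)"
  shows "hom_act m l v (f \<otimes>\<^bsub>Aut_free_group m\<^esub> g) = hom_act m l (hom_act m l v f) g"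
proof -
  have hom: "f \<in> hom (free_group {..<m}) (free_group {..<m})" "g \<in> hom (free_group {..<m}) (free_group {..<m})"
    using assms by (auto simp: carrier_Aut_free_group auto_def)
  have "word_sum v (f (g [(j, True)])) mod int l = word_sum (hom_act m l v f) (g [(j, True)]) mod int l"
    if "j < m" for j
  proof -
    have "g [(j, True)] \<in> carrier (free_group {..<m})"
      using hom_in_carrier[OF hom(2)] generator_in_free_group[of j "{..<m}" True] that by simp
    then show ?thesis using word_sum_hom_act[OF hom(1)] by (simp add: cong_def)
  qed
  then show ?thesis
    unfolding mult_Aut_free_group[OF assms] hom_act_def[of m l "hom_act m l v f" g]
      hom_act_def[of m l v "compose (carrier (free_group {..<m})) f g"]
    by (intro restrict_ext) (simp add: compose_def generator_in_free_group)
qed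

lemma has_non_nilpotent_class_Aut_free_group:
  assumes "prime p" "n \<ge> 1" "digit_sum p d = k * (p - 1)" "n \<le> k"
  shows "has_non_nilpotent_class (Aut_free_group (p ^ n)) (residue_ring (int p)) ((if p = 2 then 1 else 2) * d)"
proof (rule has_non_nilpotent_class_of_permutation_action[where act = "hom_act (p ^ n)" and perm = "perm_aut (p ^ n)"])
  fix l v assume l: "prime l" and v: "v \<in> vecs l (p ^ n)"
  show "hom_act (p ^ n) l v g \<in> vecs l (p ^ n)" for g
    using prime_gt_0_nat[OF l] by (auto simp: hom_act_def vecs_def)
  show "hom_act (p ^ n) l v \<one>\<^bsub>Aut_free_group (p ^ n)\<^esub> = v"
  proof (rule vecs_eqI[OF _ v])
    show "hom_act (p ^ n) l v \<one>\<^bsub>Aut_free_group (p ^ n)\<^esub> \<in> vecs l (p ^ n)"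
      using prime_gt_0_nat[OF l] by (auto simp: hom_act_def vecs_def)
    fix j assume "j < p ^ n"
    then show "hom_act (p ^ n) l v \<one>\<^bsub>Aut_free_group (p ^ n)\<^esub> j = v j"
      using vecs_mem[OF v] by (simp add: hom_act_def one_Aut_free_group generator_in_free_group)
  qed
  show "hom_act (p ^ n) l v (perm_aut (p ^ n) \<pi>) = (\<lambda>i\<in>{..<p ^ n}. v (\<pi> i))"
    if \<pi>: "\<pi> permutes {..<p ^ n}" for \<pi>
    unfolding hom_act_def
  proof (rule restrict_ext)
    fix i assume i: "i \<in> {..<p ^ n}"
    then have "\<pi> i < p ^ n" using permutes_in_image[OF \<pi>, of i] by simp
    then have "v (\<pi> i) mod int l = v (\<pi> i)" using vecs_mem[OF v] by simp
    then show "word_sum v (perm_aut (p ^ n) \<pi> [(i, True)]) mod int l = v (\<pi> i)"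
      using generator_in_free_group[OF i] by (simp add: perm_aut_def)
  qed
  show "hom_act (p ^ n) l (smul l (p ^ n) c v) g = smul l (p ^ n) c (hom_act (p ^ n) l v g)"
    if g: "g \<in> carrier (Aut_free_group (p ^ n))" for c g
  proof -
    have "word_sum (smul l (p ^ n) c v) (g [(j, True)]) mod int l =
        c * (word_sum v (g [(j, True)]) mod int l) mod int l" if j: "j < p ^ n" for j
    proof -
      have "g \<in> hom (free_group {..<p ^ n}) (free_group {..<p ^ n})"
        using g by (simp add: carrier_Aut_free_group auto_def)
      moreover have "[(j, True)] \<in> carrier (free_group {..<p ^ n})"
        using j by (simp add: generator_in_free_group)
      ultimately have "g [(j, True)] \<in> carrier (free_group {..<p ^ n})"
        by (rule hom_in_carrier)
      then have "set (g [(j, True)]) \<subseteq> {..<p ^ n} \<times> UNIV" by (simp add: carrier_free_group)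
      then have "[word_sum (smul l (p ^ n) c v) (g [(j, True)]) =
          word_sum (\<lambda>i. c * v i) (g [(j, True)])] (mod int l)"
        by (rule word_sum_cong) (simp add: smul_apply cong_def)
      moreover have "word_sum (\<lambda>i. c * v i) w = c * word_sum v w" for w
        by (induction w) (auto simp: word_sum_def algebra_simps)
      ultimately show ?thesis by (simp add: cong_def mod_mult_right_eq)
    qed
    then show ?thesis by (auto simp: hom_act_def smul_def[of l _ c "restrict _ _"] intro!: restrict_ext)
  qed
qed (use assms in \<open>auto simp: group_Aut_free_group hom_act_mult perm_aut_in_Aut perm_aut_mult\<close>)

theorem theorem3:
  fixes p n :: nat
  assumes "prime p" and "n \<ge> 1"
  shows
    "(odd p \<longrightarrow>
        (\<forall>d::nat. (\<exists>k\<ge>n. digit_sum p d = k * (p - 1)) \<longrightarrow>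
           has_non_nilpotent_class (Aut_free_group (p ^ n)) (residue_ring (int p)) (2 * d) \<and>
           has_non_nilpotent_class (GL_int (p ^ n)) (residue_ring (int p)) (2 * d)) \<and>
        has_non_nilpotent_class (Aut_free_group (p ^ n)) (residue_ring (int p)) (2 * p ^ n - 2) \<and>
        has_non_nilpotent_class (GL_int (p ^ n)) (residue_ring (int p)) (2 * p ^ n - 2)) \<and>
     (p = 2 \<longrightarrow>
        (\<forall>d::nat. (\<exists>k\<ge>n. digit_sum 2 d = k) \<longrightarrow>
           has_non_nilpotent_class (Aut_free_group (2 ^ n)) (residue_ring 2) d \<and>
           has_non_nilpotent_class (GL_int (2 ^ n)) (residue_ring 2) d) \<and>
        has_non_nilpotent_class (Aut_free_group (2 ^ n)) (residue_ring 2) (2 ^ n - 1) \<and>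
        has_non_nilpotent_class (GL_int (2 ^ n)) (residue_ring 2) (2 ^ n - 1))"
proof -
  let ?P = "\<lambda>d. has_non_nilpotent_class (Aut_free_group (p ^ n)) (residue_ring (int p)) ((if p = 2 then 1 else 2) * d) \<and>
    has_non_nilpotent_class (GL_int (p ^ n)) (residue_ring (int p)) ((if p = 2 then 1 else 2) * d)"
  have P: "?P d" if "k \<ge> n" "digit_sum p d = k * (p - 1)" for d k
    using has_non_nilpotent_class_Aut_free_group[OF assms that(2,1)]
      has_non_nilpotent_class_GL_int[OF assms that(2,1)] by blast
  \<comment> \<open>Taking \<open>k = n\<close>; for odd \<open>p\<close> the degree is
    \<open>2 * (p ^ n - 1)\<close>, which is \<open>2 * p ^ n - 2\<close>.\<close>
  have P': "?P (p ^ n - 1)"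
    using P[of n "p ^ n - 1"] digit_sum_power_minus_1[OF prime_ge_2_nat[OF assms(1)]] by simp
  show ?thesis
  proof (intro conjI[of "odd p \<longrightarrow> _"] impI)
    assume "odd p"
    then have "p \<noteq> 2" by auto
    then show "(\<forall>d::nat. (\<exists>k\<ge>n. digit_sum p d = k * (p - 1)) \<longrightarrow>
           has_non_nilpotent_class (Aut_free_group (p ^ n)) (residue_ring (int p)) (2 * d) \<and>
           has_non_nilpotent_class (GL_int (p ^ n)) (residue_ring (int p)) (2 * d)) \<and>
        has_non_nilpotent_class (Aut_free_group (p ^ n)) (residue_ring (int p)) (2 * p ^ n - 2) \<and>
        has_non_nilpotent_class (GL_int (p ^ n)) (residue_ring (int p)) (2 * p ^ n - 2)"
      using P P' by (auto simp: diff_mult_distrib2)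
  next
    assume "p = 2"
    then show "(\<forall>d::nat. (\<exists>k\<ge>n. digit_sum 2 d = k) \<longrightarrow>
           has_non_nilpotent_class (Aut_free_group (2 ^ n)) (residue_ring 2) d \<and>
           has_non_nilpotent_class (GL_int (2 ^ n)) (residue_ring 2) d) \<and>
        has_non_nilpotent_class (Aut_free_group (2 ^ n)) (residue_ring 2) (2 ^ n - 1) \<and>
        has_non_nilpotent_class (GL_int (2 ^ n)) (residue_ring 2) (2 ^ n - 1)"
      using P P' by auto
  qed
qed

end
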